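(* Let $\chi\in H^2(\Omega)$, $g\in H^{1/2}(\Gamma)$ with $\chi\le g$ a.e. on $\Gamma$, and $f\in L^2(\Omega)$. Then the obstacle problem with data $(\chi,g,f)$ is equivalent to the obstacle problem with data $(0,\,g-\chi|_\Gamma,\,f+\Delta\chi)$: if $u\in H^1(\Omega)$ solves the obstacle problem with data $(0,\,g-\chi|_\Gamma,\,f+\Delta\chi)$, then $u+\chi$ is the unique solution of the obstacle problem with data $(\chi,g,f)$, and conversely, if $u$ solves the obstacle problem with data $(\chi,g,f)$, then $u-\chi$ solves the obstacle problem with data $(0,\,g-\chi|_\Gamma,\,f+\Delta\chi)$.
   Context: $\Omega\subset\mathbb{R}^2$ is a bounded domain with polygonal boundary $\Gamma=\partial\Omega$ (traces and $H^{1/2}(\Gamma)$ in the usual sense for Lipschitz polygonal domains). For an obstacle $\chi\in H^2(\Omega)$, Dirichlet data $g\in H^{1/2}(\Gamma)$ with $\chi\le g$ a.e. on $\Gamma$, and $f\in L^2(\Omega)$, the obstacle problem with data $(\chi,g,f)$ is: find $u\in\mathcal{A}:=\{v\in H^1(\Omega): v\ge\chi\text{ a.e. in }\Omega,\ v|_\Gamma=g\text{ a.e. on }\Gamma\}$ with $\mathcal{J}(u)=\min_{v\in\mathcal{A}}\mathcal{J}(v)$, where $\mathcal{J}(v)=\frac12\int_\Omega|\nabla v|^2\,dx-\int_\Omega fv\,dx$. This problem has a unique solution, which is equivalently characterized by $u\in\mathcal{A}$ and $\int_\Omega\nabla u\cdot\nabla(v-u)\,dx\ge\int_\Omega f(v-u)\,dx$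 for all $v\in\mathcal{A}$. *)

theory Defs
  imports "HOL-Analysis.Analysis"
begin

primrec k_smooth :: "nat \<Rightarrow> ('a::euclidean_space \<Rightarrow> real) \<Rightarrow> bool" where
  "k_smooth 0 \<phi> \<longleftrightarrow> continuous_on UNIV \<phi>"
| "k_smooth (Suc k) \<phi> \<longleftrightarrow> (\<forall>x. \<phi> differentiable (at x)) \<and>
     (\<forall>i\<in>Basis. k_smooth k (\<lambda>x. frechet_derivative \<phi> (at x) i))"

definition smooth :: "('a::euclidean_space \<Rightarrow> real) \<Rightarrow> bool" where
  "smooth \<phi> \<longleftrightarrow> (\<forall>k. k_smooth k \<phi>)"

definition test_function :: "'a::euclidean_space set \<Rightarrow> ('a \<Rightarrow> real) \<Rightarrow> bool" where
  "test_function \<Omega> \<phi> \<longleftrightarrow> smooth \<phi> \<and> compact (closure {x. \<phi> x \<noteq> 0}) \<and> closure {x. \<phi> x \<noteq> 0} \<subseteq> \<Omega>"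

definition L2 :: "'a measure \<Rightarrow> ('a \<Rightarrow> real) set" where
  "L2 M = {u \<in> borel_measurable M. integrable M (\<lambda>x. (u x)\<^sup>2)}"

definition L2_norm :: "'a measure \<Rightarrow> ('a \<Rightarrow> real) \<Rightarrow> real" where
  "L2_norm M u = sqrt (LINT x|M. (u x)\<^sup>2)"

text \<open>
  Elements of the spaces below are representatives: functions on the whole space whose values outside
  \<^term>\<open>\<Omega>\<close> (or off the boundary, for boundary data) are irrelevant. Equality in the spaces is equality
  almost everywhere.
\<close>

definition has_weak_partial ::
  "'a::euclidean_space set \<Rightarrow> 'a \<Rightarrow> ('a \<Rightarrow> real) \<Rightarrow> ('a \<Rightarrow> real) \<Rightarrow> bool" where
  "has_weak_partial \<Omega> i u v \<longleftrightarrow> u \<in> L2 (lebesgue_on \<Omega>) \<and> v \<in> L2 (lebesgue_on \<Omega>) \<and>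
     (\<forall>\<phi>. test_function \<Omega> \<phi> \<longrightarrow>
        (LINT x|lebesgue_on \<Omega>. u x * frechet_derivative \<phi> (at x) i) =
          - (LINT x|lebesgue_on \<Omega>. v x * \<phi> x))"

text \<open>The weak derivative is unique only almost everywhere; this picks a representative.\<close>

definition weak_partial :: "'a::euclidean_space set \<Rightarrow> 'a \<Rightarrow> ('a \<Rightarrow> real) \<Rightarrow> 'a \<Rightarrow> real" where
  "weak_partial \<Omega> i u = (SOME v. has_weak_partial \<Omega> i u v)"

definition weak_grad :: "'a::euclidean_space set \<Rightarrow> ('a \<Rightarrow> real) \<Rightarrow> 'a \<Rightarrow> 'a" where
  "weak_grad \<Omega> u x = (\<Sum>i\<in>Basis. weak_partial \<Omega> i u x *\<^sub>R i)"

definition weak_laplacian :: "'a::euclidean_space set \<Rightarrow> ('a \<Rightarrow> real) \<Rightarrow> 'a \<Rightarrow> real" where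
  "weak_laplacian \<Omega> u x = (\<Sum>i\<in>Basis. weak_partial \<Omega> i (weak_partial \<Omega> i u) x)"

definition H1 :: "'a::euclidean_space set \<Rightarrow> ('a \<Rightarrow> real) set" where
  "H1 \<Omega> = {u \<in> L2 (lebesgue_on \<Omega>). \<forall>i\<in>Basis. \<exists>v. has_weak_partial \<Omega> i u v}"

definition H2 :: "'a::euclidean_space set \<Rightarrow> ('a \<Rightarrow> real) set" where
  "H2 \<Omega> = {u \<in> H1 \<Omega>. \<forall>i\<in>Basis. weak_partial \<Omega> i u \<in> H1 \<Omega>}"

definition H1_norm :: "'a::euclidean_space set \<Rightarrow> ('a \<Rightarrow> real) \<Rightarrow> real" where
  "H1_norm \<Omega> u = sqrt (LINT x|lebesgue_on \<Omega>. (u x)\<^sup>2 + (norm (weak_grad \<Omega> u x))\<^sup>2)"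

text \<open>Near each boundary point, in an orthonormal frame with axes \<open>t\<close> and \<open>n\<close> centred there,
  \<^term>\<open>\<Omega>\<close> is the strict epigraph of a Lipschitz function.\<close>

definition lipschitz_boundary :: "(real^2) set \<Rightarrow> bool" where
  "lipschitz_boundary \<Omega> \<longleftrightarrow> (\<forall>x\<in>frontier \<Omega>. \<exists>t n. \<exists>\<gamma> :: real \<Rightarrow> real. \<exists>L \<epsilon>.
     norm t = 1 \<and> norm n = 1 \<and> t \<bullet> n = 0 \<and> L-lipschitz_on UNIV \<gamma> \<and> \<epsilon> > 0 \<and>
     (\<forall>y\<in>ball x \<epsilon>. y \<in> \<Omega> \<longleftrightarrow> \<gamma> ((y - x) \<bullet> t) < (y - x) \<bullet> n))"

text \<open>The set \<open>E\<close> lists the edges of the boundary by their end points. Distinct edges may meet only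
  in common end points; in particular each edge is listed with one orientation only. Several boundary
  components are allowed.\<close>

definition polygonal_domain :: "(real^2) set \<Rightarrow> ((real^2) \<times> (real^2)) set \<Rightarrow> bool" where
  "polygonal_domain \<Omega> E \<longleftrightarrow>
     open \<Omega> \<and> connected \<Omega> \<and> bounded \<Omega> \<and> \<Omega> \<noteq> {} \<and> lipschitz_boundary \<Omega> \<and>
     finite E \<and> (\<forall>(a, b)\<in>E. a \<noteq> b) \<and>
     (\<forall>(a, b)\<in>E. \<forall>(c, d)\<in>E. (a, b) \<noteq> (c, d) \<longrightarrow>
        closed_segment a b \<inter> closed_segment c d \<subseteq> {a, b} \<inter> {c, d}) \<and>
     frontier \<Omega> = (\<Union>(a, b)\<in>E. closed_segment a b)"

text \<open>Arc length on the union of the edges, as a complete measure; the lemma below shows that the set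
  function is countably additive, so that \<^const>\<open>measure_of\<close> does not collapse to the zero measure.\<close>

definition boundary_measure :: "((real^2) \<times> (real^2)) set \<Rightarrow> (real^2) measure" where
  "boundary_measure E = completion (measure_of UNIV (sets borel)
     (\<lambda>A. \<Sum>(a, b)\<in>E. ennreal (dist a b) * emeasure lborel {t \<in> {0..1}. linepath a b t \<in> A}))"

lemma emeasure_boundary_measure:
  assumes "A \<in> sets borel"
  shows "emeasure (boundary_measure E) A =
    (\<Sum>(a, b)\<in>E. ennreal (dist a b) * emeasure lborel {t \<in> {0..1}. linepath a b t \<in> A})"
proof -
  let ?\<mu> = "\<lambda>A. \<Sum>(a, b)\<in>E. ennreal (dist a b) * emeasure lborel {t \<in> {0..1}. linepath a b t \<in> A}"
  let ?M = "measure_of UNIV (sets borel) ?\<mu>"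
  have meas: "{t \<in> {0..1}. linepath a b t \<in> B} \<in> sets lborel"
    if "B \<in> sets borel" for a b :: "real^2" and B
  proof -
    have "linepath a b \<in> borel_measurable borel"
      by (intro borel_measurable_continuous_onI continuous_on_linepath)
    then have "linepath a b -` B \<inter> space borel \<in> sets borel"
      using that by (rule measurable_sets)
    moreover have "{t \<in> {0..1}. linepath a b t \<in> B} = {0..1} \<inter> (linepath a b -` B \<inter> space borel)"
      by auto
    ultimately show ?thesis by auto
  qed
  have ca: "countably_additive (sets borel) ?\<mu>"
  proof (rule countably_additiveI)
    fix F :: "nat \<Rightarrow> (real^2) set"
    assume F: "range F \<subseteq> sets borel" "disjoint_family F"
    have *: "(\<Sum>k. emeasure lborel {t \<in> {0..1}. linepath a b t \<in> F k}) =
        emeasure lborel {t \<in> {0..1}. linepath a b t \<in> (\<Union>k. F k)}" for a b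
    proof -
      have "(\<Sum>k. emeasure lborel {t \<in> {0..1}. linepath a b t \<in> F k}) =
          emeasure lborel (\<Union>k. {t \<in> {0..1}. linepath a b t \<in> F k})"
        using F meas by (intro suminf_emeasure) (auto simp: disjoint_family_on_def)
      also have "(\<Union>k. {t \<in> {0..1}. linepath a b t \<in> F k}) =
          {t \<in> {0..1}. linepath a b t \<in> (\<Union>k. F k)}" by auto
      finally show ?thesis .
    qed
    show "(\<Sum>k. ?\<mu> (F k)) = ?\<mu> (\<Union>k. F k)"
      by (subst suminf_sum) (simp_all only: case_prod_unfold ennreal_suminf_cmult * summableI)
  qed
  have sa: "sigma_algebra UNIV (sets (borel :: (real^2) measure))"
    using sets.sigma_algebra_axioms[of "borel :: (real^2) measure"] by simp
  have "positive (sets borel) ?\<mu>"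
    by (simp add: positive_def case_prod_unfold)
  then have "emeasure ?M A = ?\<mu> A"
    using sa ca assms by (intro emeasure_measure_of_sigma)
  moreover have "A \<in> sets ?M"
    using sigma_algebra.sets_measure_of_eq[OF sa] assms by simp
  ultimately show ?thesis
    unfolding boundary_measure_def by (simp only: emeasure_completion sets_completionI_sets main_part)
qed

text \<open>
  The graph of the trace operator: the closure, in \<open>H1 \<times> L2\<close>, of the restriction to the boundary
  of functions that are smooth up to the boundary. Stating it as a relation needs neither the density
  of these functions nor the trace theorem, which say that it is the graph of an operator on all of \<open>H1\<close>.
\<close>

definition has_trace ::
  "(real^2) set \<Rightarrow> ((real^2) \<times> (real^2)) set \<Rightarrow> (real^2 \<Rightarrow> real) \<Rightarrow> (real^2 \<Rightarrow> real) \<Rightarrow> bool" where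
  "has_trace \<Omega> E u g \<longleftrightarrow> u \<in> H1 \<Omega> \<and> g \<in> L2 (boundary_measure E) \<and>
     (\<exists>\<phi> :: nat \<Rightarrow> real^2 \<Rightarrow> real. (\<forall>k. smooth (\<phi> k)) \<and>
        (\<lambda>k. H1_norm \<Omega> (\<lambda>x. \<phi> k x - u x)) \<longlonglongrightarrow> 0 \<and>
        (\<lambda>k. L2_norm (boundary_measure E) (\<lambda>x. \<phi> k x - g x)) \<longlonglongrightarrow> 0)"

definition H_half :: "(real^2) set \<Rightarrow> ((real^2) \<times> (real^2)) set \<Rightarrow> (real^2 \<Rightarrow> real) set" where
  "H_half \<Omega> E = {g. \<exists>v\<in>H1 \<Omega>. has_trace \<Omega> E v g}"

definition obstacle_set ::
  "(real^2) set \<Rightarrow> ((real^2) \<times> (real^2)) set \<Rightarrow> (real^2 \<Rightarrow> real) \<Rightarrow> (real^2 \<Rightarrow> real) \<Rightarrow> (real^2 \<Rightarrow> real) set"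
  where
  "obstacle_set \<Omega> E \<psi> g =
     {v \<in> H1 \<Omega>. (AE x in lebesgue_on \<Omega>. v x \<ge> \<psi> x) \<and> has_trace \<Omega> E v g}"

definition energy :: "(real^2) set \<Rightarrow> (real^2 \<Rightarrow> real) \<Rightarrow> (real^2 \<Rightarrow> real) \<Rightarrow> real" where
  "energy \<Omega> f v = 1/2 * (LINT x|lebesgue_on \<Omega>. (norm (weak_grad \<Omega> v x))\<^sup>2)
     - (LINT x|lebesgue_on \<Omega>. f x * v x)"

definition solves_obstacle ::
  "(real^2) set \<Rightarrow> ((real^2) \<times> (real^2)) set \<Rightarrow> (real^2 \<Rightarrow> real) \<Rightarrow> (real^2 \<Rightarrow> real) \<Rightarrow> (real^2 \<Rightarrow> real)
     \<Rightarrow> (real^2 \<Rightarrow> real) \<Rightarrow> bool" where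
  "solves_obstacle \<Omega> E \<psi> g f u \<longleftrightarrow>
     u \<in> obstacle_set \<Omega> E \<psi> g \<and> (\<forall>v\<in>obstacle_set \<Omega> E \<psi> g. energy \<Omega> f u \<le> energy \<Omega> f v)"

end

theory Submission
  imports Defs
begin

text \<open>
  On functions with a fixed trace, the two energies differ by a constant after the shift by \<open>\<psi>\<close>. This
  amounts to integrating by parts a function \<open>d\<close> with zero trace against a weakly differentiable
  \<open>p\<close>, applied to the partial derivatives of \<open>\<psi>\<close>. Localise \<open>p\<close> by cutoffs and mollify it with
  kernels that are shifted into the domain, so that the mollified function is locally Lipschitz on the whole
  plane and its derivative is the mollified weak derivative. Approximating \<open>d\<close> by smooth functions
  then leaves a boundary term, which is bounded by the \<open>L2\<close> norm of the approximants on the boundary: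
  writing a directional derivative as a limit of difference quotients, only the parallelograms swept
  by the edges under a small translation contribute.
  The same integration by parts, against a coordinate times the difference of two solutions,
  shows that a function with zero gradient and zero trace vanishes; uniqueness follows by strict
  convexity.
\<close>

section \<open>Smooth functions and cutoffs\<close>

text \<open>A function with trace zero comes with smooth approximants whose boundary values tend to
  zero, and a general function of \<open>H1\<close> comes with no such sequence. So the two factors
  of the integration by parts are treated differently: the approximants of \<open>d\<close> are used
  as given, while \<open>p\<close> has to be regularised up to the boundary. A centred kernel at a
  point near the boundary reaches outside the domain and is no test function there, so the weak
  derivative cannot be moved onto it. The shift into the domain repairs this, but its direction
  depends on the local Lipschitz graph, whence the cutoffs. All integrals pair the mollified
  function with fixed \<open>L2\<close> functions, so weak convergence suffices, and that is a
  statement about correlations under small translations. Because the boundary term only has to tend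
  to zero, an upper bound for it is enough, and it can be obtained without normals. In the
  uniqueness part the coordinate factor takes the place of a Poincare inequality.\<close>

abbreviation pderiv_at :: "('a::euclidean_space \<Rightarrow> real) \<Rightarrow> 'a \<Rightarrow> 'a \<Rightarrow> real" where
  "pderiv_at \<phi> i x \<equiv> frechet_derivative \<phi> (at x) i"

text \<open>Admits any explicit derivative in place of \<open>frechet_derivative\<close>. Each
  closure property below is then an induction on the order, the derivative being a combination of
  functions covered by the induction hypothesis.\<close>

lemma k_smooth_SucI:
  assumes "\<And>x. (\<phi> has_derivative \<phi>' x) (at x)"
    and "\<And>i. i \<in> Basis \<Longrightarrow> k_smooth k (\<lambda>x. \<phi>' x i)"
  shows "k_smooth (Suc k) \<phi>"
proof -
  have "frechet_derivative \<phi> (at x) = \<phi>' x" for x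
    using frechet_derivative_at[OF assms(1)] by simp
  then show ?thesis
    using assms by (auto simp: differentiable_def)
qed

lemma k_smooth_SucD:
  assumes "k_smooth (Suc k) \<phi>"
  shows "(\<phi> has_derivative frechet_derivative \<phi> (at x)) (at x)"
    and "i \<in> Basis \<Longrightarrow> k_smooth k (pderiv_at \<phi> i)"
  using assms by (auto simp: frechet_derivative_works)

lemma k_smooth_Suc_imp: "k_smooth (Suc k) \<phi> \<Longrightarrow> k_smooth k \<phi>"
proof (induction k arbitrary: \<phi>)
  case 0
  then show ?case
    by (auto intro!: continuous_at_imp_continuous_on differentiable_imp_continuous_within)
next
  case (Suc k)
  then show ?case by (metis k_smooth.simps(2))
qed

lemma k_smooth_const: "k_smooth k (\<lambda>x. c)"
proof (induction k arbitrary: c)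
  case (Suc k)
  then show ?case by (intro k_smooth_SucI[where \<phi>'="\<lambda>x h. 0"]) auto
qed simp

lemma k_smooth_add:
  "k_smooth k \<phi> \<Longrightarrow> k_smooth k \<eta> \<Longrightarrow> k_smooth k (\<lambda>x. \<phi> x + \<eta> x)"
proof (induction k arbitrary: \<phi> \<eta>)
  case (Suc k)
  show ?case
    by (rule k_smooth_SucI[OF has_derivative_add[OF Suc.prems[THEN k_smooth_SucD(1)]]])
       (intro Suc.IH Suc.prems[THEN k_smooth_SucD(2)])
qed (auto intro: continuous_intros)

lemma k_smooth_mult:
  "k_smooth k \<phi> \<Longrightarrow> k_smooth k \<eta> \<Longrightarrow> k_smooth k (\<lambda>x. \<phi> x * \<eta> x)"
proof (induction k arbitrary: \<phi> \<eta>)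
  case (Suc k)
  show ?case
    by (rule k_smooth_SucI[OF has_derivative_mult[OF Suc.prems[THEN k_smooth_SucD(1)]]])
       (intro k_smooth_add Suc.IH Suc.prems[THEN k_smooth_SucD(2)] Suc.prems[THEN k_smooth_Suc_imp])
qed (auto intro: continuous_intros)

lemma k_smooth_inner: "k_smooth k (\<lambda>x. x \<bullet> b)"
proof (cases k)
  case (Suc j)
  have "((\<lambda>x. x \<bullet> b) has_derivative (\<lambda>h. h \<bullet> b)) (at x)" for x
    by (auto intro!: derivative_eq_intros)
  then show ?thesis unfolding Suc by (rule k_smooth_SucI) (rule k_smooth_const)
qed (auto intro: continuous_intros)

lemma k_smooth_shift: "k_smooth k \<phi> \<Longrightarrow> k_smooth k (\<lambda>x. \<phi> (x - c))"
proof (induction k arbitrary: \<phi>)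
  case 0
  then show ?case
    by (auto intro!: continuous_on_compose2[of UNIV \<phi>] continuous_intros)
next
  case (Suc k)
  have "((\<lambda>x. \<phi> (x - c)) has_derivative frechet_derivative \<phi> (at (x - c))) (at x)" for x
  proof (rule has_derivative_compose[where f = "\<lambda>x. x - c" and f' = "\<lambda>h. h"])
    show "((\<lambda>x. x - c) has_derivative (\<lambda>h. h)) (at x)"
      by (auto intro!: derivative_eq_intros)
  qed (rule k_smooth_SucD(1)[OF Suc.prems])
  then show ?case
    by (rule k_smooth_SucI) (use Suc.IH k_smooth_SucD(2)[OF Suc.prems] in auto)
qed

lemma k_smooth_inverse:
  "k_smooth k \<phi> \<Longrightarrow> (\<And>x. \<phi> x \<noteq> 0) \<Longrightarrow> k_smooth k (\<lambda>x. inverse (\<phi> x))"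
proof (induction k arbitrary: \<phi>)
  case (Suc k)
  have "((\<lambda>x. inverse (\<phi> x)) has_derivative
     (\<lambda>h. (- 1) * (inverse (\<phi> x) * frechet_derivative \<phi> (at x) h * inverse (\<phi> x)))) (at x)" for x
    by (rule has_derivative_eq_rhs[OF Deriv.has_derivative_inverse[OF Suc.prems(2) k_smooth_SucD(1)[OF Suc.prems(1)]]])
       auto
  then show ?case
    by (rule k_smooth_SucI)
       (intro k_smooth_mult k_smooth_const Suc.IH Suc.prems(2) k_smooth_SucD(2)[OF Suc.prems(1)]
          k_smooth_Suc_imp[OF Suc.prems(1)])
qed (auto intro: continuous_intros)

text \<open>Differentiating exp(-1/t) only multiplies it by polynomials in 1/t. The family indexed
  by \<open>m\<close> is therefore closed under differentiation up to linear combinations, and all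
  members are smooth by one induction (\<open>k_smooth_flat\<close>).\<close>

definition flat :: "nat \<Rightarrow> real \<Rightarrow> real" where
  "flat m t = (if t > 0 then exp (- inverse t) * inverse t ^ m else 0)"

text \<open>With s = 1/t this is the decay of s^m exp(-s) at infinity; on the left the function is
  zero.\<close>

lemma flat_tendsto_0: "(flat m \<longlongrightarrow> 0) (at 0)"
proof -
  have "((\<lambda>t::real. inverse t ^ m / exp (inverse t)) \<longlongrightarrow> 0) (at_right 0)"
    using filterlim_compose[OF tendsto_power_div_exp_0 filterlim_inverse_at_top_right] .
  moreover have "\<forall>\<^sub>F t::real in at_right 0. inverse t ^ m / exp (inverse t) = flat m t"
    by (auto simp: eventually_at_filter flat_def exp_minus field_simps)
  ultimately have "(flat m \<longlongrightarrow> 0) (at_right 0)"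
    by (rule Lim_transform_eventually)
  moreover have "(flat m \<longlongrightarrow> 0) (at_left 0)"
    by (rule Lim_transform_eventually[OF tendsto_const])
       (auto simp: eventually_at_filter flat_def)
  ultimately show ?thesis by (simp add: filterlim_split_at)
qed

lemma DERIV_flat: "(flat m has_real_derivative flat (m + 2) t - m * flat (m + 1) t) (at t)"
proof -
  consider "t > 0" | "t < 0" | "t = 0" by linarith
  then show ?thesis
  proof cases
    case 1
    have inv: "(inverse has_real_derivative - (inverse t ^ 2)) (at t)"
      using DERIV_inverse[of t] 1 by (simp add: numeral_2_eq_2)
    have "((\<lambda>t. exp (- inverse t) * inverse t ^ m) has_real_derivative
        exp (- inverse t) * inverse t ^ (m + 2) - (m * inverse t ^ (m - 1) * inverse t ^ 2) * exp (- inverse t)) (at t)"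
      by (rule DERIV_cong[OF DERIV_mult[OF DERIV_fun_exp[OF DERIV_minus[OF inv]] DERIV_power[OF inv]]])
         (simp add: power_add power2_eq_square algebra_simps)
    also have "m * inverse t ^ (m - 1) * inverse t ^ 2 = m * inverse t ^ (m + 1)"
      by (cases m) (auto simp: power2_eq_square)
    finally have "((\<lambda>t. exp (- inverse t) * inverse t ^ m) has_real_derivative
        flat (m + 2) t - m * flat (m + 1) t) (at t)"
      using 1 by (simp add: flat_def algebra_simps)
    moreover have "\<forall>\<^sub>F s in nhds t. exp (- inverse s) * inverse s ^ m = flat m s"
      using eventually_nhds_in_open[of "{0<..}" t] 1
      by (auto simp: flat_def elim!: eventually_mono)
    ultimately show ?thesis
      by (rule DERIV_cong_ev[OF refl _ refl, THEN iffD1, rotated])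
  next
    case 2
    have "\<forall>\<^sub>F s in nhds t. 0 = flat m s"
      using eventually_nhds_in_open[of "{..<0}" t] 2
      by (auto simp: flat_def elim!: eventually_mono)
    moreover have "flat (m + 2) t - m * flat (m + 1) t = 0"
      using 2 by (simp add: flat_def)
    ultimately show ?thesis
      using DERIV_cong_ev[OF refl _ refl, of "\<lambda>_. 0" "flat m" t 0] DERIV_const[of 0 "at t"]
      by (simp only:)
  next
    case 3
    \<comment> \<open>At the origin the difference quotient of \<open>flat m\<close> is
      \<open>flat (m + 1)\<close> itself, so the derivative there is the limit just
      computed.\<close>
    have "(\<lambda>h. (flat m h - flat m 0) / (h - 0)) = flat (m + 1)"
      by (auto simp: flat_def divide_inverse)
    moreover have "flat (m + 2) t - m * flat (m + 1) t = 0"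
      using 3 by (simp add: flat_def)
    ultimately show ?thesis
      using flat_tendsto_0[of "m + 1"] unfolding has_field_derivative_iff 3 by (simp only:)
  qed
qed

text \<open>The index \<open>m\<close> is generalised because differentiation leads to
  \<open>m + 1\<close> and \<open>m + 2\<close>.\<close>

lemma k_smooth_flat: "k_smooth k \<phi> \<Longrightarrow> k_smooth k (\<lambda>x. flat m (\<phi> x))"
proof (induction k arbitrary: m)
  case 0
  have "continuous_on UNIV (flat m)"
    by (intro continuous_at_imp_continuous_on ballI DERIV_isCont[OF DERIV_flat])
  with 0 show ?case
    by (auto intro!: continuous_on_compose2[of UNIV "flat m"])
next
  case (Suc k)
  have "((\<lambda>x. flat m (\<phi> x)) has_derivative
      (\<lambda>h. frechet_derivative \<phi> (at x) h * (flat (m + 2) (\<phi> x) + (- m) * flat (m + 1) (\<phi> x)))) (at x)" for x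
    using DERIV_compose_FDERIV[OF DERIV_flat[of m "\<phi> x"] k_smooth_SucD(1)[OF Suc.prems]]
    by simp
  then show ?case
    by (rule k_smooth_SucI)
       (intro k_smooth_mult k_smooth_add k_smooth_const Suc.IH k_smooth_SucD(2)[OF Suc.prems]
          k_smooth_Suc_imp[OF Suc.prems])
qed

lemma flat_nonneg: "flat m t \<ge> 0" and flat_pos_iff: "flat m t > 0 \<longleftrightarrow> t > 0"
  by (auto simp: flat_def)

lemma smooth_const: "smooth (\<lambda>x. c)"
  and smooth_inner: "smooth (\<lambda>x. x \<bullet> b)"
  and smooth_add: "smooth \<phi> \<Longrightarrow> smooth \<eta> \<Longrightarrow> smooth (\<lambda>x. \<phi> x + \<eta> x)"
  and smooth_mult: "smooth \<phi> \<Longrightarrow> smooth \<eta> \<Longrightarrow> smooth (\<lambda>x. \<phi> x * \<eta> x)"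
  and smooth_shift: "smooth \<phi> \<Longrightarrow> smooth (\<lambda>x. \<phi> (x - d))"
  and smooth_inverse: "smooth \<phi> \<Longrightarrow> (\<And>x. \<phi> x \<noteq> 0) \<Longrightarrow> smooth (\<lambda>x. inverse (\<phi> x))"
  and smooth_flat: "smooth \<phi> \<Longrightarrow> smooth (\<lambda>x. flat m (\<phi> x))"
  by (auto simp: smooth_def k_smooth_const k_smooth_inner k_smooth_add k_smooth_mult k_smooth_shift
      k_smooth_inverse k_smooth_flat)

lemma smooth_diff: "smooth \<phi> \<Longrightarrow> smooth \<eta> \<Longrightarrow> smooth (\<lambda>x. \<phi> x - \<eta> x)"
  using smooth_add[of \<phi> "\<lambda>x. (- 1) * \<eta> x"] smooth_mult[OF smooth_const, of \<eta> "- 1"] by simp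

lemma smooth_sum: "finite A \<Longrightarrow> (\<And>a. a \<in> A \<Longrightarrow> smooth (\<phi> a)) \<Longrightarrow> smooth (\<lambda>x. \<Sum>a\<in>A. \<phi> a x)"
  by (induction A rule: finite_induct) (auto intro: smooth_const smooth_add)

lemma smooth_has_derivative:
  "smooth \<phi> \<Longrightarrow> (\<phi> has_derivative frechet_derivative \<phi> (at x)) (at x)"
  using k_smooth_SucD(1) smooth_def by blast

lemma smooth_pderiv: "smooth \<phi> \<Longrightarrow> i \<in> Basis \<Longrightarrow> smooth (pderiv_at \<phi> i)"
  using k_smooth_SucD(2) unfolding smooth_def by blast

lemma smooth_continuous: "smooth \<phi> \<Longrightarrow> continuous_on S \<phi>"
  using continuous_on_subset[OF _ subset_UNIV] k_smooth.simps(1) unfolding smooth_def by blast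

lemma pderiv_mult:
  assumes "smooth \<phi>" "smooth \<eta>"
  shows "pderiv_at (\<lambda>x. \<phi> x * \<eta> x) i x = \<phi> x * pderiv_at \<eta> i x + pderiv_at \<phi> i x * \<eta> x"
  using fun_cong[OF frechet_derivative_at[OF has_derivative_mult[OF assms[THEN smooth_has_derivative]]], of x i]
  by simp

lemma smooth_lipschitz_on_cball:
  fixes \<phi> :: "'a::euclidean_space \<Rightarrow> real"
  assumes "smooth \<phi>"
  obtains L where "L-lipschitz_on (cball 0 R) \<phi>"
proof -
  have "\<exists>M. \<forall>x\<in>cball 0 R. \<bar>pderiv_at \<phi> i x\<bar> \<le> M" if "i \<in> Basis" for i
    using compact_continuous_image[OF smooth_continuous[OF smooth_pderiv[OF assms that]] compact_cball, THEN compact_imp_bounded]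
    by (force simp: bounded_iff)
  then obtain M where M: "\<And>i x. i \<in> Basis \<Longrightarrow> x \<in> cball 0 R \<Longrightarrow> \<bar>pderiv_at \<phi> i x\<bar> \<le> M i"
    by metis
  \<comment> \<open>The absolute values keep \<open>L\<close> nonnegative even if the ball is empty
    and \<open>M\<close> is arbitrary.\<close>
  define L where "L = (\<Sum>i\<in>Basis. \<bar>M i\<bar>)"
  have "norm (\<phi> x - \<phi> y) \<le> L * norm (x - y)" if "x \<in> cball 0 R" "y \<in> cball 0 R" for x y
  proof (rule differentiable_bound[OF convex_cball _ _ that, where f' = "\<lambda>z. frechet_derivative \<phi> (at z)"])
    fix z :: 'a assume z: "z \<in> cball 0 R"
    show "(\<phi> has_derivative frechet_derivative \<phi> (at z)) (at z within cball 0 R)"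
      using smooth_has_derivative[OF assms] has_derivative_at_withinI by blast
    have "norm (frechet_derivative \<phi> (at z) h) \<le> L * norm h" for h
    proof -
      have lin: "linear (frechet_derivative \<phi> (at z))"
        using has_derivative_linear[OF smooth_has_derivative[OF assms]] .
      have "frechet_derivative \<phi> (at z) h = (\<Sum>i\<in>Basis. (h \<bullet> i) * pderiv_at \<phi> i z)"
        using linear_sum[OF lin, of "\<lambda>i. (h \<bullet> i) *\<^sub>R i" Basis] linear_scale[OF lin]
        by (simp add: euclidean_representation)
      also have "norm \<dots> \<le> (\<Sum>i\<in>Basis. norm h * \<bar>M i\<bar>)"
      proof (rule sum_norm_le)
        fix i :: 'a assume i: "i \<in> Basis"
        show "norm ((h \<bullet> i) * pderiv_at \<phi> i z) \<le> norm h * \<bar>M i\<bar>"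
          using M[OF i z] Basis_le_norm[OF i, of h]
          unfolding real_norm_def abs_mult by (intro mult_mono) auto
      qed
      finally show ?thesis by (simp add: L_def sum_distrib_left mult.commute)
    qed
    then show "onorm (frechet_derivative \<phi> (at z)) \<le> L"
      by (intro onorm_le) (simp add: mult.commute)
  qed
  then have "L-lipschitz_on (cball 0 R) \<phi>"
    by (intro lipschitz_onI) (auto simp: dist_norm L_def sum_nonneg)
  then show thesis by (rule that)
qed

text \<open>The kernel of every mollification and the source of test functions. The squared norm
  keeps the argument of \<open>flat 0\<close> smooth at the centre too.\<close>

definition bump :: "'a::euclidean_space \<Rightarrow> real \<Rightarrow> 'a \<Rightarrow> real" where
  "bump c r x = flat 0 (r\<^sup>2 - (norm (x - c))\<^sup>2)"

lemma smooth_norm_sq: "smooth (\<lambda>x::'a::euclidean_space. (norm (x - c))\<^sup>2)"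
proof -
  have "smooth (\<lambda>x::'a. \<Sum>i\<in>Basis. (x \<bullet> i) * (x \<bullet> i))"
    by (intro smooth_sum smooth_mult smooth_inner finite_Basis)
  then have "smooth (\<lambda>x::'a. (norm x)\<^sup>2)"
    by (simp add: norm_eq_sqrt_inner euclidean_inner[symmetric])
  then show ?thesis by (rule smooth_shift)
qed

lemma smooth_bump: "smooth (bump c r)"
  unfolding bump_def by (intro smooth_flat smooth_diff smooth_const smooth_norm_sq)

lemma bump_nonneg: "bump c r x \<ge> 0"
  by (simp add: bump_def flat_nonneg)

lemma bump_pos_iff: "r > 0 \<Longrightarrow> bump c r x > 0 \<longleftrightarrow> x \<in> ball c r"
  using power_strict_mono[of "norm (c - x)" r 2] power2_less_imp_less[of "norm (c - x)" r]
  by (auto simp: bump_def flat_pos_iff dist_norm norm_minus_commute)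

lemma bump_eq_0_iff: "r > 0 \<Longrightarrow> bump c r x = 0 \<longleftrightarrow> x \<notin> ball c r"
  using bump_pos_iff[of r c x] bump_nonneg[of c r x] by linarith

lemma bump_le_1: "bump c r x \<le> 1"
  by (simp add: bump_def flat_def)

text \<open>A quotient f / (f + h), where f is positive exactly inside the ball of radius
  \<open>s\<close> and h exactly outside the closed ball of radius \<open>r\<close>. As r < s, one
  of them is positive at every point, so the denominator never vanishes.\<close>

lemma cutoff_exists:
  fixes c :: "'a::euclidean_space"
  assumes "0 < r" "r < s"
  obtains \<theta> where "smooth \<theta>" "\<And>x. x \<in> ball c r \<Longrightarrow> \<theta> x = 1" "\<And>x. x \<notin> ball c s \<Longrightarrow> \<theta> x = 0"
proof -
  define \<theta> where "\<theta> x = flat 0 (s\<^sup>2 - (norm (x - c))\<^sup>2) *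
    inverse (flat 0 (s\<^sup>2 - (norm (x - c))\<^sup>2) + flat 0 ((norm (x - c))\<^sup>2 - r\<^sup>2))" for x
  have rs: "r\<^sup>2 < s\<^sup>2" using assms by (simp add: power_strict_mono)
  have "flat 0 (s\<^sup>2 - (norm (x - c))\<^sup>2) + flat 0 ((norm (x - c))\<^sup>2 - r\<^sup>2) \<noteq> 0" for x
    using rs by (auto simp: flat_def add_pos_pos less_imp_neq[symmetric])
  then have "smooth \<theta>"
    unfolding \<theta>_def by (intro smooth_mult smooth_inverse smooth_add smooth_flat smooth_diff smooth_const smooth_norm_sq) auto
  moreover have "\<theta> x = 1" if "x \<in> ball c r" for x
  proof -
    have "(norm (x - c))\<^sup>2 < r\<^sup>2"
      using that by (auto simp: dist_norm norm_minus_commute intro: power_strict_mono)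
    then show ?thesis using rs by (simp add: \<theta>_def flat_def)
  qed
  moreover have "\<theta> x = 0" if "x \<notin> ball c s" for x
  proof -
    have "s\<^sup>2 \<le> (norm (x - c))\<^sup>2"
      using that assms by (auto simp: dist_norm norm_minus_commute intro: power_mono)
    then show ?thesis by (simp add: \<theta>_def flat_def)
  qed
  ultimately show thesis by (rule that)
qed

lemma test_function_bump:
  assumes "r > 0" "cball c r \<subseteq> \<Omega>"
  shows "test_function \<Omega> (bump c r)"
proof -
  have "{x. bump c r x \<noteq> 0} = ball c r" by (auto simp: bump_eq_0_iff[OF assms(1)])
  then show ?thesis using assms by (simp add: test_function_def smooth_bump)
qed

lemma test_function_mult:
  assumes "smooth \<theta>" "test_function \<Omega> \<phi>"
  shows "test_function \<Omega> (\<lambda>x. \<theta> x * \<phi> x)"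
proof -
  have sub: "closure {x. \<theta> x * \<phi> x \<noteq> 0} \<subseteq> closure {x. \<phi> x \<noteq> 0}"
    by (intro closure_mono) auto
  moreover have "compact (closure {x. \<theta> x * \<phi> x \<noteq> 0})"
    using assms(2) compact_Int_closed[of "closure {x. \<phi> x \<noteq> 0}" "closure {x. \<theta> x * \<phi> x \<noteq> 0}"] sub
    by (auto simp: test_function_def Int_absorb1)
  ultimately show ?thesis
    using assms smooth_mult[OF assms(1), of \<phi>] unfolding test_function_def by blast
qed

section \<open>Square integrable functions and translation\<close>

lemma L2D:
  assumes "u \<in> L2 M"
  shows "u \<in> borel_measurable M" "integrable M (\<lambda>x. (u x)\<^sup>2)"
  using assms by (auto simp: L2_def)

lemma L2_mult_integrable:
  assumes "u \<in> L2 M" "v \<in> L2 M"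
  shows "integrable M (\<lambda>x. u x * v x)"
proof (rule Bochner_Integration.integrable_bound[of M "\<lambda>x. (u x)\<^sup>2 + (v x)\<^sup>2"])
  note [measurable] = assms[THEN L2D(1)]
  show "(\<lambda>x. u x * v x) \<in> borel_measurable M" by measurable
  show "AE x in M. norm (u x * v x) \<le> norm ((u x)\<^sup>2 + (v x)\<^sup>2)"
  proof (rule AE_I2)
    fix x
    have "2 * \<bar>u x * v x\<bar> \<le> (u x)\<^sup>2 + (v x)\<^sup>2"
      using sum_squares_bound[of "\<bar>u x\<bar>" "\<bar>v x\<bar>"] by (simp add: abs_mult)
    then show "norm (u x * v x) \<le> norm ((u x)\<^sup>2 + (v x)\<^sup>2)" by simp
  qed
qed (use assms in \<open>auto dest: L2D\<close>)

lemma L2_add: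
  assumes "u \<in> L2 M" "v \<in> L2 M"
  shows "(\<lambda>x. u x + v x) \<in> L2 M"
  using assms L2_mult_integrable[OF assms] by (auto simp: L2_def power2_sum mult.assoc)

lemma L2_bounded_mult:
  assumes "v \<in> L2 M" "\<theta> \<in> borel_measurable M" "\<And>x. x \<in> space M \<Longrightarrow> \<bar>\<theta> x\<bar> \<le> B"
  shows "(\<lambda>x. \<theta> x * v x) \<in> L2 M"
proof -
  note [measurable] = L2D(1)[OF assms(1)] assms(2)
  have "integrable M (\<lambda>x. (\<theta> x * v x)\<^sup>2)"
  proof (rule Bochner_Integration.integrable_bound[of M "\<lambda>x. B\<^sup>2 * (v x)\<^sup>2"])
    show "AE x in M. norm ((\<theta> x * v x)\<^sup>2) \<le> norm (B\<^sup>2 * (v x)\<^sup>2)"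
    proof (rule AE_I2)
      fix x assume "x \<in> space M"
      then have "(\<theta> x)\<^sup>2 \<le> B\<^sup>2" using assms(3) abs_ge_zero order_trans by (intro power2_le_iff_abs_le[THEN iffD2]) blast+
      then show "norm ((\<theta> x * v x)\<^sup>2) \<le> norm (B\<^sup>2 * (v x)\<^sup>2)"
        by (simp add: power_mult_distrib mult_right_mono)
    qed
  qed (use L2D(2)[OF assms(1)] in auto)
  then show ?thesis by (simp add: L2_def)
qed

lemma L2_cmult: "v \<in> L2 M \<Longrightarrow> (\<lambda>x. c * v x) \<in> L2 M"
  by (rule L2_bounded_mult[of v M "\<lambda>x. c" "\<bar>c\<bar>"]) auto

lemma L2_diff: "u \<in> L2 M \<Longrightarrow> v \<in> L2 M \<Longrightarrow> (\<lambda>x. u x - v x) \<in> L2 M"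
  using L2_add[of u M "\<lambda>x. (- 1) * v x"] L2_cmult[of v M "- 1"] by simp

lemma L2_sum:
  "finite A \<Longrightarrow> (\<And>a. a \<in> A \<Longrightarrow> v a \<in> L2 M) \<Longrightarrow> (\<lambda>x. \<Sum>a\<in>A. v a x) \<in> L2 M"
proof (induction A rule: finite_induct)
  case empty
  show ?case by (simp add: L2_def)
next
  case (insert a A)
  then have "(\<lambda>x. v a x + (\<Sum>a\<in>A. v a x)) \<in> L2 M" by (intro L2_add) auto
  with insert.hyps show ?case by simp
qed

lemma (in finite_measure) L2_bounded:
  assumes "\<theta> \<in> borel_measurable M" "\<And>x. x \<in> space M \<Longrightarrow> \<bar>\<theta> x\<bar> \<le> B"
  shows "\<theta> \<in> L2 M"
  using L2_bounded_mult[OF _ assms, of "\<lambda>x. 1"] by (simp add: L2_def)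

lemma (in finite_measure) L2_integrable: "v \<in> L2 M \<Longrightarrow> integrable M v"
  using L2_mult_integrable[of v M "\<lambda>x. 1"] L2_bounded[of "\<lambda>x. 1" 1] by simp

lemma L2_norm_nonneg: "L2_norm M u \<ge> 0"
  by (simp add: L2_norm_def)

lemma L2_norm_sq: "(L2_norm M u)\<^sup>2 = (LINT x|M. (u x)\<^sup>2)"
  by (simp add: L2_norm_def)

text \<open>The absolute value stands inside the integral because the boundary term of Green's
  estimate has that form.\<close>

lemma L2_cauchy_schwarz:
  assumes "u \<in> L2 M" "v \<in> L2 M"
  shows "(LINT x|M. \<bar>u x * v x\<bar>) \<le> L2_norm M u * L2_norm M v"
proof -
  note [measurable] = assms[THEN L2D(1)]
  have "ennreal ((LINT x|M. \<bar>u x * v x\<bar>)\<^sup>2) = (\<integral>\<^sup>+x. ennreal \<bar>u x\<bar> * ennreal \<bar>v x\<bar> \<partial>M)\<^sup>2"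
    using nn_integral_eq_integral[OF integrable_abs[OF L2_mult_integrable[OF assms]]]
    by (simp add: ennreal_power[symmetric] abs_mult ennreal_mult)
  also have "\<dots> \<le> (\<integral>\<^sup>+x. (ennreal \<bar>u x\<bar>)\<^sup>2 \<partial>M) * (\<integral>\<^sup>+x. (ennreal \<bar>v x\<bar>)\<^sup>2 \<partial>M)"
    by (rule Cauchy_Schwarz_nn_integral) auto
  also have "\<dots> = ennreal ((LINT x|M. (u x)\<^sup>2) * (LINT x|M. (v x)\<^sup>2))"
    using assms[THEN L2D(2), THEN nn_integral_eq_integral]
    by (simp add: ennreal_power ennreal_mult)
  finally have "(LINT x|M. \<bar>u x * v x\<bar>)\<^sup>2 \<le> (L2_norm M u * L2_norm M v)\<^sup>2"
    by (simp add: power_mult_distrib L2_norm_sq)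
  then show ?thesis
    by (rule power2_le_imp_le) (simp add: L2_norm_nonneg)
qed

lemma L2_cauchy_schwarz':
  assumes "u \<in> L2 M" "v \<in> L2 M"
  shows "\<bar>LINT x|M. u x * v x\<bar> \<le> L2_norm M u * L2_norm M v"
  using integral_abs_bound[of M "\<lambda>x. u x * v x"] L2_cauchy_schwarz[OF assms] by linarith

lemma L2_integral_mult_tendsto:
  assumes "\<And>k. u k \<in> L2 M" "u' \<in> L2 M" "v \<in> L2 M"
    and "(\<lambda>k. L2_norm M (\<lambda>x. u k x - u' x)) \<longlonglongrightarrow> 0"
  shows "(\<lambda>k. LINT x|M. u k x * v x) \<longlonglongrightarrow> (LINT x|M. u' x * v x)"
proof -
  have "(\<lambda>k. (LINT x|M. u k x * v x) - (LINT x|M. u' x * v x)) \<longlonglongrightarrow> 0"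
  proof (rule Lim_null_comparison)
    show "\<forall>\<^sub>F k in sequentially. norm ((LINT x|M. u k x * v x) - (LINT x|M. u' x * v x))
        \<le> L2_norm M (\<lambda>x. u k x - u' x) * L2_norm M v"
    proof (intro always_eventually allI)
      fix k
      have "(LINT x|M. u k x * v x) - (LINT x|M. u' x * v x) = (LINT x|M. (u k x - u' x) * v x)"
        using L2_mult_integrable[OF assms(1) assms(3)] L2_mult_integrable[OF assms(2,3)]
        by (simp add: left_diff_distrib)
      then show "norm ((LINT x|M. u k x * v x) - (LINT x|M. u' x * v x))
          \<le> L2_norm M (\<lambda>x. u k x - u' x) * L2_norm M v"
        using L2_cauchy_schwarz'[OF L2_diff[OF assms(1,2)] assms(3)] by simp
    qed
    show "(\<lambda>k. L2_norm M (\<lambda>x. u k x - u' x) * L2_norm M v) \<longlonglongrightarrow> 0"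
      using tendsto_mult_left_zero[OF assms(4)] by simp
  qed
  then show ?thesis by (simp add: LIM_zero_iff)
qed

section \<open>Continuity of translation in L1\<close>

lemma integrable_lborel_shift:
  fixes q :: "'a::euclidean_space \<Rightarrow> real"
  assumes "integrable lborel q"
  shows "integrable lborel (\<lambda>x. q (x + z))" "(LINT x|lborel. q (x + z)) = (LINT x|lborel. q x)"
proof -
  have [measurable]: "q \<in> borel_measurable borel" using assms by auto
  have "integrable (distr lborel borel ((+) z)) q" using assms by (simp add: lborel_distr_plus)
  then show "integrable lborel (\<lambda>x. q (x + z))"
    by (subst (asm) integrable_distr_eq) (auto simp: add.commute)
  have "(LINT x|distr lborel borel ((+) z). q x) = (LINT x|lborel. q (z + x))"
    by (rule integral_distr) auto
  then show "(LINT x|lborel. q (x + z)) = (LINT x|lborel. q x)"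
    by (simp add: lborel_distr_plus add.commute)
qed

text \<open>Approximating from outside by open sets makes the pointwise limit of the translates one-sided,
  and the other side follows because translation preserves the measure.\<close>

lemma translation_continuous_indicator_open:
  fixes U :: "'a::euclidean_space set"
  assumes "open U" "emeasure lborel U < \<infinity>" "z \<longlonglongrightarrow> 0"
  shows "(\<lambda>n. LINT x|lborel. \<bar>indicator U (x + z n) - indicator U x :: real\<bar>) \<longlonglongrightarrow> 0"
proof -
  have [measurable]: "U \<in> sets borel" using assms by auto
  have iU: "integrable lborel (indicator U :: 'a \<Rightarrow> real)"
    using assms by simp
  have "(\<lambda>n. LINT x|lborel. max 0 (indicator U x - indicator U (x + z n)) :: real) \<longlonglongrightarrow> (LINT x|(lborel::'a measure). 0)"
  proof (rule integral_dominated_convergence[OF _ _ iU])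
    show "AE x in lborel. (\<lambda>n. max 0 (indicator U x - indicator U (x + z n)) :: real) \<longlonglongrightarrow> 0"
    proof (rule AE_I2)
      fix x :: 'a
      show "(\<lambda>n. max 0 (indicator U x - indicator U (x + z n)) :: real) \<longlonglongrightarrow> 0"
      proof (cases "x \<in> U")
        case True
        have "(\<lambda>n. x + z n) \<longlonglongrightarrow> x" using tendsto_add[OF tendsto_const assms(3), of x] by simp
        then have "\<forall>\<^sub>F n in sequentially. x + z n \<in> U"
          using assms(1) True by (rule topological_tendstoD)
        then show ?thesis
          by (intro tendsto_eventually) (auto elim!: eventually_mono simp: True)
      next
        case False
        then have "max 0 (indicator U x - indicator U (x + z n)) = (0::real)" for n
          by (simp add: indicator_def)
        then show ?thesis by simp
      qed
    qed
  qed (auto simp: indicator_def)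
  moreover have "(LINT x|lborel. \<bar>indicator U (x + z n) - indicator U x :: real\<bar>)
      = 2 * (LINT x|lborel. max 0 (indicator U x - indicator U (x + z n)))" for n
  proof -
    note sh = integrable_lborel_shift[OF iU, of "z n"]
    have "(LINT x|lborel. \<bar>indicator U (x + z n) - indicator U x :: real\<bar>)
       = (LINT x|lborel. (indicator U (x + z n) - indicator U x) + 2 * max 0 (indicator U x - indicator U (x + z n)))"
      by (intro Bochner_Integration.integral_cong) (auto simp: indicator_def)
    also have "\<dots> = 2 * (LINT x|lborel. max 0 (indicator U x - indicator U (x + z n)))"
      using sh iU by (subst Bochner_Integration.integral_add) auto
    finally show ?thesis .
  qed
  ultimately show ?thesis
    using tendsto_mult_right_zero[of _ sequentially 2] by simp
qed

text \<open>The factor 2 counts the approximation error at \<open>x\<close> and at the translated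
  point; by translation invariance both have the same integral.\<close>

lemma translation_continuous_step:
  fixes f g :: "'a::euclidean_space \<Rightarrow> real"
  assumes "integrable lborel f" "integrable lborel g"
  shows "(LINT x|lborel. \<bar>f (x + z) - f x\<bar>) \<le> (LINT x|lborel. \<bar>g (x + z) - g x\<bar>) + 2 * (LINT x|lborel. \<bar>f x - g x\<bar>)"
proof -
  note i = assms integrable_lborel_shift(1)[OF assms(1), of z] integrable_lborel_shift(1)[OF assms(2), of z]
  have d: "integrable lborel (\<lambda>x. \<bar>f x - g x\<bar>)" using i by auto
  have "(LINT x|lborel. \<bar>f (x + z) - f x\<bar>) \<le>
     (LINT x|lborel. \<bar>g (x + z) - g x\<bar> + \<bar>f (x + z) - g (x + z)\<bar> + \<bar>f x - g x\<bar>)"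
    using i by (intro integral_mono) auto
  also have "\<dots> = (LINT x|lborel. \<bar>g (x + z) - g x\<bar>) + (LINT x|lborel. \<bar>f (x + z) - g (x + z)\<bar>)
      + (LINT x|lborel. \<bar>f x - g x\<bar>)"
    using i by simp
  finally show ?thesis
    using integrable_lborel_shift(2)[OF d, of z] by simp
qed

text \<open>The error made in replacing \<open>f\<close> by \<open>g\<close> is the same for all
  translates, hence uniform in \<open>n\<close>. This closes the property under L1 limits; it is
  used to pass from open to measurable sets, and from simple functions to integrable ones.\<close>

lemma translation_continuous_approx:
  fixes f :: "'a::euclidean_space \<Rightarrow> real"
  assumes f: "integrable lborel f"
    and approx: "\<And>e. e > 0 \<Longrightarrow> \<exists>g. integrable lborel g \<and> (LINT x|lborel. \<bar>f x - g x\<bar>) < e \<and>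
      (\<lambda>n. LINT x|lborel. \<bar>g (x + z n) - g x\<bar>) \<longlonglongrightarrow> 0"
  shows "(\<lambda>n. LINT x|lborel. \<bar>f (x + z n) - f x\<bar>) \<longlonglongrightarrow> 0"
proof (rule LIMSEQ_I)
  fix r :: real assume "r > 0"
  then obtain g where g: "integrable lborel g" "(LINT x|lborel. \<bar>f x - g x\<bar>) < r / 4"
    "(\<lambda>n. LINT x|lborel. \<bar>g (x + z n) - g x\<bar>) \<longlonglongrightarrow> 0"
    using approx[of "r / 4"] by auto
  from LIMSEQ_D[OF g(3), of "r / 2"] \<open>r > 0\<close> obtain N where
    N: "\<And>n. n \<ge> N \<Longrightarrow> (LINT x|lborel. \<bar>g (x + z n) - g x\<bar>) < r / 2"
    by force
  show "\<exists>N. \<forall>n\<ge>N. norm ((LINT x|lborel. \<bar>f (x + z n) - f x\<bar>) - 0) < r"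
  proof (intro exI[of _ N] allI impI)
    fix n assume "n \<ge> N"
    from N[OF this] g(2) translation_continuous_step[OF f g(1), of "z n"]
    show "norm ((LINT x|lborel. \<bar>f (x + z n) - f x\<bar>) - 0) < r"
      by simp
  qed
qed

lemma translation_continuous_L1:
  fixes f :: "'a::euclidean_space \<Rightarrow> real"
  assumes "integrable lborel f" "z \<longlonglongrightarrow> 0"
  shows "(\<lambda>n. LINT x|lborel. \<bar>f (x + z n) - f x\<bar>) \<longlonglongrightarrow> 0"
  using assms(1)
proof (induction rule: integrable_induct)
  case (base A c)
  then have A[measurable]: "A \<in> sets borel" by simp
  have iA: "integrable lborel (indicator A :: 'a \<Rightarrow> real)" using base by simp
  have "(\<lambda>n. LINT x|lborel. \<bar>indicator A (x + z n) - indicator A x :: real\<bar>) \<longlonglongrightarrow> 0"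
  proof (rule translation_continuous_approx[OF iA])
    fix e :: real assume "e > 0"
    with outer_regular_lborel[OF A] obtain U where U: "open U" "A \<subseteq> U" "emeasure lborel (U - A) < e"
      by metis
    then have [measurable]: "U \<in> sets borel" by auto
    have "emeasure lborel U = emeasure lborel A + emeasure lborel (U - A)"
      using U(2) by (subst plus_emeasure) (auto simp: Un_absorb1)
    then have fin: "emeasure lborel U < \<infinity>"
      using base less_trans[OF U(3) ennreal_less_top] by simp
    have "(LINT x|lborel. \<bar>indicator A x - indicator U x :: real\<bar>) = (LINT x|lborel. indicator (U - A) x)"
      using U(2) by (intro Bochner_Integration.integral_cong) (auto simp: indicator_def)
    also have "\<dots> = measure lborel (U - A)" by simp
    also have "\<dots> < e"
      using U(3) \<open>e > 0\<close> less_trans[OF U(3) ennreal_less_top]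
      by (simp add: emeasure_eq_ennreal_measure ennreal_less_iff)
    finally show "\<exists>g. integrable lborel g \<and> (LINT x|lborel. \<bar>indicator A x - g x\<bar>) < e \<and>
        (\<lambda>n. LINT x|lborel. \<bar>g (x + z n) - g x\<bar>) \<longlonglongrightarrow> 0"
      using translation_continuous_indicator_open[OF U(1) fin assms(2)] fin
      by (intro exI[of _ "indicator U"]) auto
  qed
  from tendsto_mult_right_zero[OF this, of "\<bar>c\<bar>"] show ?case
    by (simp add: abs_mult[symmetric] right_diff_distrib mult.commute flip: integral_mult_right_zero)
next
  case (add f g)
  have "(\<lambda>n. LINT x|lborel. \<bar>(f (x + z n) + g (x + z n)) - (f x + g x)\<bar>) \<longlonglongrightarrow> 0"
  proof (rule Lim_null_comparison[OF _ tendsto_add_zero[OF add.IH]], intro always_eventually allI)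
    fix n
    note i = add.hyps integrable_lborel_shift(1)[OF add.hyps(1), of "z n"] integrable_lborel_shift(1)[OF add.hyps(2), of "z n"]
    have "(LINT x|lborel. \<bar>(f (x + z n) + g (x + z n)) - (f x + g x)\<bar>) \<le>
      (LINT x|lborel. \<bar>f (x + z n) - f x\<bar> + \<bar>g (x + z n) - g x\<bar>)"
      using i by (intro integral_mono) auto
    then show "norm (LINT x|lborel. \<bar>(f (x + z n) + g (x + z n)) - (f x + g x)\<bar>) \<le>
      (LINT x|lborel. \<bar>f (x + z n) - f x\<bar>) + (LINT x|lborel. \<bar>g (x + z n) - g x\<bar>)"
      using i by simp
  qed
  then show ?case by simp
next
  case (lim f s)
  show ?case
  proof (rule translation_continuous_approx[OF lim.hyps(4)])
    fix e :: real assume "e > 0"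
    have [measurable]: "f \<in> borel_measurable lborel" "\<And>i. s i \<in> borel_measurable lborel" 
      using lim by auto
    \<comment> \<open>The induction rule bounds the simple functions by twice the modulus of
      \<open>f\<close>, whence the factor 3 in the dominating function.\<close>
    have "(\<lambda>i. LINT x|lborel. \<bar>f x - s i x\<bar>) \<longlonglongrightarrow> (LINT x|(lborel::'a measure). 0)"
    proof (rule integral_dominated_convergence[where w = "\<lambda>x. 3 * \<bar>f x\<bar>"])
      show "AE x in lborel. (\<lambda>i. \<bar>f x - s i x\<bar>) \<longlonglongrightarrow> 0"
      proof (rule AE_I2)
        fix x :: 'a assume "x \<in> space lborel"
        from tendsto_diff[OF tendsto_const lim.hyps(2)[OF this], of "f x"]
        show "(\<lambda>i. \<bar>f x - s i x\<bar>) \<longlonglongrightarrow> 0" by (simp add: tendsto_rabs_zero)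
      qed
      show "AE x in lborel. norm \<bar>f x - s i x\<bar> \<le> 3 * \<bar>f x\<bar>" for i
      proof (rule AE_I2)
        fix x :: 'a
        have "norm (s i x) \<le> 2 * norm (f x)" using lim.hyps(3)[of x i] by simp
        then show "norm \<bar>f x - s i x\<bar> \<le> 3 * \<bar>f x\<bar>" by (simp split: abs_split)
      qed
    qed (use lim in auto)
    then have "(\<lambda>i. LINT x|lborel. \<bar>f x - s i x\<bar>) \<longlonglongrightarrow> 0" by simp
    from LIMSEQ_D[OF this \<open>e > 0\<close>] obtain i where "norm ((LINT x|lborel. \<bar>f x - s i x\<bar>) - 0) < e"
      by blast
    then show "\<exists>g. integrable lborel g \<and> (LINT x|lborel. \<bar>f x - g x\<bar>) < e \<and>
        (\<lambda>n. LINT x|lborel. \<bar>g (x + z n) - g x\<bar>) \<longlonglongrightarrow> 0"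
      using lim.IH lim.hyps(1) by (intro exI[of _ "s i"]) auto
  qed
qed

section \<open>Mollification\<close>

lemma L2_lborel_shift:
  fixes q :: "'a::euclidean_space \<Rightarrow> real"
  assumes "q \<in> L2 lborel"
  shows "(\<lambda>x. q (x + z)) \<in> L2 lborel" "L2_norm lborel (\<lambda>x. q (x + z)) = L2_norm lborel q"
  using integrable_lborel_shift[OF L2D(2)[OF assms], of z] L2D(1)[OF assms]
  by (auto simp: L2_def L2_norm_def)

lemma L2_truncation:
  assumes w: "w \<in> L2 M"
  shows "(\<lambda>n. L2_norm M (\<lambda>x. w x - max (- real n) (min (real n) (w x)))) \<longlonglongrightarrow> 0"
proof -
  note [measurable] = L2D(1)[OF w]
  have "(\<lambda>n. LINT x|M. (w x - max (- real n) (min (real n) (w x)))\<^sup>2) \<longlonglongrightarrow> (LINT x|M. 0)"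
  proof (rule integral_dominated_convergence[OF _ _ L2D(2)[OF w]])
    show "AE x in M. (\<lambda>n. (w x - max (- real n) (min (real n) (w x)))\<^sup>2) \<longlonglongrightarrow> 0"
    proof (rule AE_I2, rule tendsto_eventually)
      fix x
      obtain N where "\<bar>w x\<bar> \<le> real N" using real_arch_simple by blast
      then show "\<forall>\<^sub>F n in sequentially. (w x - max (- real n) (min (real n) (w x)))\<^sup>2 = 0"
        by (intro eventually_sequentiallyI[of N]) (auto simp: max_def min_def)
    qed
    show "AE x in M. norm ((w x - max (- real n) (min (real n) (w x)))\<^sup>2) \<le> (w x)\<^sup>2" for n
    proof (rule AE_I2)
      fix x
      have "\<bar>w x - max (- real n) (min (real n) (w x))\<bar> \<le> \<bar>w x\<bar>" by (auto simp: max_def min_def)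
      then show "norm ((w x - max (- real n) (min (real n) (w x)))\<^sup>2) \<le> (w x)\<^sup>2"
        by (simp add: abs_le_square_iff)
    qed
  qed auto
  then show ?thesis
    unfolding L2_norm_def using tendsto_real_sqrt by fastforce
qed

text \<open>Translation is continuous in L1 only so far, so \<open>w\<close> is truncated. The
  bounded part is paired with the L1 difference of \<open>q\<close> and its translate; the remainder
  is small in L2, and Cauchy-Schwarz bounds its pairing with every translate of \<open>q\<close>,
  since translates keep their L2 norm.\<close>

lemma correlation_tendsto:
  fixes w q :: "'a::euclidean_space \<Rightarrow> real"
  assumes w: "w \<in> L2 lborel" and q: "q \<in> L2 lborel" "integrable lborel q" and z: "z \<longlonglongrightarrow> 0"
  shows "(\<lambda>n. LINT x|lborel. w x * q (x + z n)) \<longlonglongrightarrow> (LINT x|lborel. w x * q x)"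
proof (rule LIMSEQ_I)
  fix r :: real assume r: "r > 0"
  note [measurable] = L2D(1)[OF w] L2D(1)[OF q(1)]
  define N where "N = L2_norm lborel q"
  have N: "N \<ge> 0" by (simp add: N_def L2_norm_nonneg)
  define t where "t n x = max (- real n) (min (real n) (w x))" for n x
  have [measurable]: "t n \<in> borel_measurable borel" for n unfolding t_def by measurable
  \<comment> \<open>The two remainders get r/4 each and the truncated part r/2. Adding 1 here and in
    the choice of \<open>K\<close> avoids division by a zero norm or a zero truncation
    level.\<close>
  from LIMSEQ_D[OF L2_truncation[OF w], of "r / (4 * (N + 1))"] r N
  obtain n where n: "L2_norm lborel (\<lambda>x. w x - t n x) < r / (4 * (N + 1))"
    unfolding t_def by (auto simp: L2_norm_nonneg)
  have tb: "\<bar>t n x\<bar> \<le> real n" for x by (auto simp: t_def)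
  have tL2: "t n \<in> L2 lborel"
  proof -
    have "integrable lborel (\<lambda>x. (t n x)\<^sup>2)"
    proof (rule Bochner_Integration.integrable_bound[OF L2D(2)[OF w]])
      show "AE x in lborel. norm ((t n x)\<^sup>2) \<le> norm ((w x)\<^sup>2)"
        by (rule AE_I2) (auto simp: abs_le_square_iff[symmetric] t_def)
    qed auto
    then show ?thesis by (simp add: L2_def)
  qed
  note dL2 = L2_diff[OF w tL2]
  from LIMSEQ_D[OF translation_continuous_L1[OF q(2) z], of "r / (2 * (real n + 1))"] r
  obtain K where K: "\<And>k. k \<ge> K \<Longrightarrow> (LINT x|lborel. \<bar>q (x + z k) - q x\<bar>) < r / (2 * (real n + 1))"
    by auto
  show "\<exists>K. \<forall>k\<ge>K. norm ((LINT x|lborel. w x * q (x + z k)) - (LINT x|lborel. w x * q x)) < r"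
  proof (intro exI[of _ K] allI impI)
    fix k assume k: "k \<ge> K"
    note qs = L2_lborel_shift[OF q(1), of "z k"]
    have i: "integrable lborel (\<lambda>x. (w x - t n x) * q (x + z k))" "integrable lborel (\<lambda>x. (w x - t n x) * q x)"
      "integrable lborel (\<lambda>x. t n x * q (x + z k))" "integrable lborel (\<lambda>x. t n x * q x)"
      using L2_mult_integrable dL2 tL2 qs q by blast+
    have iq: "integrable lborel (\<lambda>x. \<bar>q (x + z k) - q x\<bar>)"
      using integrable_lborel_shift(1)[OF q(2)] q(2) by auto
    have small: "L2_norm lborel (\<lambda>x. w x - t n x) * N \<le> r / 4"
    proof -
      have "L2_norm lborel (\<lambda>x. w x - t n x) * N \<le> r / (4 * (N + 1)) * (N + 1)"
        using n N r by (intro mult_mono) (auto simp: L2_norm_nonneg)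
      also have "\<dots> = r / 4" using N by (simp add: field_simps)
      finally show ?thesis .
    qed
    have "(LINT x|lborel. w x * q (x + z k)) = (LINT x|lborel. (w x - t n x) * q (x + z k) + t n x * q (x + z k))"
      by (simp add: algebra_simps)
    also have "\<dots> = (LINT x|lborel. (w x - t n x) * q (x + z k)) + (LINT x|lborel. t n x * q (x + z k))"
      using i by (intro Bochner_Integration.integral_add)
    finally have e1: "(LINT x|lborel. w x * q (x + z k)) = \<dots>" .
    have "(LINT x|lborel. w x * q x) = (LINT x|lborel. (w x - t n x) * q x + t n x * q x)"
      by (simp add: algebra_simps)
    also have "\<dots> = (LINT x|lborel. (w x - t n x) * q x) + (LINT x|lborel. t n x * q x)"
      using i by (intro Bochner_Integration.integral_add)
    finally have e2: "(LINT x|lborel. w x * q x) = \<dots>" .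
    have b1: "\<bar>LINT x|lborel. (w x - t n x) * q (x + z k)\<bar> \<le> r / 4"
      using L2_cauchy_schwarz'[OF dL2 qs(1)] small by (simp add: qs(2) N_def)
    have b2: "\<bar>LINT x|lborel. (w x - t n x) * q x\<bar> \<le> r / 4"
      using L2_cauchy_schwarz'[OF dL2 q(1)] small by (simp add: N_def)
    have "\<bar>(LINT x|lborel. t n x * q (x + z k)) - (LINT x|lborel. t n x * q x)\<bar> =
        \<bar>LINT x|lborel. t n x * (q (x + z k) - q x)\<bar>"
      using i by (simp add: right_diff_distrib)
    also have "\<dots> \<le> (LINT x|lborel. \<bar>t n x * (q (x + z k) - q x)\<bar>)"
      by (rule integral_abs_bound)
    also have "\<dots> \<le> (LINT x|lborel. real n * \<bar>q (x + z k) - q x\<bar>)"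
    proof (rule integral_mono)
      show "integrable lborel (\<lambda>x. \<bar>t n x * (q (x + z k) - q x)\<bar>)"
        using i by (simp add: right_diff_distrib)
    qed (use iq tb in \<open>auto simp: abs_mult mult_right_mono\<close>)
    also have "\<dots> = real n * (LINT x|lborel. \<bar>q (x + z k) - q x\<bar>)" by simp
    also have "\<dots> \<le> (real n + 1) * (LINT x|lborel. \<bar>q (x + z k) - q x\<bar>)"
      by (intro mult_right_mono) auto
    also have "\<dots> < (real n + 1) * (r / (2 * (real n + 1)))"
      using K[OF k] by (intro mult_strict_left_mono) auto
    also have "\<dots> = r / 2" by (simp add: divide_simps)
    finally show "norm ((LINT x|lborel. w x * q (x + z k)) - (LINT x|lborel. w x * q x)) < r"
      unfolding e1 e2 real_norm_def using b1 b2 by linarith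
  qed
qed

text \<open>Turns convergence along sequences into a neighbourhood of zero, as an average over all
  shifts in the support of a kernel requires.\<close>

lemma correlation_continuous_at_0:
  fixes w q :: "'a::euclidean_space \<Rightarrow> real"
  assumes w: "w \<in> L2 lborel" and q: "q \<in> L2 lborel" "integrable lborel q" and e: "e > 0"
  obtains \<eta> where "\<eta> > 0"
    "\<And>z. norm z < \<eta> \<Longrightarrow> \<bar>(LINT x|lborel. w x * q (x + z)) - (LINT x|lborel. w x * q x)\<bar> < e"
proof (rule ccontr)
  assume "\<not> thesis"
  then have "\<forall>n. \<exists>z. norm z < inverse (real (Suc n)) \<and>
      \<not> \<bar>(LINT x|lborel. w x * q (x + z)) - (LINT x|lborel. w x * q x)\<bar> < e"
    using that by (metis inverse_positive_iff_positive of_nat_0_less_iff zero_less_Suc)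
  then obtain z where z: "\<And>n. norm (z n) < inverse (real (Suc n))"
    "\<And>n. \<not> \<bar>(LINT x|lborel. w x * q (x + z n)) - (LINT x|lborel. w x * q x)\<bar> < e"
    by metis
  have "z \<longlonglongrightarrow> 0"
    using z(1) by (intro Lim_null_comparison[OF _ LIMSEQ_inverse_real_of_nat]) (auto intro: always_eventually less_imp_le)
  from LIMSEQ_D[OF correlation_tendsto[OF w q this] e] z(2) show False
    by auto
qed

text \<open>Pairing \<open>w\<close> with a mollification of \<open>q\<close> is averaging the
  correlation of \<open>w\<close> and \<open>q\<close> over the shifts \<open>z\<close> with weight
  \<open>\<rho> z\<close>. Convergence of mollifications thereby reduces to continuity of the
  correlation at zero.\<close>

lemma correlation_fubini:
  fixes w q \<rho> :: "'a::euclidean_space \<Rightarrow> real"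
  assumes w: "integrable lborel w" and q: "integrable lborel q"
    and \<rho>[measurable]: "\<rho> \<in> borel_measurable borel" and \<rho>b: "\<And>z. 0 \<le> \<rho> z" "\<And>z. \<rho> z \<le> 1"
  shows "(LINT x|lborel. w x * (LINT y|lborel. q y * \<rho> (y - x))) =
      (LINT z|lborel. \<rho> z * (LINT x|lborel. w x * q (x + z)))"
    and "integrable lborel (\<lambda>z. \<rho> z * (LINT x|lborel. w x * q (x + z)))"
proof -
  have [measurable]: "w \<in> borel_measurable borel" "q \<in> borel_measurable borel" using w q by auto
  define F where "F = (\<lambda>(x, z). w x * (q (x + z) * \<rho> z))"
  have [measurable]: "F \<in> borel_measurable (lborel \<Otimes>\<^sub>M lborel)" unfolding F_def by measurable
  have iq: "integrable lborel (\<lambda>z. q (x + z) * \<rho> z)" for x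
  proof (rule Bochner_Integration.integrable_bound[OF integrable_lborel_shift(1)[OF q, of x]])
    show "AE z in lborel. norm (q (x + z) * \<rho> z) \<le> norm (q (z + x))"
      using mult_left_mono[OF \<rho>b(2), of "\<bar>q _\<bar>"] \<rho>b(1) by (intro AE_I2) (auto simp: abs_mult add.commute)
  qed auto
  have shift: "(LINT y|lborel. q y * \<rho> (y - x)) = (LINT z|lborel. q (x + z) * \<rho> z)" for x
  proof -
    have "integrable lborel (\<lambda>y. q y * \<rho> (y - x))"
      using integrable_lborel_shift(1)[OF iq[of x], of "- x"] by simp
    from integrable_lborel_shift(2)[OF this, of x] show ?thesis by (simp add: add.commute)
  qed
  have iF: "integrable (lborel \<Otimes>\<^sub>M lborel) F"
  proof (rule lborel_pair.Fubini_integrable)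
    show "integrable lborel (\<lambda>x. LINT y|lborel. norm (F (x, y)))"
    proof (rule Bochner_Integration.integrable_bound[of _ "\<lambda>x. w x * (LINT y|lborel. \<bar>q y\<bar>)"])
      show "AE x in lborel. norm (LINT y|lborel. norm (F (x, y))) \<le> norm (w x * (LINT y|lborel. \<bar>q y\<bar>))"
      proof (rule AE_I2)
        fix x :: 'a
        have "(LINT y|lborel. norm (F (x, y))) = \<bar>w x\<bar> * (LINT y|lborel. \<bar>q (x + y) * \<rho> y\<bar>)"
          by (simp add: F_def abs_mult)
        also have "\<dots> \<le> \<bar>w x\<bar> * (LINT y|lborel. \<bar>q (y + x)\<bar>)"
        proof (intro mult_left_mono integral_mono)
          fix y show "\<bar>q (x + y) * \<rho> y\<bar> \<le> \<bar>q (y + x)\<bar>"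
            using mult_left_mono[OF \<rho>b(2)[of y], of "\<bar>q (x + y)\<bar>"] \<rho>b(1)[of y] by (simp add: abs_mult add.commute)
        qed (use iq integrable_lborel_shift(1)[OF q] in auto)
        also have "\<dots> = \<bar>w x\<bar> * (LINT y|lborel. \<bar>q y\<bar>)"
          using integrable_lborel_shift(2)[OF integrable_abs[OF q], of x] by simp
        finally show "norm (LINT y|lborel. norm (F (x, y))) \<le> norm (w x * (LINT y|lborel. \<bar>q y\<bar>))"
          by (simp add: abs_mult)
      qed
    qed (use w in auto)
    show "AE x in lborel. integrable lborel (\<lambda>y. F (x, y))"
      using iq by (auto simp: F_def)
  qed auto
  have inner: "(LINT x|lborel. F (x, z)) = \<rho> z * (LINT x|lborel. w x * q (x + z))" for z
  proof -
    have "F (x, z) = \<rho> z * (w x * q (x + z))" for x by (simp add: F_def)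
    then show ?thesis by simp
  qed
  have "(LINT x|lborel. w x * (LINT y|lborel. q y * \<rho> (y - x))) = (LINT x|lborel. LINT z|lborel. F (x, z))"
    by (simp add: shift F_def)
  also have "\<dots> = (LINT z|lborel. LINT x|lborel. F (x, z))"
    using lborel_pair.Fubini_integral[of "\<lambda>x z. F (x, z)"] iF by simp
  finally show "(LINT x|lborel. w x * (LINT y|lborel. q y * \<rho> (y - x))) =
      (LINT z|lborel. \<rho> z * (LINT x|lborel. w x * q (x + z)))"
    by (simp add: inner)
  show "integrable lborel (\<lambda>z. \<rho> z * (LINT x|lborel. w x * q (x + z)))"
    using lborel_pair.integrable_snd[of "\<lambda>x z. F (x, z)"] iF by (simp add: inner)
qed

text \<open>Where the kernel lives, the correlation is within \<open>e\<close> of its value at zero;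
  averaging multiplies this by the mass. The radius does not depend on the kernel, so two pairings
  can be handled with one common kernel.\<close>

lemma mollify_lborel:
  fixes w q :: "'a::euclidean_space \<Rightarrow> real"
  assumes w: "w \<in> L2 lborel" "integrable lborel w" and q: "q \<in> L2 lborel" "integrable lborel q"
    and e: "e > 0"
  obtains \<eta> where "\<eta> > 0"
    "\<And>\<rho>. integrable lborel \<rho> \<Longrightarrow> (\<And>z. 0 \<le> \<rho> z) \<Longrightarrow> (\<And>z. \<rho> z \<le> 1) \<Longrightarrow>
      (\<And>z. \<eta> \<le> norm z \<Longrightarrow> \<rho> z = 0) \<Longrightarrow>
      \<bar>(LINT x|lborel. w x * (LINT y|lborel. q y * \<rho> (y - x)))
        - (LINT z|lborel. \<rho> z) * (LINT x|lborel. w x * q x)\<bar> \<le> e * (LINT z|lborel. \<rho> z)"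
proof -
  obtain \<eta> where \<eta>: "\<eta> > 0"
    "\<And>z. norm z < \<eta> \<Longrightarrow> \<bar>(LINT x|lborel. w x * q (x + z)) - (LINT x|lborel. w x * q x)\<bar> < e"
    using correlation_continuous_at_0[OF w(1) q e] by blast
  show thesis
  proof (rule that[OF \<eta>(1)])
    fix \<rho> :: "'a \<Rightarrow> real"
    assume \<rho>: "integrable lborel \<rho>" "\<And>z. 0 \<le> \<rho> z" "\<And>z. \<rho> z \<le> 1" "\<And>z. \<eta> \<le> norm z \<Longrightarrow> \<rho> z = 0"
    define C where "C z = (LINT x|lborel. w x * q (x + z))" for z
    have [measurable]: "\<rho> \<in> borel_measurable borel" using \<rho>(1) by auto
    note F = correlation_fubini[OF w(2) q(2) \<open>\<rho> \<in> borel_measurable borel\<close> \<rho>(2,3), folded C_def]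
    have "(LINT x|lborel. w x * (LINT y|lborel. q y * \<rho> (y - x)))
        - (LINT z|lborel. \<rho> z) * (LINT x|lborel. w x * q x) = (LINT z|lborel. \<rho> z * (C z - (LINT x|lborel. w x * q x)))"
      using F \<rho>(1) by (simp add: right_diff_distrib)
    also have "\<bar>\<dots>\<bar> \<le> (LINT z|lborel. \<bar>\<rho> z * (C z - (LINT x|lborel. w x * q x))\<bar>)"
      by (rule integral_abs_bound)
    also have "\<dots> \<le> (LINT z|lborel. e * \<rho> z)"
    proof (rule integral_mono)
      show "integrable lborel (\<lambda>z. \<bar>\<rho> z * (C z - (LINT x|lborel. w x * q x))\<bar>)"
        using F \<rho>(1) by (simp add: right_diff_distrib)
      fix z show "\<bar>\<rho> z * (C z - (LINT x|lborel. w x * q x))\<bar> \<le> e * \<rho> z"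
      proof (cases "norm z < \<eta>")
        case True
        have "\<rho> z * \<bar>C z - (LINT x|lborel. w x * q x)\<bar> \<le> \<rho> z * e"
          using \<eta>(2)[OF True] \<rho>(2) by (intro mult_left_mono) (auto simp: C_def)
        then show ?thesis using \<rho>(2) by (simp add: abs_mult mult.commute)
      qed (use \<rho>(4) in auto)
    qed (use \<rho>(1) in auto)
    finally show "\<bar>(LINT x|lborel. w x * (LINT y|lborel. q y * \<rho> (y - x)))
        - (LINT z|lborel. \<rho> z) * (LINT x|lborel. w x * q x)\<bar> \<le> e * (LINT z|lborel. \<rho> z)"
      by simp
  qed
qed

text \<open>Fubini and translations are applied to Borel functions on the whole space, whereas an
  element of L2 on the domain is only Lebesgue measurable and arbitrary outside. The replacement
  extends it by zero and changes it on a null set, which no integral against a Borel function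
  detects.\<close>

lemma L2_lebesgue_on_borel_rep:
  fixes q :: "'a::euclidean_space \<Rightarrow> real"
  assumes \<Omega>: "\<Omega> \<in> sets lebesgue" "bounded \<Omega>" and q: "q \<in> L2 (lebesgue_on \<Omega>)"
  obtains q' where "q' \<in> L2 lborel" "integrable lborel q'"
    "\<And>k. k \<in> borel_measurable borel \<Longrightarrow> (LINT x|lebesgue_on \<Omega>. q x * k x) = (LINT x|lborel. q' x * k x)"
    "AE x in lebesgue. q' x = indicator \<Omega> x * q x"
proof -
  have "finite_measure (lebesgue_on \<Omega>)"
    using \<Omega> by (simp add: bounded_set_imp_lmeasurable finite_measure_lebesgue_on)
  then interpret finite_measure "lebesgue_on \<Omega>" .
  have m: "\<Omega> \<inter> space lebesgue \<in> sets lebesgue" using \<Omega> by simp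
  have "(\<lambda>x. indicator \<Omega> x * q x) \<in> borel_measurable lebesgue"
    using L2D(1)[OF q] borel_measurable_restrict_space_iff[OF m, of q] by simp
  from completion_ex_borel_measurable_real[OF this] obtain q' where
    q'[measurable]: "q' \<in> borel_measurable borel" and "AE x in lborel. indicator \<Omega> x * q x = q' x"
    by auto
  then have ae: "AE x in lebesgue. q' x = indicator \<Omega> x * q x"
    by (auto intro: AE_completion simp: eq_commute)
  have "integrable lebesgue (\<lambda>x. indicator \<Omega> x * q x)"
    using L2_integrable[OF q] integrable_restrict_space[OF m, of q] by simp
  then have "integrable lebesgue q'"
    by (rule integrable_cong_AE_imp) (use ae in \<open>auto simp: eq_commute intro: measurable_completion\<close>)
  then have i: "integrable lborel q'" by (simp add: integrable_completion)
  have "integrable lebesgue (\<lambda>x. indicator \<Omega> x * (q x)\<^sup>2)"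
    using L2D(2)[OF q] integrable_restrict_space[OF m, of "\<lambda>x. (q x)\<^sup>2"] by simp
  then have "integrable lebesgue (\<lambda>x. (q' x)\<^sup>2)"
    by (rule integrable_cong_AE_imp) (use ae in \<open>auto simp: indicator_def intro: measurable_completion elim!: eventually_mono\<close>)
  then have "q' \<in> L2 lborel" by (simp add: integrable_completion L2_def)
  moreover have "(LINT x|lebesgue_on \<Omega>. q x * k x) = (LINT x|lborel. q' x * k x)"
    if [measurable]: "k \<in> borel_measurable borel" for k
  proof -
    have "(LINT x|lebesgue_on \<Omega>. q x * k x) = (LINT x|lebesgue. (indicator \<Omega> x * q x) * k x)"
      by (simp add: integral_restrict_space[OF m] mult.assoc)
    also have "\<dots> = (LINT x|lebesgue. q' x * k x)"
    proof (rule integral_cong_AE)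
      have [measurable]: "k \<in> borel_measurable lebesgue" "q' \<in> borel_measurable lebesgue"
        by (auto intro: measurable_completion)
      show "(\<lambda>x. q' x * k x) \<in> borel_measurable lebesgue" by measurable
      show "(\<lambda>x. indicator \<Omega> x * q x * k x) \<in> borel_measurable lebesgue"
        using \<open>(\<lambda>x. indicator \<Omega> x * q x) \<in> borel_measurable lebesgue\<close> by measurable
    qed (use ae in auto)
    also have "\<dots> = (LINT x|lborel. q' x * k x)"
      by (rule integral_completion) measurable
    finally show ?thesis .
  qed
  ultimately show thesis using that i ae by blast
qed

lemma mollify_lebesgue_on:
  fixes w q :: "'a::euclidean_space \<Rightarrow> real"
  assumes \<Omega>: "\<Omega> \<in> sets lebesgue" "bounded \<Omega>" and w: "w \<in> L2 (lebesgue_on \<Omega>)"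
    and q: "q \<in> L2 (lebesgue_on \<Omega>)" and e: "e > 0"
  obtains \<eta> where "\<eta> > 0"
    "\<And>\<rho>. integrable lborel \<rho> \<Longrightarrow> (\<And>z. 0 \<le> \<rho> z) \<Longrightarrow> (\<And>z. \<rho> z \<le> 1) \<Longrightarrow>
      (\<And>z. \<eta> \<le> norm z \<Longrightarrow> \<rho> z = 0) \<Longrightarrow>
      \<bar>(LINT x|lebesgue_on \<Omega>. w x * (LINT y|lebesgue_on \<Omega>. q y * \<rho> (y - x)))
        - (LINT z|lborel. \<rho> z) * (LINT x|lebesgue_on \<Omega>. w x * q x)\<bar> \<le> e * (LINT z|lborel. \<rho> z)"
proof -
  obtain w' where w': "w' \<in> L2 lborel" "integrable lborel w'"
    "\<And>k. k \<in> borel_measurable borel \<Longrightarrow> (LINT x|lebesgue_on \<Omega>. w x * k x) = (LINT x|lborel. w' x * k x)"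
    "AE x in lebesgue. w' x = indicator \<Omega> x * w x"
    using L2_lebesgue_on_borel_rep[OF \<Omega> w] by blast
  obtain q' where q': "q' \<in> L2 lborel" "integrable lborel q'"
    "\<And>k. k \<in> borel_measurable borel \<Longrightarrow> (LINT x|lebesgue_on \<Omega>. q x * k x) = (LINT x|lborel. q' x * k x)"
    "AE x in lebesgue. q' x = indicator \<Omega> x * q x"
    using L2_lebesgue_on_borel_rep[OF \<Omega> q] by blast
  have [measurable]: "q' \<in> borel_measurable borel" using q'(2) by auto
  have m: "\<Omega> \<inter> space lebesgue \<in> sets lebesgue" using \<Omega> by simp
  have "(LINT x|lebesgue_on \<Omega>. w x * q x) = (LINT x|lebesgue_on \<Omega>. w x * q' x)"
  proof (rule integral_cong_AE)
    have "AE x in lebesgue_on \<Omega>. q' x = q x"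
      unfolding AE_restrict_space_iff[OF m] using q'(4) by (auto elim!: eventually_mono)
    then show "AE x in lebesgue_on \<Omega>. w x * q x = w x * q' x" by auto
    have "q' \<in> borel_measurable (lebesgue_on \<Omega>)"
      by (intro measurable_restrict_space1 measurable_completion) simp
    then show "(\<lambda>x. w x * q' x) \<in> borel_measurable (lebesgue_on \<Omega>)"
      using L2D(1)[OF w] by measurable
  qed (use L2D(1)[OF w] L2D(1)[OF q] in measurable)
  then have wq: "(LINT x|lebesgue_on \<Omega>. w x * q x) = (LINT x|lborel. w' x * q' x)"
    using w'(3)[of q'] by simp
  from mollify_lborel[OF w'(1,2) q'(1,2) e] obtain \<eta> where \<eta>: "\<eta> > 0"
    "\<And>\<rho>. integrable lborel \<rho> \<Longrightarrow> (\<And>z. 0 \<le> \<rho> z) \<Longrightarrow> (\<And>z. \<rho> z \<le> 1) \<Longrightarrow>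
      (\<And>z. \<eta> \<le> norm z \<Longrightarrow> \<rho> z = 0) \<Longrightarrow>
      \<bar>(LINT x|lborel. w' x * (LINT y|lborel. q' y * \<rho> (y - x)))
        - (LINT z|lborel. \<rho> z) * (LINT x|lborel. w' x * q' x)\<bar> \<le> e * (LINT z|lborel. \<rho> z)"
    by blast
  show thesis
  proof (rule that[OF \<eta>(1)])
    fix \<rho> :: "'a \<Rightarrow> real"
    assume \<rho>: "integrable lborel \<rho>" "\<And>z. 0 \<le> \<rho> z" "\<And>z. \<rho> z \<le> 1" "\<And>z. \<eta> \<le> norm z \<Longrightarrow> \<rho> z = 0"
    have [measurable]: "\<rho> \<in> borel_measurable borel" using \<rho>(1) by auto
    have "(LINT x|lebesgue_on \<Omega>. w x * (LINT y|lebesgue_on \<Omega>. q y * \<rho> (y - x)))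
      = (LINT x|lebesgue_on \<Omega>. w x * (LINT y|lborel. q' y * \<rho> (y - x)))"
      by (subst q'(3)) auto
    also have "\<dots> = (LINT x|lborel. w' x * (LINT y|lborel. q' y * \<rho> (y - x)))"
      by (rule w'(3)) measurable
    finally show "\<bar>(LINT x|lebesgue_on \<Omega>. w x * (LINT y|lebesgue_on \<Omega>. q y * \<rho> (y - x)))
        - (LINT z|lborel. \<rho> z) * (LINT x|lebesgue_on \<Omega>. w x * q x)\<bar> \<le> e * (LINT z|lborel. \<rho> z)"
      using \<eta>(2)[OF \<rho>] wq by simp
  qed
qed

section \<open>Weak derivatives\<close>

lemma smooth_directional_derivative:
  assumes "smooth \<phi>"
  shows "((\<lambda>h. (\<phi> (x + h *\<^sub>R e) - \<phi> x) / h) \<longlongrightarrow> pderiv_at \<phi> e x) (at 0)"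
proof -
  have lin: "linear (frechet_derivative \<phi> (at x))"
    using has_derivative_linear[OF smooth_has_derivative[OF assms]] .
  have "((\<lambda>h. \<phi> (x + h *\<^sub>R e)) has_derivative (\<lambda>h. frechet_derivative \<phi> (at x) (h *\<^sub>R e))) (at 0)"
  proof (rule has_derivative_compose[where f = "\<lambda>h. x + h *\<^sub>R e" and f' = "\<lambda>h. h *\<^sub>R e"])
    show "((\<lambda>h. x + h *\<^sub>R e) has_derivative (\<lambda>h. h *\<^sub>R e)) (at 0)"
      by (auto intro!: derivative_eq_intros)
    show "(\<phi> has_derivative frechet_derivative \<phi> (at x)) (at (x + 0 *\<^sub>R e))"
      using smooth_has_derivative[OF assms, of x] by simp
  qed
  then have "((\<lambda>h. \<phi> (x + h *\<^sub>R e)) has_real_derivative pderiv_at \<phi> e x) (at 0)"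
    by (simp add: has_field_derivative_def linear_scale[OF lin] mult.commute[of _ "pderiv_at \<phi> e x"])
  then show ?thesis by (simp add: DERIV_def)
qed

text \<open>A fixed sequence of steps suits dominated convergence. The steps are at most 1, so all
  points met lie within \<open>norm e\<close> of \<open>x\<close>.\<close>

definition dquot :: "('a::euclidean_space \<Rightarrow> real) \<Rightarrow> 'a \<Rightarrow> nat \<Rightarrow> 'a \<Rightarrow> real" where
  "dquot F e n x = (F (x + inverse (real (Suc n)) *\<^sub>R e) - F x) / inverse (real (Suc n))"

lemma smooth_dquot_tendsto:
  assumes "smooth \<phi>"
  shows "(\<lambda>n. dquot \<phi> e n x) \<longlonglongrightarrow> pderiv_at \<phi> e x"
proof -
  have "filterlim (\<lambda>n. inverse (real (Suc n))) (at 0) sequentially"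
    using LIMSEQ_inverse_real_of_nat by (auto simp: filterlim_at intro!: always_eventually)
  from filterlim_compose[OF smooth_directional_derivative[OF assms] this] show ?thesis
    by (simp add: dquot_def)
qed

lemma dquot_bound:
  assumes L: "L-lipschitz_on (cball 0 R) F" and x: "norm x + norm e \<le> R"
  shows "\<bar>dquot F e n x\<bar> \<le> L * norm e"
proof -
  define h where "h = inverse (real (Suc n))"
  have h: "0 < h" "h \<le> 1" by (auto simp: h_def inverse_eq_divide)
  have "norm (x + h *\<^sub>R e) \<le> norm x + norm e"
    using norm_triangle_ineq[of x "h *\<^sub>R e"] h mult_right_mono[of h 1 "norm e"] by simp
  then have inn: "x + h *\<^sub>R e \<in> cball 0 R" using x unfolding mem_cball_0 by linarith
  have "x \<in> cball 0 R" using x norm_ge_zero[of e] unfolding mem_cball_0 by linarith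
  from lipschitz_onD[OF L inn this]
  have "\<bar>F (x + h *\<^sub>R e) - F x\<bar> \<le> L * norm e * h" using h(1) by (simp add: dist_norm mult_ac)
  then show ?thesis using h(1) unfolding dquot_def h_def[symmetric] by (simp add: abs_divide pos_divide_le_eq)
qed

lemma continuous_measurable_lebesgue_on:
  fixes f :: "'a::euclidean_space \<Rightarrow> real"
  assumes "continuous_on UNIV f"
  shows "f \<in> borel_measurable (lebesgue_on S)"
proof -
  have "f \<in> borel_measurable borel"
    using assms by (rule borel_measurable_continuous_onI)
  then show ?thesis
    by (intro measurable_restrict_space1 measurable_completion) simp
qed

text \<open>Dominated convergence with the constant L * norm e on a set of finite measure. Assuming
  a limit \<open>G\<close> along the sequence, and not differentiability, makes the lemma applicable
  to mollified functions; the limit also supplies the measurability of \<open>G\<close>.\<close>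

lemma difference_quotient_integral:
  fixes F G :: "'a::euclidean_space \<Rightarrow> real"
  assumes S: "S \<in> lmeasurable" "\<And>x. x \<in> S \<Longrightarrow> norm x + norm e \<le> R"
    and L: "L-lipschitz_on (cball 0 R) F"
    and G: "\<And>x. x \<in> S \<Longrightarrow> (\<lambda>n. dquot F e n x) \<longlonglongrightarrow> G x"
  shows "(\<lambda>n. LINT x|lebesgue_on S. dquot F e n x)
    \<longlonglongrightarrow> (LINT x|lebesgue_on S. G x)"
proof -
  define h where "h n = inverse (real (Suc n))" for n
  have h: "0 < h n" "h n \<le> 1" for n by (auto simp: h_def inverse_eq_divide)
  have inn: "x + h n *\<^sub>R e \<in> cball 0 R" "x \<in> cball 0 R" if "x \<in> S" for x n
  proof -
    have "norm (x + h n *\<^sub>R e) \<le> norm x + h n * norm e"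
      using norm_triangle_ineq[of x "h n *\<^sub>R e"] h[of n] by simp
    also have "\<dots> \<le> norm x + norm e" using h[of n] mult_right_mono[of "h n" 1 "norm e"] by simp
    finally show "x + h n *\<^sub>R e \<in> cball 0 R" using S(2)[OF that] by simp
    show "x \<in> cball 0 R" using S(2)[OF that] norm_ge_zero[of e] unfolding mem_cball_0 by linarith
  qed
  have cF: "continuous_on (cball 0 R) F" using L by (rule lipschitz_on_continuous_on)
  have Sl: "S \<in> sets lebesgue" using S(1) by auto
  have meas: "(\<lambda>x. (F (x + h n *\<^sub>R e) - F x) / h n) \<in> borel_measurable (lebesgue_on S)" for n
    using h(1)[of n]
    by (intro continuous_imp_measurable_on_sets_lebesgue[OF _ Sl] continuous_intros
        continuous_on_compose2[OF cF]) (use inn in auto)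
  have lim: "(\<lambda>n. (F (x + h n *\<^sub>R e) - F x) / h n) \<longlonglongrightarrow> G x" if "x \<in> S" for x
    using G[OF that] by (simp add: dquot_def h_def)
  interpret finite_measure "lebesgue_on S"
    using S(1) by (rule finite_measure_lebesgue_on)
  have "(\<lambda>n. LINT x|lebesgue_on S. (F (x + h n *\<^sub>R e) - F x) / h n) \<longlonglongrightarrow> (LINT x|lebesgue_on S. G x)"
  proof (rule integral_dominated_convergence[where w = "\<lambda>x. L * norm e"])
    show "AE x in lebesgue_on S. (\<lambda>n. (F (x + h n *\<^sub>R e) - F x) / h n) \<longlonglongrightarrow> G x"
      using lim by (intro AE_I2) simp
    show "G \<in> borel_measurable (lebesgue_on S)"
      by (rule borel_measurable_LIMSEQ_real[OF _ meas]) (use lim in simp)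
    show "AE x in lebesgue_on S. norm ((F (x + h n *\<^sub>R e) - F x) / h n) \<le> L * norm e" for n
      using dquot_bound[OF L S(2), of _ n] by (intro AE_I2) (simp add: dquot_def h_def)
  qed (use meas in auto)
  then show ?thesis by (simp add: dquot_def h_def)
qed

lemma pderiv_eq_0_outside_support:
  assumes "smooth \<phi>" "x \<notin> closure {x. \<phi> x \<noteq> 0}"
  shows "pderiv_at \<phi> i x = 0"
proof -
  have "((\<lambda>x. 0) has_derivative (\<lambda>h. 0)) (at x)" by simp
  then have "(\<phi> has_derivative (\<lambda>h. 0)) (at x)"
  proof (rule has_derivative_transform_within_open)
    show "open (- closure {x. \<phi> x \<noteq> 0})" by auto
    show "0 = \<phi> y" if "y \<in> - closure {x. \<phi> x \<noteq> 0}" for y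
      using that closure_subset[of "{x. \<phi> x \<noteq> 0}"] by auto
  qed (use assms(2) in auto)
  from fun_cong[OF frechet_derivative_at[OF this], of i] show ?thesis by simp
qed

section \<open>Weak partial derivatives on a bounded open set\<close>

locale bounded_domain =
  fixes \<Omega> :: "'a::euclidean_space set"
  assumes domain_open: "open \<Omega>" and domain_bounded: "bounded \<Omega>"
begin

lemma domain_lmeasurable: "\<Omega> \<in> lmeasurable"
  by (rule lmeasurable_open[OF domain_bounded domain_open])

lemma domain_sets: "\<Omega> \<in> sets lebesgue"
  using domain_lmeasurable by auto

lemma domain_radius:
  obtains R where "R > 0" "\<And>x. x \<in> \<Omega> \<Longrightarrow> norm x \<le> R"
  using domain_bounded bounded_pos by metis

sublocale domain: finite_measure "lebesgue_on \<Omega>"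
  using domain_lmeasurable by (rule finite_measure_lebesgue_on)

lemma continuous_bounded_on_domain:
  fixes f :: "'a \<Rightarrow> real"
  assumes "continuous_on UNIV f"
  obtains B where "\<And>x. x \<in> \<Omega> \<Longrightarrow> \<bar>f x\<bar> \<le> B"
proof -
  obtain R where R: "\<And>x. x \<in> \<Omega> \<Longrightarrow> norm x \<le> R" using domain_radius by blast
  have "bounded (f ` cball 0 R)"
    using continuous_on_subset[OF assms, of "cball 0 R"]
    by (intro compact_imp_bounded compact_continuous_image) auto
  then obtain B where "\<And>x. x \<in> cball 0 R \<Longrightarrow> \<bar>f x\<bar> \<le> B" by (force simp: bounded_iff)
  with R show thesis by (intro that[of B]) auto
qed

lemma continuous_L2: "continuous_on UNIV f \<Longrightarrow> f \<in> L2 (lebesgue_on \<Omega>)"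
proof -
  assume f: "continuous_on UNIV f"
  then obtain B where "\<And>x. x \<in> \<Omega> \<Longrightarrow> \<bar>f x\<bar> \<le> B" using continuous_bounded_on_domain by blast
  then show ?thesis by (intro domain.L2_bounded[OF continuous_measurable_lebesgue_on[OF f]]) simp
qed

lemma L2_continuous_mult:
  assumes "continuous_on UNIV \<theta>" "v \<in> L2 (lebesgue_on \<Omega>)"
  shows "(\<lambda>x. \<theta> x * v x) \<in> L2 (lebesgue_on \<Omega>)"
proof -
  obtain B where "\<And>x. x \<in> \<Omega> \<Longrightarrow> \<bar>\<theta> x\<bar> \<le> B" using continuous_bounded_on_domain[OF assms(1)] by blast
  then show ?thesis
    by (intro L2_bounded_mult[OF assms(2) continuous_measurable_lebesgue_on[OF assms(1)]]) simp
qed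

text \<open>All translates of a compactly supported function have the same integral, so the
  difference quotients integrate to zero, and so does their limit.\<close>

lemma test_function_integral_pderiv:
  assumes "test_function \<Omega> \<phi>"
  shows "(LINT x|lebesgue_on \<Omega>. pderiv_at \<phi> e x) = 0"
proof -
  have \<phi>: "smooth \<phi>" and supp: "closure {x. \<phi> x \<noteq> 0} \<subseteq> \<Omega>" and comp: "compact (closure {x. \<phi> x \<noteq> 0})"
    using assms by (auto simp: test_function_def)
  note c = smooth_continuous[OF \<phi>, of UNIV]
  have [measurable]: "\<phi> \<in> borel_measurable borel" using c by (rule borel_measurable_continuous_onI)
  obtain R where R: "R > 0" "\<And>x. x \<in> \<Omega> \<Longrightarrow> norm x \<le> R" using domain_radius by blast
  \<comment> \<open>The ball contains the supports of all translates that occur, so integrating over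
    it is integrating over the whole space. The Lipschitz bound below needs another
    \<open>norm e\<close> of room, for the shifted points.\<close>
  define S where "S = cball (0::'a) (R + norm e)"
  have S: "S \<in> lmeasurable" and Ss: "S \<in> sets lebesgue" by (auto simp: S_def)
  obtain L where "L-lipschitz_on (cball 0 (R + 2 * norm e)) \<phi>"
    using smooth_lipschitz_on_cball[OF \<phi>] by blast
  then have lim: "(\<lambda>n. LINT x|lebesgue_on S. dquot \<phi> e n x)
    \<longlonglongrightarrow> (LINT x|lebesgue_on S. pderiv_at \<phi> e x)"
    by (intro difference_quotient_integral[OF S, of e "R + 2 * norm e"] smooth_dquot_tendsto[OF \<phi>])
       (auto simp: S_def)
  have supp': "\<phi> x = 0" if "x \<notin> \<Omega>" for x
    using supp closure_subset[of "{x. \<phi> x \<noteq> 0}"] that by auto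
  have i: "integrable lborel \<phi>"
  proof -
    have "integrable lborel (\<lambda>x. indicator (closure {x. \<phi> x \<noteq> 0}) x *\<^sub>R \<phi> x)"
      using comp continuous_on_subset[OF c] by (intro borel_integrable_compact) auto
    moreover have "(\<lambda>x. indicator (closure {x. \<phi> x \<noteq> 0}) x *\<^sub>R \<phi> x) = \<phi>"
      using closure_subset[of "{x. \<phi> x \<noteq> 0}"] by (auto simp: indicator_def fun_eq_iff)
    ultimately show ?thesis by simp
  qed
  have sh: "(LINT x|lebesgue_on S. \<phi> (x + t *\<^sub>R e)) = (LINT x|lborel. \<phi> x)"
    and shi: "integrable (lebesgue_on S) (\<lambda>x. \<phi> (x + t *\<^sub>R e))"
    if t: "0 \<le> t" "t \<le> 1" for t
  proof -
    have "x \<in> S" if "\<phi> (x + t *\<^sub>R e) \<noteq> 0" for x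
    proof -
      have "norm (x + t *\<^sub>R e) \<le> R" using supp' R(2) that by blast
      then have "norm x \<le> R + t * norm e" using norm_triangle_ineq4[of "x + t *\<^sub>R e" "t *\<^sub>R e"] t by simp
      also have "\<dots> \<le> R + norm e" using t mult_right_mono[of t 1 "norm e"] by simp
      finally show ?thesis by (simp add: S_def)
    qed
    then have eq: "(\<lambda>x. indicator S x *\<^sub>R \<phi> (x + t *\<^sub>R e)) = (\<lambda>x. \<phi> (x + t *\<^sub>R e))"
      by (auto simp: indicator_def fun_eq_iff)
    have "(LINT x|lebesgue_on S. \<phi> (x + t *\<^sub>R e)) = (LINT x|lebesgue. \<phi> (x + t *\<^sub>R e))"
      using Ss by (subst integral_restrict_space) (simp_all add: eq del: real_scaleR_def)
    also have "\<dots> = (LINT x|lborel. \<phi> (x + t *\<^sub>R e))" by (rule integral_completion) measurable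
    finally show "(LINT x|lebesgue_on S. \<phi> (x + t *\<^sub>R e)) = (LINT x|lborel. \<phi> x)"
      using integrable_lborel_shift(2)[OF i] by simp
    show "integrable (lebesgue_on S) (\<lambda>x. \<phi> (x + t *\<^sub>R e))"
      using Ss integrable_lborel_shift(1)[OF i, of "t *\<^sub>R e"]
      by (subst integrable_restrict_space) (simp_all add: eq integrable_completion del: real_scaleR_def)
  qed
  have "(LINT x|lebesgue_on S. dquot \<phi> e n x) = 0" for n
  proof -
    have t: "0 \<le> inverse (real (Suc n))" "inverse (real (Suc n)) \<le> 1" by (auto simp: inverse_eq_divide)
    show ?thesis
      using sh[OF t] shi[OF t] sh[of 0] shi[of 0] by (simp add: dquot_def del: of_nat_Suc)
  qed
  from lim[unfolded this LIMSEQ_const_iff] have "(LINT x|lebesgue_on S. pderiv_at \<phi> e x) = 0" by simp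
  moreover have "(LINT x|lebesgue_on S. pderiv_at \<phi> e x) = (LINT x|lebesgue_on \<Omega>. pderiv_at \<phi> e x)"
  proof -
    have "\<Omega> \<subseteq> S" using R(2) by (auto simp: S_def intro!: add_increasing2)
    moreover have "pderiv_at \<phi> e x = 0" if "x \<notin> \<Omega>" for x
      using pderiv_eq_0_outside_support[OF \<phi>] supp that by blast
    ultimately have "(\<lambda>x. indicator S x *\<^sub>R pderiv_at \<phi> e x) = (\<lambda>x. indicator \<Omega> x *\<^sub>R pderiv_at \<phi> e x)"
      by (auto simp: indicator_def fun_eq_iff)
    moreover have "(LINT x|lebesgue_on S. pderiv_at \<phi> e x) = (LINT x|lebesgue. indicator S x *\<^sub>R pderiv_at \<phi> e x)"
      by (rule integral_restrict_space) (use Ss in simp)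
    moreover have "(LINT x|lebesgue_on \<Omega>. pderiv_at \<phi> e x) = (LINT x|lebesgue. indicator \<Omega> x *\<^sub>R pderiv_at \<phi> e x)"
      by (rule integral_restrict_space) (use domain_sets in simp)
    ultimately show ?thesis by (simp only:)
  qed
  ultimately show ?thesis by simp
qed

lemma has_weak_partial_smooth:
  assumes "smooth \<phi>" "i \<in> Basis"
  shows "has_weak_partial \<Omega> i \<phi> (pderiv_at \<phi> i)"
  unfolding has_weak_partial_def
proof (intro conjI allI impI)
  show L: "\<phi> \<in> L2 (lebesgue_on \<Omega>)" "pderiv_at \<phi> i \<in> L2 (lebesgue_on \<Omega>)"
    using assms by (auto intro!: continuous_L2 smooth_continuous smooth_pderiv)
  fix \<eta> assume \<eta>: "test_function \<Omega> \<eta>"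
  then have s: "smooth \<eta>" by (simp add: test_function_def)
  have L': "\<eta> \<in> L2 (lebesgue_on \<Omega>)" "pderiv_at \<eta> i \<in> L2 (lebesgue_on \<Omega>)"
    using s assms by (auto intro!: continuous_L2 smooth_continuous smooth_pderiv)
  \<comment> \<open>The product of \<phi> with a test function is again a test function, so its
    derivative integrates to zero.\<close>
  have "(LINT x|lebesgue_on \<Omega>. \<phi> x * pderiv_at \<eta> i x + pderiv_at \<phi> i x * \<eta> x) = 0"
    using test_function_integral_pderiv[OF test_function_mult[OF assms(1) \<eta>], of i]
    by (simp add: pderiv_mult[OF assms(1) s])
  then show "(LINT x|lebesgue_on \<Omega>. \<phi> x * pderiv_at \<eta> i x) = - (LINT x|lebesgue_on \<Omega>. pderiv_at \<phi> i x * \<eta> x)"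
    using L2_mult_integrable[OF L(1) L'(2)] L2_mult_integrable[OF L(2) L'(1)] by simp
qed

lemma test_function_L2:
  assumes "test_function \<Omega> \<eta>"
  shows "\<eta> \<in> L2 (lebesgue_on \<Omega>)" "i \<in> Basis \<Longrightarrow> pderiv_at \<eta> i \<in> L2 (lebesgue_on \<Omega>)"
  using assms by (auto intro!: continuous_L2 smooth_continuous smooth_pderiv simp: test_function_def)

lemma has_weak_partial_lincomb:
  assumes u: "has_weak_partial \<Omega> i u u'" and v: "has_weak_partial \<Omega> i v v'" and i: "i \<in> Basis"
  shows "has_weak_partial \<Omega> i (\<lambda>x. a * u x + b * v x) (\<lambda>x. a * u' x + b * v' x)"
  unfolding has_weak_partial_def
proof (intro conjI allI impI)
  have L: "u \<in> L2 (lebesgue_on \<Omega>)" "u' \<in> L2 (lebesgue_on \<Omega>)" "v \<in> L2 (lebesgue_on \<Omega>)" "v' \<in> L2 (lebesgue_on \<Omega>)"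
    using u v by (auto simp: has_weak_partial_def)
  then show "(\<lambda>x. a * u x + b * v x) \<in> L2 (lebesgue_on \<Omega>)" "(\<lambda>x. a * u' x + b * v' x) \<in> L2 (lebesgue_on \<Omega>)"
    by (auto intro!: L2_add L2_cmult)
  fix \<eta> assume \<eta>: "test_function \<Omega> \<eta>"
  note T = test_function_L2(1)[OF \<eta>] test_function_L2(2)[OF \<eta> i]
  note I = L2_mult_integrable[OF L(1) T(2)] L2_mult_integrable[OF L(2) T(1)]
    L2_mult_integrable[OF L(3) T(2)] L2_mult_integrable[OF L(4) T(1)]
  show "(LINT x|lebesgue_on \<Omega>. (a * u x + b * v x) * pderiv_at \<eta> i x) =
      - (LINT x|lebesgue_on \<Omega>. (a * u' x + b * v' x) * \<eta> x)"
    using I u v \<eta> unfolding has_weak_partial_def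
    by (simp add: distrib_right mult.assoc)
qed

lemma has_weak_partial_mult:
  assumes u: "has_weak_partial \<Omega> i u u'" and \<theta>: "smooth \<theta>" and i: "i \<in> Basis"
  shows "has_weak_partial \<Omega> i (\<lambda>x. \<theta> x * u x) (\<lambda>x. \<theta> x * u' x + pderiv_at \<theta> i x * u x)"
  unfolding has_weak_partial_def
proof (intro conjI allI impI)
  have L: "u \<in> L2 (lebesgue_on \<Omega>)" "u' \<in> L2 (lebesgue_on \<Omega>)"
    using u by (auto simp: has_weak_partial_def)
  note c = smooth_continuous[OF \<theta>, of UNIV] smooth_continuous[OF smooth_pderiv[OF \<theta> i], of UNIV]
  have L': "(\<lambda>x. \<theta> x * u' x) \<in> L2 (lebesgue_on \<Omega>)" "(\<lambda>x. pderiv_at \<theta> i x * u x) \<in> L2 (lebesgue_on \<Omega>)"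
    using L2_continuous_mult L c by auto
  show "(\<lambda>x. \<theta> x * u x) \<in> L2 (lebesgue_on \<Omega>)" using L2_continuous_mult L c by auto
  show "(\<lambda>x. \<theta> x * u' x + pderiv_at \<theta> i x * u x) \<in> L2 (lebesgue_on \<Omega>)"
    using L' by (rule L2_add)
  fix \<eta> assume \<eta>: "test_function \<Omega> \<eta>"
  then have s: "smooth \<eta>" by (simp add: test_function_def)
  note T = test_function_L2[OF \<eta>]
  note t = test_function_mult[OF \<theta> \<eta>]
  \<comment> \<open>The identity for \<open>u\<close> is tested with the product of \<theta> and
    \<eta>; the term in which the derivative falls on \<theta> goes over into the new weak
    derivative.\<close>
  have "(LINT x|lebesgue_on \<Omega>. u x * pderiv_at (\<lambda>x. \<theta> x * \<eta> x) i x) = - (LINT x|lebesgue_on \<Omega>. u' x * (\<theta> x * \<eta> x))"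
    using u t by (simp add: has_weak_partial_def)
  moreover have I0: "integrable (lebesgue_on \<Omega>) (\<lambda>x. u x * pderiv_at (\<lambda>x. \<theta> x * \<eta> x) i x)"
    using L2_mult_integrable[OF L(1) test_function_L2(2)[OF t i]] .
  note I = L2_mult_integrable[OF L'(1) T(1)] L2_mult_integrable[OF L'(2) T(1)]
  have "(LINT x|lebesgue_on \<Omega>. \<theta> x * u x * pderiv_at \<eta> i x) =
     (LINT x|lebesgue_on \<Omega>. u x * pderiv_at (\<lambda>x. \<theta> x * \<eta> x) i x - pderiv_at \<theta> i x * u x * \<eta> x)"
    unfolding pderiv_mult[OF \<theta> s] by (simp add: algebra_simps)
  moreover have "\<dots> = (LINT x|lebesgue_on \<Omega>. u x * pderiv_at (\<lambda>x. \<theta> x * \<eta> x) i x)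
      - (LINT x|lebesgue_on \<Omega>. pderiv_at \<theta> i x * u x * \<eta> x)"
    using I0 I(2) by (rule Bochner_Integration.integral_diff)
  moreover have "(LINT x|lebesgue_on \<Omega>. (\<theta> x * u' x + pderiv_at \<theta> i x * u x) * \<eta> x) =
      (LINT x|lebesgue_on \<Omega>. \<theta> x * u' x * \<eta> x) + (LINT x|lebesgue_on \<Omega>. pderiv_at \<theta> i x * u x * \<eta> x)"
    using I unfolding distrib_right by (rule Bochner_Integration.integral_add)
  moreover have "(LINT x|lebesgue_on \<Omega>. \<theta> x * u' x * \<eta> x) = (LINT x|lebesgue_on \<Omega>. u' x * (\<theta> x * \<eta> x))"
    by (simp add: mult_ac)
  ultimately show "(LINT x|lebesgue_on \<Omega>. \<theta> x * u x * pderiv_at \<eta> i x) =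
      - (LINT x|lebesgue_on \<Omega>. (\<theta> x * u' x + pderiv_at \<theta> i x * u x) * \<eta> x)"
    by linarith
qed

end

lemma bump_shift: "bump c r (y - x) = bump (x + c) r y"
  by (simp add: bump_def algebra_simps)

text \<open>If the mass were zero, the bump would vanish almost everywhere and an open ball would be
  negligible.\<close>

lemma integrable_bump:
  assumes "r > 0"
  shows "integrable lborel (bump c r)" "(LINT z|lborel. bump c r z) > 0"
proof -
  have c: "continuous_on UNIV (bump c r)" by (rule smooth_continuous[OF smooth_bump])
  have "integrable lborel (\<lambda>x. indicator (cball c r) x *\<^sub>R bump c r x)"
    using continuous_on_subset[OF c] by (intro borel_integrable_compact) auto
  moreover have "(\<lambda>x. indicator (cball c r) x *\<^sub>R bump c r x) = bump c r"
    using bump_eq_0_iff[OF assms, of c] by (force simp: indicator_def fun_eq_iff)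
  ultimately show i: "integrable lborel (bump c r)" by simp
  have "(LINT z|lborel. bump c r z) \<noteq> 0"
  proof
    assume "(LINT z|lborel. bump c r z) = 0"
    then have "AE z in lborel. bump c r z = 0"
      using integral_nonneg_eq_0_iff_AE[OF i] bump_nonneg by auto
    then have "AE z in lborel. z \<notin> ball c r"
      using bump_eq_0_iff[OF assms, of c] by simp
    then have "emeasure lborel (ball c r) = 0"
      by (subst (asm) AE_iff_measurable[of "ball c r"]) auto
    then have "negligible (ball c r)" by (simp add: negligible_iff_emeasure0)
    with assms show False by (simp add: open_not_negligible)
  qed
  moreover have "(LINT z|lborel. bump c r z) \<ge> 0" by (intro integral_nonneg_AE AE_I2 bump_nonneg)
  ultimately show "(LINT z|lborel. bump c r z) > 0" by linarith
qed

section \<open>Uniqueness of weak derivatives\<close>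

context bounded_domain
begin

text \<open>The kernels need not be normalised: their mass is a positive factor which cancels.\<close>

lemma mollify_sum_eq_0:
  assumes L2: "w1 \<in> L2 (lebesgue_on \<Omega>)" "q1 \<in> L2 (lebesgue_on \<Omega>)" "w2 \<in> L2 (lebesgue_on \<Omega>)" "q2 \<in> L2 (lebesgue_on \<Omega>)"
    and bumps: "\<And>\<eta>. \<eta> > 0 \<Longrightarrow> \<exists>c r. r > 0 \<and> norm c + r \<le> \<eta> \<and>
      (LINT x|lebesgue_on \<Omega>. w1 x * (LINT y|lebesgue_on \<Omega>. q1 y * bump c r (y - x))) +
      (LINT x|lebesgue_on \<Omega>. w2 x * (LINT y|lebesgue_on \<Omega>. q2 y * bump c r (y - x))) = 0"
  shows "(LINT x|lebesgue_on \<Omega>. w1 x * q1 x) + (LINT x|lebesgue_on \<Omega>. w2 x * q2 x) = 0"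
proof (rule ccontr)
  define s where "s = (LINT x|lebesgue_on \<Omega>. w1 x * q1 x) + (LINT x|lebesgue_on \<Omega>. w2 x * q2 x)"
  assume "\<not> ?thesis"
  \<comment> \<open>Two errors of a quarter of the mass times the modulus of \<open>s\<close> add up
    to one half, which cannot cover the whole.\<close>
  then have "\<bar>s\<bar> / 4 > 0" by (simp add: s_def)
  note * = mollify_lebesgue_on[OF domain_sets domain_bounded L2(1,2) this]
    mollify_lebesgue_on[OF domain_sets domain_bounded L2(3,4) this]
  obtain \<eta>1 where \<eta>1: "\<eta>1 > 0"
    "\<And>\<rho>. integrable lborel \<rho> \<Longrightarrow> (\<And>z. 0 \<le> \<rho> z) \<Longrightarrow> (\<And>z. \<rho> z \<le> 1) \<Longrightarrow>
      (\<And>z. \<eta>1 \<le> norm z \<Longrightarrow> \<rho> z = 0) \<Longrightarrow>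
      \<bar>(LINT x|lebesgue_on \<Omega>. w1 x * (LINT y|lebesgue_on \<Omega>. q1 y * \<rho> (y - x)))
        - (LINT z|lborel. \<rho> z) * (LINT x|lebesgue_on \<Omega>. w1 x * q1 x)\<bar> \<le> \<bar>s\<bar> / 4 * (LINT z|lborel. \<rho> z)"
    using *(1) by blast
  obtain \<eta>2 where \<eta>2: "\<eta>2 > 0"
    "\<And>\<rho>. integrable lborel \<rho> \<Longrightarrow> (\<And>z. 0 \<le> \<rho> z) \<Longrightarrow> (\<And>z. \<rho> z \<le> 1) \<Longrightarrow>
      (\<And>z. \<eta>2 \<le> norm z \<Longrightarrow> \<rho> z = 0) \<Longrightarrow>
      \<bar>(LINT x|lebesgue_on \<Omega>. w2 x * (LINT y|lebesgue_on \<Omega>. q2 y * \<rho> (y - x)))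
        - (LINT z|lborel. \<rho> z) * (LINT x|lebesgue_on \<Omega>. w2 x * q2 x)\<bar> \<le> \<bar>s\<bar> / 4 * (LINT z|lborel. \<rho> z)"
    using *(2) by blast
  obtain c r where cr: "r > 0" "norm c + r \<le> min \<eta>1 \<eta>2"
    "(LINT x|lebesgue_on \<Omega>. w1 x * (LINT y|lebesgue_on \<Omega>. q1 y * bump c r (y - x))) +
      (LINT x|lebesgue_on \<Omega>. w2 x * (LINT y|lebesgue_on \<Omega>. q2 y * bump c r (y - x))) = 0"
    using bumps[of "min \<eta>1 \<eta>2"] \<eta>1(1) \<eta>2(1) by auto
  have z: "bump c r z = 0" if "min \<eta>1 \<eta>2 \<le> norm z" for z
  proof -
    have "norm c + r \<le> norm z" using that cr(2) by linarith
    also have "\<dots> \<le> norm c + dist c z" using norm_triangle_sub[of z c] by (simp add: dist_norm norm_minus_commute)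
    finally show ?thesis using cr(1) by (simp add: bump_eq_0_iff)
  qed
  define m where "m = (LINT z|lborel. bump c r z)"
  have m: "m > 0" using integrable_bump(2)[OF cr(1)] by (simp add: m_def)
  have "\<bar>(LINT x|lebesgue_on \<Omega>. w1 x * (LINT y|lebesgue_on \<Omega>. q1 y * bump c r (y - x)))
        - m * (LINT x|lebesgue_on \<Omega>. w1 x * q1 x)\<bar> \<le> \<bar>s\<bar> / 4 * m"
    unfolding m_def by (rule \<eta>1(2)) (use cr(1) z integrable_bump(1) bump_nonneg bump_le_1 in auto)
  moreover have "\<bar>(LINT x|lebesgue_on \<Omega>. w2 x * (LINT y|lebesgue_on \<Omega>. q2 y * bump c r (y - x)))
        - m * (LINT x|lebesgue_on \<Omega>. w2 x * q2 x)\<bar> \<le> \<bar>s\<bar> / 4 * m"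
    unfolding m_def by (rule \<eta>2(2)) (use cr(1) z integrable_bump(1) bump_nonneg bump_le_1 in auto)
  ultimately have "\<bar>m * (LINT x|lebesgue_on \<Omega>. w1 x * q1 x) + m * (LINT x|lebesgue_on \<Omega>. w2 x * q2 x)\<bar> \<le> \<bar>s\<bar> / 2 * m"
    using cr(3) by linarith
  then have "\<bar>s\<bar> * m \<le> \<bar>s\<bar> / 2 * m"
    using m by (simp add: s_def abs_mult distrib_left[symmetric] mult.commute)
  with \<open>\<bar>s\<bar> / 4 > 0\<close> m show False by simp
qed

text \<open>On the points farther than 1/(n+1) from the complement, a bump of radius at most 1/(n+1)
  is a test function, so the mollified \<open>v\<close> vanishes there. Pairing it with
  \<open>v\<close> restricted to these points gives the integral of the square of \<open>v\<close>
  over them in the limit; the second pairing of \<open>mollify_sum_eq_0\<close> is taken to be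
  zero.\<close>

lemma fundamental_lemma:
  assumes v: "v \<in> L2 (lebesgue_on \<Omega>)"
    and test: "\<And>\<phi>. test_function \<Omega> \<phi> \<Longrightarrow> (LINT x|lebesgue_on \<Omega>. v x * \<phi> x) = 0"
  shows "AE x in lebesgue_on \<Omega>. v x = 0"
proof -
  define K where "K n = {x. inverse (real (Suc n)) < infdist x (- \<Omega>)}" for n
  \<comment> \<open>\<open>infdist\<close> to the empty set is 0 by convention, so the sets
    \<open>K n\<close> exhaust the domain only if the complement is nonempty.\<close>
  have ne: "- \<Omega> \<noteq> {}" using domain_bounded not_bounded_UNIV by (metis Compl_empty_eq double_complement)
  have oK: "open (K n)" for n unfolding K_def by (intro open_Collect_less continuous_intros)
  have "AE x in lebesgue_on \<Omega>. x \<in> K n \<longrightarrow> v x = 0" for n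
  proof -
    have mK: "(\<lambda>x. indicator (K n) x :: real) \<in> borel_measurable (lebesgue_on \<Omega>)"
      using oK by (intro measurable_restrict_space1 measurable_completion) auto
    have w: "(\<lambda>x. indicator (K n) x * v x) \<in> L2 (lebesgue_on \<Omega>)"
      by (rule L2_bounded_mult[OF v mK, of 1]) (auto simp: indicator_def)
    have "(LINT x|lebesgue_on \<Omega>. (indicator (K n) x * v x) * v x) + (LINT x|lebesgue_on \<Omega>. 0 * 0) = 0"
    proof (rule mollify_sum_eq_0[OF w v])
      fix \<eta> :: real assume "\<eta> > 0"
      define r where "r = min \<eta> (inverse (real (Suc n)))"
      have r: "r > 0" "r \<le> \<eta>" using \<open>\<eta> > 0\<close> by (auto simp: r_def)
      have zero: "indicator (K n) x * v x * (LINT y|lebesgue_on \<Omega>. v y * bump 0 r (y - x)) = 0" for x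
      proof (cases "x \<in> K n")
        case True
        have "cball x r \<subseteq> \<Omega>"
        proof
          fix y assume "y \<in> cball x r"
          then have "dist x y \<le> inverse (real (Suc n))" by (simp add: r_def)
          then show "y \<in> \<Omega>" using True infdist_le[of y "- \<Omega>" x] by (force simp: K_def)
        qed
        from test[OF test_function_bump[OF r(1) this]] show ?thesis by (simp add: bump_shift)
      qed simp
      show "\<exists>c r. r > 0 \<and> norm c + r \<le> \<eta> \<and>
        (LINT x|lebesgue_on \<Omega>. indicator (K n) x * v x * (LINT y|lebesgue_on \<Omega>. v y * bump c r (y - x))) +
        (LINT x|lebesgue_on \<Omega>. 0 * (LINT y|lebesgue_on \<Omega>. 0 * bump c r (y - x))) = 0"
        using r by (intro exI[of _ 0] exI[of _ r]) (simp add: zero del: mult_eq_0_iff)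
    qed (auto simp: L2_def)
    then have "(LINT x|lebesgue_on \<Omega>. (indicator (K n) x * v x) * v x) = 0" by simp
    moreover have "integrable (lebesgue_on \<Omega>) (\<lambda>x. (indicator (K n) x * v x) * v x)"
      using L2_mult_integrable[OF w v] .
    ultimately have "AE x in lebesgue_on \<Omega>. (indicator (K n) x * v x) * v x = 0"
      by (subst (asm) integral_nonneg_eq_0_iff_AE) (auto simp: indicator_def)
    then show ?thesis by (auto elim!: eventually_mono)
  qed
  then have K_AE: "AE x in lebesgue_on \<Omega>. \<forall>n. x \<in> K n \<longrightarrow> v x = 0" unfolding AE_all_countable by blast
  have K_ex: "\<exists>n. x \<in> K n" if "x \<in> \<Omega>" for x
  proof -
    have "0 < infdist x (- \<Omega>)"
      using domain_open ne that by (intro infdist_pos_not_in_closed) auto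
    from reals_Archimedean[OF this] show ?thesis by (simp add: K_def)
  qed
  show ?thesis
    by (rule AE_mp[OF K_AE], rule AE_I2) (use K_ex in auto)
qed

lemma has_weak_partial_unique:
  assumes u: "has_weak_partial \<Omega> i u v" and v: "has_weak_partial \<Omega> i u v'"
  shows "AE x in lebesgue_on \<Omega>. v x = v' x"
proof -
  have L: "v \<in> L2 (lebesgue_on \<Omega>)" "v' \<in> L2 (lebesgue_on \<Omega>)"
    using u v by (auto simp: has_weak_partial_def)
  have "AE x in lebesgue_on \<Omega>. v x - v' x = 0"
  proof (rule fundamental_lemma[OF L2_diff[OF L]])
    fix \<phi> assume \<phi>: "test_function \<Omega> \<phi>"
    note T = test_function_L2(1)[OF \<phi>]
    show "(LINT x|lebesgue_on \<Omega>. (v x - v' x) * \<phi> x) = 0"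
      using u v \<phi> L2_mult_integrable[OF L(1) T] L2_mult_integrable[OF L(2) T]
      by (simp add: has_weak_partial_def left_diff_distrib)
  qed
  then show ?thesis by auto
qed

lemma weak_partial_works: "has_weak_partial \<Omega> i u v \<Longrightarrow> has_weak_partial \<Omega> i u (weak_partial \<Omega> i u)"
  unfolding weak_partial_def by (rule someI[where P = "has_weak_partial \<Omega> i u"])

lemma weak_partial_AE:
  "has_weak_partial \<Omega> i u v \<Longrightarrow> AE x in lebesgue_on \<Omega>. weak_partial \<Omega> i u x = v x"
  using has_weak_partial_unique weak_partial_works by blast

lemma H1_weak_partial: "u \<in> H1 \<Omega> \<Longrightarrow> i \<in> Basis \<Longrightarrow> has_weak_partial \<Omega> i u (weak_partial \<Omega> i u)"
  using weak_partial_works by (auto simp: H1_def)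

lemma H1_L2:
  assumes "u \<in> H1 \<Omega>"
  shows "u \<in> L2 (lebesgue_on \<Omega>)" "i \<in> Basis \<Longrightarrow> weak_partial \<Omega> i u \<in> L2 (lebesgue_on \<Omega>)"
  using assms H1_weak_partial[OF assms] by (auto simp: H1_def has_weak_partial_def)

lemma H1_lincomb:
  assumes "u \<in> H1 \<Omega>" "v \<in> H1 \<Omega>"
  shows "(\<lambda>x. a * u x + b * v x) \<in> H1 \<Omega>"
  using has_weak_partial_lincomb[OF assms[THEN H1_weak_partial]] assms[THEN H1_L2(1)]
  by (auto simp: H1_def intro!: L2_add L2_cmult)

lemma weak_partial_lincomb:
  assumes "u \<in> H1 \<Omega>" "v \<in> H1 \<Omega>" "i \<in> Basis"
  shows "AE x in lebesgue_on \<Omega>. weak_partial \<Omega> i (\<lambda>x. a * u x + b * v x) x =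
    a * weak_partial \<Omega> i u x + b * weak_partial \<Omega> i v x"
  by (intro weak_partial_AE has_weak_partial_lincomb H1_weak_partial assms)

lemma H1_smooth: "smooth \<phi> \<Longrightarrow> \<phi> \<in> H1 \<Omega>"
  using has_weak_partial_smooth smooth_continuous continuous_L2 unfolding H1_def by blast

lemma H1_mult:
  assumes "u \<in> H1 \<Omega>" "smooth \<theta>"
  shows "(\<lambda>x. \<theta> x * u x) \<in> H1 \<Omega>"
  using has_weak_partial_mult[OF H1_weak_partial[OF assms(1)] assms(2)]
    L2_continuous_mult[OF smooth_continuous[OF assms(2)] H1_L2(1)[OF assms(1)]]
  unfolding H1_def by blast

end

section \<open>Norms and traces\<close>

lemma weak_grad_inner:
  "weak_grad \<Omega> u x \<bullet> weak_grad \<Omega> v x = (\<Sum>i\<in>Basis. weak_partial \<Omega> i u x * weak_partial \<Omega> i v x)"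
  unfolding weak_grad_def by (subst euclidean_inner) simp

lemma weak_grad_norm_sq: "(norm (weak_grad \<Omega> u x))\<^sup>2 = (\<Sum>i\<in>Basis. (weak_partial \<Omega> i u x)\<^sup>2)"
  unfolding power2_norm_eq_inner weak_grad_inner by (simp add: power2_eq_square)

text \<open>Plays the part of a triangle inequality for squared norms: weaker by a constant, but it
  integrates directly and suffices for norms that tend to zero.\<close>

lemma lincomb_sq_le: "(a * x + b * y)\<^sup>2 \<le> 2 * a\<^sup>2 * x\<^sup>2 + 2 * b\<^sup>2 * (y::real)\<^sup>2"
proof -
  have "0 \<le> (a * x - b * y)\<^sup>2" by simp
  then show ?thesis by (simp add: power2_sum power2_diff power_mult_distrib)
qed

lemma L2_norm_lincomb:
  assumes "u \<in> L2 M" "v \<in> L2 M"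
  shows "(L2_norm M (\<lambda>x. a * u x + b * v x))\<^sup>2 \<le> 2 * a\<^sup>2 * (L2_norm M u)\<^sup>2 + 2 * b\<^sup>2 * (L2_norm M v)\<^sup>2"
proof -
  have "(LINT x|M. (a * u x + b * v x)\<^sup>2) \<le> (LINT x|M. 2 * a\<^sup>2 * (u x)\<^sup>2 + 2 * b\<^sup>2 * (v x)\<^sup>2)"
    using assms[THEN L2D(2)] L2D(2)[OF L2_add[OF L2_cmult[OF assms(1)] L2_cmult[OF assms(2)]]]
    by (intro integral_mono) (auto simp: lincomb_sq_le)
  then show ?thesis using assms[THEN L2D(2)] by (simp add: L2_norm_sq)
qed

lemma lincomb_norm_tendsto_0:
  fixes N :: "nat \<Rightarrow> real"
  assumes "\<And>k. 0 \<le> N k" "\<And>k. (N k)\<^sup>2 \<le> 2 * a\<^sup>2 * (A k)\<^sup>2 + 2 * b\<^sup>2 * (B k)\<^sup>2"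
    and "A \<longlonglongrightarrow> 0" "B \<longlonglongrightarrow> 0"
  shows "N \<longlonglongrightarrow> 0"
proof -
  have "(\<lambda>k. 2 * a\<^sup>2 * (A k)\<^sup>2 + 2 * b\<^sup>2 * (B k)\<^sup>2) \<longlonglongrightarrow> 2 * a\<^sup>2 * 0\<^sup>2 + 2 * b\<^sup>2 * 0\<^sup>2"
    by (intro tendsto_intros assms)
  then have lim: "(\<lambda>k. 2 * a\<^sup>2 * (A k)\<^sup>2 + 2 * b\<^sup>2 * (B k)\<^sup>2) \<longlonglongrightarrow> 0" by simp
  have "(\<lambda>k. (N k)\<^sup>2) \<longlonglongrightarrow> 0"
    by (rule Lim_null_comparison[OF _ lim], intro always_eventually allI) (simp add: assms(2))
  from tendsto_real_sqrt[OF this] show ?thesis using assms(1) by simp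
qed

context bounded_domain
begin

lemma H1_norm_sq:
  "(H1_norm \<Omega> u)\<^sup>2 = (LINT x|lebesgue_on \<Omega>. (u x)\<^sup>2 + (\<Sum>i\<in>Basis. (weak_partial \<Omega> i u x)\<^sup>2))"
  by (simp add: H1_norm_def weak_grad_norm_sq integral_nonneg_AE sum_nonneg)

lemma H1_norm_nonneg: "H1_norm \<Omega> u \<ge> 0"
  by (simp add: H1_norm_def integral_nonneg_AE)

lemma H1_norm_integrable:
  assumes "u \<in> H1 \<Omega>"
  shows "integrable (lebesgue_on \<Omega>) (\<lambda>x. (u x)\<^sup>2 + (\<Sum>i\<in>Basis. (weak_partial \<Omega> i u x)\<^sup>2))"
  using H1_L2[OF assms] by (auto intro!: Bochner_Integration.integrable_add Bochner_Integration.integrable_sum dest: L2D(2))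

lemma L2_norm_le_H1_norm:
  assumes "u \<in> H1 \<Omega>"
  shows "L2_norm (lebesgue_on \<Omega>) u \<le> H1_norm \<Omega> u"
    and "i \<in> Basis \<Longrightarrow> L2_norm (lebesgue_on \<Omega>) (weak_partial \<Omega> i u) \<le> H1_norm \<Omega> u"
proof -
  note I = H1_norm_integrable[OF assms]
  have "(L2_norm (lebesgue_on \<Omega>) u)\<^sup>2 \<le> (H1_norm \<Omega> u)\<^sup>2"
    unfolding L2_norm_sq H1_norm_sq
    using I L2D(2)[OF H1_L2(1)[OF assms]] by (intro integral_mono) (auto simp: sum_nonneg)
  then show "L2_norm (lebesgue_on \<Omega>) u \<le> H1_norm \<Omega> u"
    by (rule power2_le_imp_le) (rule H1_norm_nonneg)
  assume i: "i \<in> Basis"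
  have "(L2_norm (lebesgue_on \<Omega>) (weak_partial \<Omega> i u))\<^sup>2 \<le> (H1_norm \<Omega> u)\<^sup>2"
    unfolding L2_norm_sq H1_norm_sq
    using I L2D(2)[OF H1_L2(2)[OF assms i]] i
    by (intro integral_mono) (auto intro!: add_increasing member_le_sum)
  then show "L2_norm (lebesgue_on \<Omega>) (weak_partial \<Omega> i u) \<le> H1_norm \<Omega> u"
    by (rule power2_le_imp_le) (rule H1_norm_nonneg)
qed

lemma H1_norm_lincomb:
  assumes "u \<in> H1 \<Omega>" "v \<in> H1 \<Omega>"
  shows "(H1_norm \<Omega> (\<lambda>x. a * u x + b * v x))\<^sup>2 \<le> 2 * a\<^sup>2 * (H1_norm \<Omega> u)\<^sup>2 + 2 * b\<^sup>2 * (H1_norm \<Omega> v)\<^sup>2"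
proof -
  note I = assms[THEN H1_norm_integrable]
  \<comment> \<open>Chosen representatives of weak derivatives are linear only almost everywhere; as
    there are finitely many coordinates, one null set serves all.\<close>
  have "AE x in lebesgue_on \<Omega>. \<forall>i\<in>Basis. weak_partial \<Omega> i (\<lambda>x. a * u x + b * v x) x =
    a * weak_partial \<Omega> i u x + b * weak_partial \<Omega> i v x"
    using weak_partial_lincomb[OF assms] by (intro AE_finite_allI) auto
  then have "AE x in lebesgue_on \<Omega>. (a * u x + b * v x)\<^sup>2 + (\<Sum>i\<in>Basis. (weak_partial \<Omega> i (\<lambda>x. a * u x + b * v x) x)\<^sup>2)
     \<le> 2 * a\<^sup>2 * ((u x)\<^sup>2 + (\<Sum>i\<in>Basis. (weak_partial \<Omega> i u x)\<^sup>2)) + 2 * b\<^sup>2 * ((v x)\<^sup>2 + (\<Sum>i\<in>Basis. (weak_partial \<Omega> i v x)\<^sup>2))"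
  proof eventually_elim
    case (elim x)
    have "(\<Sum>i\<in>Basis. (weak_partial \<Omega> i (\<lambda>x. a * u x + b * v x) x)\<^sup>2) \<le>
      (\<Sum>i\<in>Basis. 2 * a\<^sup>2 * (weak_partial \<Omega> i u x)\<^sup>2 + 2 * b\<^sup>2 * (weak_partial \<Omega> i v x)\<^sup>2)"
      using elim by (intro sum_mono) (simp add: lincomb_sq_le)
    then show ?case using lincomb_sq_le[of a "u x" b "v x"]
      by (simp add: sum.distrib sum_distrib_left distrib_left)
  qed
  then have "(LINT x|lebesgue_on \<Omega>. (a * u x + b * v x)\<^sup>2 + (\<Sum>i\<in>Basis. (weak_partial \<Omega> i (\<lambda>x. a * u x + b * v x) x)\<^sup>2))
     \<le> (LINT x|lebesgue_on \<Omega>. 2 * a\<^sup>2 * ((u x)\<^sup>2 + (\<Sum>i\<in>Basis. (weak_partial \<Omega> i u x)\<^sup>2)) + 2 * b\<^sup>2 * ((v x)\<^sup>2 + (\<Sum>i\<in>Basis. (weak_partial \<Omega> i v x)\<^sup>2)))"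
    by (rule integral_mono_AE[OF H1_norm_integrable[OF H1_lincomb[OF assms]]
          Bochner_Integration.integrable_add[OF I[THEN integrable_mult_right]]])
  also have "\<dots> = 2 * a\<^sup>2 * (H1_norm \<Omega> u)\<^sup>2 + 2 * b\<^sup>2 * (H1_norm \<Omega> v)\<^sup>2"
    using I unfolding H1_norm_sq by (subst Bochner_Integration.integral_add) (auto intro: integrable_mult_right)
  finally show ?thesis unfolding H1_norm_sq .
qed

end

section \<open>Integration along the boundary and linearity of traces\<close>

lemma sets_boundary_measure: "A \<in> sets borel \<Longrightarrow> A \<in> sets (boundary_measure E)"
proof -
  assume "A \<in> sets borel"
  then have "A \<in> sets (measure_of UNIV (sets borel) (\<lambda>A. \<Sum>(a, b)\<in>E. ennreal (dist a b) * emeasure lborel {t \<in> {0..1}. linepath a b t \<in> A}))"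
    using sigma_algebra.sets_measure_of_eq[OF sets.sigma_algebra_axioms[of "borel :: (real^2) measure"]] by simp
  then show ?thesis unfolding boundary_measure_def by (rule sets_completionI_sets)
qed

lemma space_boundary_measure: "space (boundary_measure E) = UNIV"
  by (simp add: boundary_measure_def space_measure_of_conv)

lemma measurable_boundary_measure: "f \<in> borel_measurable borel \<Longrightarrow> f \<in> measurable (boundary_measure E) borel"
  by (rule measurableI) (auto intro: sets_boundary_measure measurable_sets_borel simp: space_boundary_measure)

lemma measurable_linepath: "linepath a b \<in> borel_measurable borel"
  by (intro borel_measurable_continuous_onI continuous_on_linepath)

lemma nn_integral_boundary_measure:
  assumes "f \<in> borel_measurable borel"
  shows "(\<integral>\<^sup>+x. f x \<partial>boundary_measure E) =
    (\<Sum>(a, b)\<in>E. ennreal (dist a b) * (\<integral>\<^sup>+t. f (linepath a b t) * indicator {0..1} t \<partial>lborel))"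
  using assms
proof (induction rule: borel_measurable_induct)
  case (cong f g)
  then have "f = g" by auto
  with cong show ?case by simp
next
  case (set A)
  note [measurable] = set measurable_linepath
  have "(\<integral>\<^sup>+t. indicator A (linepath a b t) * indicator {0..1} t \<partial>lborel) = emeasure lborel {t \<in> {0..1}. linepath a b t \<in> A}" for a b
  proof -
    have "(\<integral>\<^sup>+t. indicator A (linepath a b t) * indicator {0..1} t \<partial>lborel) = (\<integral>\<^sup>+t. indicator {t \<in> {0..1}. linepath a b t \<in> A} t \<partial>lborel)"
      by (intro nn_integral_cong) (auto simp: indicator_def)
    then show ?thesis by simp
  qed
  then show ?case
    using set by (simp add: emeasure_boundary_measure sets_boundary_measure)
next
  case (mult u c)
  note [measurable] = mult(2) measurable_linepath
  show ?case
    using mult measurable_boundary_measure[OF mult(2)]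
    by (simp add: nn_integral_cmult case_prod_unfold mult.assoc sum_distrib_left)
       (simp add: mult.left_commute)
next
  case (add u v)
  note [measurable] = add(1,3) measurable_linepath
  show ?case
    using add measurable_boundary_measure[OF add(1)] measurable_boundary_measure[OF add(3)]
    by (simp add: nn_integral_add case_prod_unfold distrib_left distrib_right sum.distrib)
next
  case (seq U)
  note [measurable] = seq(1) measurable_linepath
  have inc: "incseq (\<lambda>i t. U i (linepath a b t) * indicator {0..1} t)" for a b
    using seq(3) by (auto simp: incseq_def le_fun_def intro!: mult_right_mono)
  have "(\<integral>\<^sup>+t. (SUP i. U i) (linepath a b t) * indicator {0..1} t \<partial>lborel) =
      (SUP i. \<integral>\<^sup>+t. U i (linepath a b t) * indicator {0..1} t \<partial>lborel)" for a b
    using nn_integral_monotone_convergence_SUP[OF inc[of a b]]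
    by (simp add: SUP_mult_right_ennreal image_comp)
  then have "(\<Sum>(a, b)\<in>E. ennreal (dist a b) * (\<integral>\<^sup>+t. (SUP i. U i) (linepath a b t) * indicator {0..1} t \<partial>lborel)) =
     (SUP i. \<Sum>(a, b)\<in>E. ennreal (dist a b) * (\<integral>\<^sup>+t. U i (linepath a b t) * indicator {0..1} t \<partial>lborel))"
  proof (simp add: SUP_mult_left_ennreal case_prod_unfold, intro ennreal_SUP_sum[symmetric])
    fix e :: "(real^2) \<times> (real^2)"
    show "incseq (\<lambda>i. ennreal (dist (fst e) (snd e)) * (\<integral>\<^sup>+t. U i (linepath (fst e) (snd e) t) * indicator {0..1} t \<partial>lborel))"
      using inc by (auto simp: incseq_def le_fun_def intro!: mult_left_mono nn_integral_mono)
  qed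
  moreover have "(\<integral>\<^sup>+x. (SUP i. U i) x \<partial>boundary_measure E) = (SUP i. \<integral>\<^sup>+x. U i x \<partial>boundary_measure E)"
    using nn_integral_monotone_convergence_SUP[OF seq(3)] measurable_boundary_measure[OF seq(1)]
    by (simp add: image_comp)
  ultimately show ?case using seq(4) seq.IH by simp
qed

text \<open>Nonnegativity allows the value to be read off the extended nonnegative integral. Later
  uses integrate squares and absolute values only.\<close>

lemma boundary_integral_continuous:
  fixes f :: "real^2 \<Rightarrow> real"
  assumes f: "continuous_on UNIV f" "\<And>x. 0 \<le> f x"
  shows "integrable (boundary_measure E) f"
    and "(LINT x|boundary_measure E. f x) = (\<Sum>(a, b)\<in>E. dist a b * integral {0..1} (\<lambda>t. f (linepath a b t)))"
proof -
  have [measurable]: "f \<in> borel_measurable borel" using f(1) by (rule borel_measurable_continuous_onI)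
  have I: "((\<lambda>t. f (linepath a b t)) has_integral integral {0..1} (\<lambda>t. f (linepath a b t))) {0..1}" for a b
    by (intro integrable_integral integrable_continuous_real continuous_on_compose2[OF f(1)] continuous_on_linepath) auto
  have nn: "integral {0..1} (\<lambda>t. f (linepath a b t)) \<ge> 0" for a b
    by (intro integral_nonneg has_integral_integrable[OF I] f(2))
  have "(\<integral>\<^sup>+t. ennreal (f (linepath a b t)) * indicator {0..1} t \<partial>lborel) = ennreal (integral {0..1} (\<lambda>t. f (linepath a b t)))" for a b
  proof -
    have "ennreal (f (linepath a b t)) * indicator {0..1} t = ennreal (indicator {0..1} t * f (linepath a b t))" for t
      by (simp add: indicator_def)
    then show ?thesis using nn_integral_has_integral_lebesgue[OF f(2) I[of a b]] by simp
  qed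
  then have "(\<integral>\<^sup>+x. ennreal (f x) \<partial>boundary_measure E) = (\<Sum>(a, b)\<in>E. ennreal (dist a b * integral {0..1} (\<lambda>t. f (linepath a b t))))"
    by (subst nn_integral_boundary_measure) (auto simp: ennreal_mult nn)
  also have "\<dots> = ennreal (\<Sum>(a, b)\<in>E. dist a b * integral {0..1} (\<lambda>t. f (linepath a b t)))"
    unfolding case_prod_unfold by (rule sum_ennreal) (simp add: nn)
  finally have eq: "(\<integral>\<^sup>+x. ennreal (f x) \<partial>boundary_measure E) = \<dots>" .
  have m: "f \<in> borel_measurable (boundary_measure E)" by (rule measurable_boundary_measure) simp
  show "integrable (boundary_measure E) f"
    by (rule integrableI_nn_integral_finite[OF m _ eq]) (auto simp: f(2) intro!: sum_nonneg mult_nonneg_nonneg nn)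
  show "(LINT x|boundary_measure E. f x) = (\<Sum>(a, b)\<in>E. dist a b * integral {0..1} (\<lambda>t. f (linepath a b t)))"
    by (subst integral_eq_nn_integral[OF m]) (auto simp: f(2) eq intro!: sum_nonneg mult_nonneg_nonneg nn enn2real_ennreal)
qed

lemma continuous_L2_boundary:
  fixes f :: "real^2 \<Rightarrow> real"
  assumes "continuous_on UNIV f"
  shows "f \<in> L2 (boundary_measure E)"
proof -
  have "integrable (boundary_measure E) (\<lambda>x. (f x)\<^sup>2)"
    using assms by (intro boundary_integral_continuous) (auto intro!: continuous_intros)
  moreover have "f \<in> borel_measurable (boundary_measure E)"
    by (intro measurable_boundary_measure borel_measurable_continuous_onI assms)
  ultimately show ?thesis by (simp add: L2_def)
qed

text \<open>The same combination of the approximating sequences works. In particular the difference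
  of two functions with a common trace has trace zero.\<close>

lemma has_trace_lincomb:
  assumes bd: "bounded_domain \<Omega>" and u: "has_trace \<Omega> E u g" and v: "has_trace \<Omega> E v h"
  shows "has_trace \<Omega> E (\<lambda>x. a * u x + b * v x) (\<lambda>x. a * g x + b * h x)"
proof -
  interpret bounded_domain \<Omega> by (rule bd)
  obtain \<phi> where \<phi>: "\<And>k. smooth (\<phi> k)" "(\<lambda>k. H1_norm \<Omega> (\<lambda>x. \<phi> k x - u x)) \<longlonglongrightarrow> 0"
    "(\<lambda>k. L2_norm (boundary_measure E) (\<lambda>x. \<phi> k x - g x)) \<longlonglongrightarrow> 0"
    using u unfolding has_trace_def by blast
  obtain \<eta> where \<eta>: "\<And>k. smooth (\<eta> k)" "(\<lambda>k. H1_norm \<Omega> (\<lambda>x. \<eta> k x - v x)) \<longlonglongrightarrow> 0"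
    "(\<lambda>k. L2_norm (boundary_measure E) (\<lambda>x. \<eta> k x - h x)) \<longlonglongrightarrow> 0"
    using v unfolding has_trace_def by blast
  have uv: "u \<in> H1 \<Omega>" "v \<in> H1 \<Omega>" "g \<in> L2 (boundary_measure E)" "h \<in> L2 (boundary_measure E)"
    using u v by (auto simp: has_trace_def)
  have d: "(\<lambda>x. \<phi> k x - u x) \<in> H1 \<Omega>" "(\<lambda>x. \<eta> k x - v x) \<in> H1 \<Omega>" for k
    using H1_lincomb[OF H1_smooth[OF \<phi>(1)] uv(1), of 1 _ "- 1"] H1_lincomb[OF H1_smooth[OF \<eta>(1)] uv(2), of 1 _ "- 1"]
    by simp_all
  have db: "(\<lambda>x. \<phi> k x - g x) \<in> L2 (boundary_measure E)" "(\<lambda>x. \<eta> k x - h x) \<in> L2 (boundary_measure E)" for k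
    using L2_diff[OF continuous_L2_boundary[OF smooth_continuous]] \<phi>(1) \<eta>(1) uv by auto
  have eq: "a * \<phi> k x + b * \<eta> k x - (a * p + b * q) = a * (\<phi> k x - p) + b * (\<eta> k x - q)" for k x p q
    by (simp add: algebra_simps)
  have "(\<lambda>k. H1_norm \<Omega> (\<lambda>x. a * \<phi> k x + b * \<eta> k x - (a * u x + b * v x))) \<longlonglongrightarrow> 0"
    unfolding eq by (rule lincomb_norm_tendsto_0[OF H1_norm_nonneg H1_norm_lincomb[OF d] \<phi>(2) \<eta>(2)])
  moreover have "(\<lambda>k. L2_norm (boundary_measure E) (\<lambda>x. a * \<phi> k x + b * \<eta> k x - (a * g x + b * h x))) \<longlonglongrightarrow> 0"
    unfolding eq by (rule lincomb_norm_tendsto_0[OF L2_norm_nonneg L2_norm_lincomb[OF db] \<phi>(3) \<eta>(3)])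
  moreover have "smooth (\<lambda>x. a * \<phi> k x + b * \<eta> k x)" for k
    by (intro smooth_add smooth_mult smooth_const \<phi> \<eta>)
  ultimately show ?thesis
    unfolding has_trace_def using H1_lincomb[OF uv(1,2)] L2_add[OF L2_cmult[OF uv(3)] L2_cmult[OF uv(4)]]
    by (intro conjI exI[of _ "\<lambda>k x. a * \<phi> k x + b * \<eta> k x"]) auto
qed

section \<open>Green's estimate\<close>

text \<open>Parallelograms are parametrised by the unit square with the first coordinate running
  along the edge; a bound that depends on the edge parameter alone then becomes an edge
  integral.\<close>

lemma integral_cbox_first_coordinate:
  fixes f :: "real \<Rightarrow> real"
  assumes f: "continuous_on UNIV f" "\<And>t. 0 \<le> f t"
  shows "integral (cbox 0 (1::real^2)) (\<lambda>x. f (x $ 1)) = integral {0..1} f"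
proof -
  have [measurable]: "f \<in> borel_measurable borel" using f(1) by (rule borel_measurable_continuous_onI)
  have I1: "(f has_integral integral {0..1} f) {0..1}"
    by (intro integrable_integral integrable_continuous_real continuous_on_subset[OF f(1)]) auto
  have "(\<lambda>x::real^2. f (x $ 1)) integrable_on cbox 0 1"
    by (intro integrable_continuous continuous_on_compose2[OF f(1)]) (auto intro!: continuous_intros)
  then have I2: "((\<lambda>x::real^2. f (x $ 1)) has_integral integral (cbox 0 1) (\<lambda>x::real^2. f (x $ 1))) (cbox 0 1)"
    by (rule integrable_integral)
  \<comment> \<open>One factor per axis: \<open>f\<close> on the first and 1 on the second, both cut
    off to the unit interval, so that the integral over the square factorises.\<close>
  define g where "g b t = (if b = axis 1 (1::real) then f t else 1) * indicator {0..1} t" for b :: "real^2" and t :: real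
  have B: "(Basis :: (real^2) set) = {axis 1 1, axis 2 1}" "axis 1 (1::real) \<noteq> (axis 2 1 :: real^2)"
    by (auto simp: Basis_vec_def UNIV_2 axis_eq_axis)
  have "ennreal (integral (cbox 0 1) (\<lambda>x::real^2. f (x $ 1))) = (\<integral>\<^sup>+x. ennreal (indicator (cbox 0 (1::real^2)) x * f (x $ 1)) \<partial>lborel)"
    using nn_integral_has_integral_lebesgue[OF f(2) I2] by simp
  also have "\<dots> = (\<integral>\<^sup>+x. (\<Prod>b\<in>Basis. ennreal (g b (x \<bullet> b))) \<partial>(lborel :: (real^2) measure))"
  proof (rule nn_integral_cong)
    fix x :: "real^2"
    have "indicator (cbox 0 1) x * f (x $ 1) = (\<Prod>b\<in>Basis. g b (x \<bullet> b))"
      unfolding B(1) using B(2) by (auto simp: g_def inner_axis indicator_def mem_box_cart forall_2)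
    then show "ennreal (indicator (cbox 0 1) x * f (x $ 1)) = (\<Prod>b\<in>Basis. ennreal (g b (x \<bullet> b)))"
      by (simp add: prod_ennreal g_def f(2))
  qed
  also have "\<dots> = (\<Prod>b\<in>(Basis::(real^2) set). (\<integral>\<^sup>+t. ennreal (g b t) \<partial>lborel))"
    by (rule nn_integral_lborel_prod) (auto simp: g_def f(2))
  also have "\<dots> = (\<integral>\<^sup>+t. ennreal (indicator {0..1} t * f t) \<partial>lborel) * (\<integral>\<^sup>+t. indicator {0..1::real} t \<partial>lborel)"
    unfolding B(1) using B(2) by (simp add: g_def mult.commute ennreal_indicator)
  also have "\<dots> = ennreal (integral {0..1} f)"
    using nn_integral_has_integral_lebesgue[OF f(2) I1] by simp
  finally show ?thesis
    by (subst (asm) ennreal_inj) (auto intro!: integral_nonneg has_integral_integrable[OF I1] has_integral_integrable[OF I2] f(2))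
qed

text \<open>Lagrange's identity: the product of the squared norms exceeds the squared determinant by
  the square of the inner product.\<close>

lemma parallelogram_det_le:
  fixes v w :: "real^2"
  shows "\<bar>v $ 1 * w $ 2 - w $ 1 * v $ 2\<bar> \<le> norm v * norm w"
proof -
  have "(v $ 1 * w $ 2 - w $ 1 * v $ 2)\<^sup>2 \<le> (norm v)\<^sup>2 * (norm w)\<^sup>2"
  proof -
    have "(norm v)\<^sup>2 * (norm w)\<^sup>2 - (v $ 1 * w $ 2 - w $ 1 * v $ 2)\<^sup>2 = (v $ 1 * w $ 1 + v $ 2 * w $ 2)\<^sup>2"
      unfolding power2_norm_eq_inner by (simp add: inner_vec_def sum_2 power2_eq_square algebra_simps)
    then show ?thesis by (metis diff_ge_0_iff_ge zero_le_power2)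
  qed
  then have "\<bar>v $ 1 * w $ 2 - w $ 1 * v $ 2\<bar>\<^sup>2 \<le> (norm v * norm w)\<^sup>2" by (simp add: power_mult_distrib)
  then show ?thesis by (rule power2_le_imp_le) simp
qed

text \<open>Linear change of variables from the unit square. A degenerate parallelogram, swept along
  its own edge, is included: its determinant is zero.\<close>

lemma integral_parallelogram_le:
  fixes F :: "real^2 \<Rightarrow> real" and f :: "real \<Rightarrow> real"
  assumes F: "continuous_on UNIV F" "\<And>x. 0 \<le> F x" and f: "continuous_on UNIV f" "\<And>t. 0 \<le> f t"
    and le: "\<And>x::real^2. x \<in> cbox 0 1 \<Longrightarrow> F (a + ((x $ 1) *\<^sub>R v + (x $ 2) *\<^sub>R w)) \<le> f (x $ 1)"
  shows "(\<integral>\<^sup>+y. ennreal (indicator ((\<lambda>x::real^2. a + ((x $ 1) *\<^sub>R v + (x $ 2) *\<^sub>R w)) ` cbox 0 1) y * F y) \<partial>lborel)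
     \<le> ennreal (norm v * norm w * integral {0..1} f)"
proof -
  define T where "T x = (x $ 1) *\<^sub>R v + (x $ 2) *\<^sub>R w" for x :: "real^2"
  have lin: "linear T"
    unfolding T_def by (rule linearI) (simp_all add: scaleR_add_left scaleR_add_right)
  have det: "det (matrix T) = v $ 1 * w $ 2 - w $ 1 * v $ 2"
    by (simp add: det_2 matrix_def T_def axis_def)
  define H where "H y = F (a + y)" for y
  have cT: "continuous_on S T" for S unfolding T_def by (intro continuous_intros)
  have cH: "continuous_on S H" for S
    unfolding H_def by (intro continuous_on_compose2[OF F(1)] continuous_intros) auto
  have comp: "compact (T ` cbox 0 1)" by (intro compact_continuous_image cT compact_cbox)
  have AI: "(\<lambda>x. H (T x)) absolutely_integrable_on cbox 0 1"
    by (intro absolutely_integrable_continuous continuous_on_compose2[OF cH cT]) auto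
  have "(\<lambda>x. \<bar>det (matrix T)\<bar> *\<^sub>R H (T x)) absolutely_integrable_on cbox 0 1"
    using AI by (rule absolutely_integrable_scaleR_left)
  \<comment> \<open>The change of variables theorem speaks of functions with values in a vector
    type, so the integrand is wrapped into \<open>real^1\<close> and unwrapped afterwards.\<close>
  then have "(\<lambda>x. \<bar>det (matrix T)\<bar> *\<^sub>R (vec (H (T x)) :: real^1)) absolutely_integrable_on cbox 0 1"
    by (simp add: absolutely_integrable_on_1_iff)
  with has_absolute_integral_change_of_variables_linear[OF lin, where f = "\<lambda>x. vec (H x) :: real^1" and S = "cbox 0 1" and
      b = "integral (cbox 0 1) (\<lambda>x. \<bar>det (matrix T)\<bar> *\<^sub>R (vec (H (T x)) :: real^1))"]
  have "(\<lambda>x. vec (H x) :: real^1) absolutely_integrable_on T ` cbox 0 1"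
    "integral (T ` cbox 0 1) (\<lambda>x. vec (H x) :: real^1) = integral (cbox 0 1) (\<lambda>x. \<bar>det (matrix T)\<bar> *\<^sub>R (vec (H (T x)) :: real^1))"
    by auto
  then have H: "H absolutely_integrable_on T ` cbox 0 1"
    "integral (T ` cbox 0 1) H = integral (cbox 0 1) (\<lambda>x. \<bar>det (matrix T)\<bar> *\<^sub>R H (T x))"
    by (simp_all add: absolutely_integrable_on_1_iff integral_on_1_eq vec_eq_iff)
  have "(\<integral>\<^sup>+y. ennreal (indicator ((\<lambda>x. a + T x) ` cbox 0 1) y * F y) \<partial>lborel) =
     (\<integral>\<^sup>+y. ennreal (indicator (T ` cbox 0 1) y * H y) \<partial>lborel)"
  proof -
    have c: "compact ((\<lambda>x. a + T x) ` cbox 0 1)"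
      by (intro compact_continuous_image continuous_intros cT compact_cbox)
    have [measurable]: "F \<in> borel_measurable borel" using F(1) by (rule borel_measurable_continuous_onI)
    have [measurable]: "(\<lambda>x. a + T x) ` cbox 0 1 \<in> sets borel" using compact_imp_closed[OF c] by auto
    have "(\<integral>\<^sup>+y. ennreal (indicator ((\<lambda>x. a + T x) ` cbox 0 1) y * F y) \<partial>lborel) =
      (\<integral>\<^sup>+y. ennreal (indicator ((\<lambda>x. a + T x) ` cbox 0 1) y * F y) \<partial>distr lborel borel ((+) a))"
      by (simp add: lborel_distr_plus)
    also have "\<dots> = (\<integral>\<^sup>+y. ennreal (indicator ((\<lambda>x. a + T x) ` cbox 0 1) (a + y) * F (a + y)) \<partial>lborel)"
      by (rule nn_integral_distr) measurable
    also have "\<dots> = (\<integral>\<^sup>+y. ennreal (indicator (T ` cbox 0 1) y * H y) \<partial>lborel)"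
      by (intro nn_integral_cong) (auto simp: indicator_def H_def)
    finally show ?thesis .
  qed
  also have "\<dots> = ennreal (integral (T ` cbox 0 1) H)"
    by (rule nn_integral_has_integral_lebesgue[OF _ integrable_integral[OF set_lebesgue_integral_eq_integral(1)[OF H(1)]]])
       (simp add: H_def F(2))
  also have "integral (T ` cbox 0 1) H = \<bar>det (matrix T)\<bar> * integral (cbox 0 1) (\<lambda>x. H (T x))"
    unfolding H(2) by simp
  also have "\<dots> \<le> norm v * norm w * integral {0..1} f"
  proof (intro mult_mono)
    show "\<bar>det (matrix T)\<bar> \<le> norm v * norm w" unfolding det by (rule parallelogram_det_le)
    have "integral (cbox 0 1) (\<lambda>x. H (T x)) \<le> integral (cbox 0 (1::real^2)) (\<lambda>x. f (x $ 1))"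
    proof (rule integral_le)
      show "(\<lambda>x. H (T x)) integrable_on cbox 0 1" using AI by (rule set_lebesgue_integral_eq_integral(1))
      show "(\<lambda>x::real^2. f (x $ 1)) integrable_on cbox 0 1"
        by (intro integrable_continuous continuous_on_compose2[OF f(1)]) (auto intro!: continuous_intros)
    qed (use le in \<open>auto simp: H_def T_def\<close>)
    then show "integral (cbox 0 1) (\<lambda>x. H (T x)) \<le> integral {0..1} f"
      by (simp add: integral_cbox_first_coordinate[OF f])
    show "0 \<le> integral (cbox 0 1) (\<lambda>x. H (T x))"
      using AI F(2) by (intro integral_nonneg) (auto simp: H_def dest: set_lebesgue_integral_eq_integral(1))
  qed auto
  finally show ?thesis by (simp add: T_def ennreal_leI)
qed

text \<open>Moves the integral to the whole space, where translation invariance is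
  available.\<close>

lemma (in bounded_domain) integral_domain_continuous:
  fixes F :: "'a \<Rightarrow> real"
  assumes "continuous_on UNIV F"
  shows "integrable lborel (\<lambda>x. indicator \<Omega> x * F x)"
    "(LINT x|lebesgue_on \<Omega>. F x) = (LINT x|lborel. indicator \<Omega> x * F x)"
proof -
  have [measurable]: "F \<in> borel_measurable borel" "\<Omega> \<in> sets borel"
    using borel_measurable_continuous_onI[OF assms] domain_open by auto
  have m: "\<Omega> \<inter> space lebesgue \<in> sets lebesgue" using domain_sets by simp
  have "integrable (lebesgue_on \<Omega>) F" using domain.L2_integrable[OF continuous_L2[OF assms]] .
  then show "integrable lborel (\<lambda>x. indicator \<Omega> x * F x)"
    by (simp add: integrable_restrict_space[OF m] integrable_completion)
  show "(LINT x|lebesgue_on \<Omega>. F x) = (LINT x|lborel. indicator \<Omega> x * F x)"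
    by (simp add: integral_restrict_space[OF m] integral_completion)
qed

text \<open>If exactly one of \<open>x\<close> and \<open>x - d\<close> lies in the domain, the segment between them crosses the
  boundary, so \<open>x\<close> lies in the parallelogram swept by some edge.\<close>

lemma (in bounded_domain) symdiff_shift_swept:
  assumes fr: "frontier \<Omega> \<subseteq> (\<Union>(a, b)\<in>E. closed_segment a b)" and x: "(x \<in> \<Omega>) \<noteq> (x - d \<in> \<Omega>)"
  obtains a b s t where "(a, b) \<in> E" "0 \<le> s" "s \<le> 1" "0 \<le> t" "t \<le> 1" "x = a + (s *\<^sub>R (b - a) + t *\<^sub>R d)"
proof -
  have "closed_segment x (x - d) \<inter> \<Omega> \<noteq> {}" "closed_segment x (x - d) - \<Omega> \<noteq> {}"
    using x ends_in_segment[of x "x - d"] by auto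
  then have "closed_segment x (x - d) \<inter> frontier \<Omega> \<noteq> {}"
    by (rule connected_Int_frontier[OF connected_segment(1)])
  then obtain y where y: "y \<in> closed_segment x (x - d)" "y \<in> frontier \<Omega>" by auto
  then obtain a b where ab: "(a, b) \<in> E" "y \<in> closed_segment a b" using fr by auto
  obtain t where t: "0 \<le> t" "t \<le> 1" "y = (1 - t) *\<^sub>R x + t *\<^sub>R (x - d)"
    using y(1) by (auto simp: in_segment)
  obtain s where s: "0 \<le> s" "s \<le> 1" "y = (1 - s) *\<^sub>R a + s *\<^sub>R b"
    using ab(2) by (auto simp: in_segment)
  have "x = y + t *\<^sub>R d" using t(3) by (simp add: algebra_simps)
  also have "\<dots> = a + (s *\<^sub>R (b - a) + t *\<^sub>R d)" using s(3) by (simp add: algebra_simps)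
  finally show thesis using that ab(1) s t by blast
qed

text \<open>Only the points in exactly one of the domain and its translate contribute. They lie in
  the parallelograms swept by the edges, each of area at most the edge length times
  \<open>norm d\<close>, and on these \<open>F\<close> differs from its value on the edge by at most
  L * norm d.\<close>

lemma green_shift_estimate:
  fixes \<Omega> :: "(real^2) set" and F :: "real^2 \<Rightarrow> real"
  assumes bd: "bounded_domain \<Omega>" and E: "finite E" "frontier \<Omega> \<subseteq> (\<Union>(a, b)\<in>E. closed_segment a b)"
    and F: "continuous_on UNIV F" and L: "L-lipschitz_on (cball 0 R) F"
    and R: "\<And>a b. (a, b) \<in> E \<Longrightarrow> norm a + norm d \<le> R \<and> norm b + norm d \<le> R"
  shows "\<bar>LINT x|lebesgue_on \<Omega>. F (x + d) - F x\<bar> \<le>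
    norm d * (\<Sum>(a, b)\<in>E. dist a b * (integral {0..1} (\<lambda>t. \<bar>F (linepath a b t)\<bar>) + L * norm d))"
proof -
  interpret bounded_domain \<Omega> by (rule bd)
  have [measurable]: "F \<in> borel_measurable borel" "\<Omega> \<in> sets borel"
    using borel_measurable_continuous_onI[OF F] domain_open by auto
  have cF: "continuous_on UNIV (\<lambda>x. F (x + d))"
    by (intro continuous_on_compose2[OF F] continuous_intros) auto
  note I1 = integral_domain_continuous[OF cF] and I2 = integral_domain_continuous[OF F]
  have "integrable lborel (\<lambda>x. indicator \<Omega> (x - d) * F x)"
    using integrable_lborel_shift(1)[OF I1(1), of "- d"] by simp
  note I3 = this integrable_lborel_shift(2)[OF this, of d]
  define P where "P a b = (\<lambda>x. a + ((x $ 1) *\<^sub>R (b - a) + (x $ 2) *\<^sub>R d)) ` cbox 0 (1::real^2)" for a b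
  have Pc: "closed (P a b)" for a b
    unfolding P_def by (intro compact_imp_closed compact_continuous_image continuous_intros compact_cbox)
  have [measurable]: "P a b \<in> sets borel" for a b using Pc by auto
  have dI: "integrable lborel (\<lambda>x. (indicator \<Omega> (x - d) - indicator \<Omega> x) * F x)"
    using I2(1) I3(1) by (simp add: left_diff_distrib)
  have "integrable (lebesgue_on \<Omega>) (\<lambda>x. F (x + d))" "integrable (lebesgue_on \<Omega>) F"
    using domain.L2_integrable[OF continuous_L2] cF F by auto
  \<comment> \<open>Translation moves the shift from \<open>F\<close> to the indicator of the
    domain.\<close>
  then have "(LINT x|lebesgue_on \<Omega>. F (x + d) - F x) = (LINT x|lborel. (indicator \<Omega> (x - d) - indicator \<Omega> x) * F x)"
    using I1 I2 I3 by (simp add: left_diff_distrib)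
  also have "\<bar>\<dots>\<bar> \<le> (LINT x|lborel. \<bar>(indicator \<Omega> (x - d) - indicator \<Omega> x) * F x\<bar>)"
    by (rule integral_abs_bound)
  finally have "ennreal \<bar>LINT x|lebesgue_on \<Omega>. F (x + d) - F x\<bar> \<le> ennreal (LINT x|lborel. \<bar>(indicator \<Omega> (x - d) - indicator \<Omega> x) * F x\<bar>)"
    by (rule ennreal_leI)
  also have "\<dots> = (\<integral>\<^sup>+x. ennreal \<bar>(indicator \<Omega> (x - d) - indicator \<Omega> x) * F x\<bar> \<partial>lborel)"
    by (rule nn_integral_eq_integral[symmetric]) (use dI in auto)
  also have "\<dots> \<le> (\<integral>\<^sup>+x. (\<Sum>(a, b)\<in>E. ennreal (indicator (P a b) x * \<bar>F x\<bar>)) \<partial>lborel)"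
  proof (rule nn_integral_mono)
    fix x :: "real^2"
    show "ennreal \<bar>(indicator \<Omega> (x - d) - indicator \<Omega> x) * F x\<bar> \<le> (\<Sum>(a, b)\<in>E. ennreal (indicator (P a b) x * \<bar>F x\<bar>))"
    proof (cases "(x \<in> \<Omega>) = (x - d \<in> \<Omega>)")
      case False
      then obtain a b s t where ab: "(a, b) \<in> E" "0 \<le> s" "s \<le> 1" "0 \<le> t" "t \<le> 1" "x = a + (s *\<^sub>R (b - a) + t *\<^sub>R d)"
        using symdiff_shift_swept[OF E(2)] by blast
      have "vector [s, t] \<in> cbox 0 (1::real^2)"
        using ab by (simp add: mem_box_cart forall_2)
      then have "x \<in> P a b" unfolding P_def
        using ab(6) by (intro image_eqI[of _ _ "vector [s, t]"]) auto
      then have "ennreal \<bar>(indicator \<Omega> (x - d) - indicator \<Omega> x) * F x\<bar> \<le> (\<lambda>(a, b). ennreal (indicator (P a b) x * \<bar>F x\<bar>)) (a, b)"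
        by (auto simp: indicator_def)
      also have "\<dots> \<le> (\<Sum>e\<in>E. (\<lambda>(a, b). ennreal (indicator (P a b) x * \<bar>F x\<bar>)) e)"
        using ab(1) E(1) by (intro member_le_sum) auto
      finally show ?thesis by simp
    qed (auto simp: indicator_def)
  qed
  also have "\<dots> = (\<Sum>(a, b)\<in>E. \<integral>\<^sup>+x. ennreal (indicator (P a b) x * \<bar>F x\<bar>) \<partial>lborel)"
    unfolding case_prod_unfold by (rule nn_integral_sum) measurable
  also have "\<dots> \<le> (\<Sum>(a, b)\<in>E. ennreal (norm d * (dist a b * (integral {0..1} (\<lambda>t. \<bar>F (linepath a b t)\<bar>) + L * norm d))))"
  proof (rule sum_mono, clarify)
    fix a b assume ab: "(a, b) \<in> E"
    have Lnn: "0 \<le> L" using L by (rule lipschitz_on_nonneg)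
    have lpc: "continuous_on S (linepath a b)" for S by (rule continuous_on_linepath)
    have "(\<integral>\<^sup>+x. ennreal (indicator (P a b) x * \<bar>F x\<bar>) \<partial>lborel) \<le>
       ennreal (norm (b - a) * norm d * integral {0..1} (\<lambda>t. \<bar>F (linepath a b t)\<bar> + L * norm d))"
      unfolding P_def
    proof (rule integral_parallelogram_le)
      show "continuous_on UNIV (\<lambda>x. \<bar>F x\<bar>)" using F by (intro continuous_intros)
      show "continuous_on UNIV (\<lambda>t. \<bar>F (linepath a b t)\<bar> + L * norm d)"
        by (intro continuous_intros continuous_on_compose2[OF F lpc]) auto
      fix x :: "real^2" assume "x \<in> cbox 0 1"
      then have x: "0 \<le> x $ 1" "x $ 1 \<le> 1" "0 \<le> x $ 2" "x $ 2 \<le> 1" by (auto simp: mem_box_cart forall_2)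
      \<comment> \<open>\<open>?y\<close> is the point of the edge from which \<open>?z\<close> is
        swept. They are at most \<open>norm d\<close> apart, and both lie in the ball where
        \<open>F\<close> is Lipschitz, for \<open>?y\<close> because balls are convex.\<close>
      let ?y = "linepath a b (x $ 1)" and ?z = "a + ((x $ 1) *\<^sub>R (b - a) + (x $ 2) *\<^sub>R d)"
      have z: "?z = ?y + (x $ 2) *\<^sub>R d" by (simp add: linepath_def algebra_simps)
      have "norm ?y \<le> (1 - x $ 1) * norm a + x $ 1 * norm b"
        using norm_triangle_ineq[of "(1 - x $ 1) *\<^sub>R a" "(x $ 1) *\<^sub>R b"] x by (simp add: linepath_def)
      also have "\<dots> \<le> (1 - x $ 1) * (R - norm d) + x $ 1 * (R - norm d)"
        using R[OF ab] x by (intro add_mono mult_left_mono) auto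
      finally have ny: "norm ?y \<le> R - norm d" by (simp add: algebra_simps)
      have "norm ((x $ 2) *\<^sub>R d) \<le> norm d" using x mult_right_mono[of "x $ 2" 1 "norm d"] by simp
      note nd = this
      have "norm ?z \<le> R" unfolding z using norm_triangle_ineq[of ?y "(x $ 2) *\<^sub>R d"] ny nd by linarith
      moreover have "norm ?y \<le> R" using ny norm_ge_zero[of d] by linarith
      ultimately have "dist (F ?z) (F ?y) \<le> L * dist ?z ?y" by (intro lipschitz_onD[OF L]) auto
      also have "dist ?z ?y = norm ((x $ 2) *\<^sub>R d)" unfolding z by (simp add: dist_norm)
      also have "L * \<dots> \<le> L * norm d" using nd Lnn by (intro mult_left_mono)
      finally show "\<bar>F ?z\<bar> \<le> \<bar>F ?y\<bar> + L * norm d" by (simp add: dist_real_def)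
    qed (use Lnn in auto)
    also have "integral {0..1} (\<lambda>t. \<bar>F (linepath a b t)\<bar> + L * norm d) = integral {0..1} (\<lambda>t. \<bar>F (linepath a b t)\<bar>) + L * norm d"
      by (subst integral_add)
         (auto intro!: integrable_continuous_real continuous_intros continuous_on_compose2[OF F lpc])
    finally show "(\<integral>\<^sup>+x. ennreal (indicator (P a b) x * \<bar>F x\<bar>) \<partial>lborel) \<le>
       ennreal (norm d * (dist a b * (integral {0..1} (\<lambda>t. \<bar>F (linepath a b t)\<bar>) + L * norm d)))"
      by (simp add: dist_norm norm_minus_commute mult_ac)
  qed
  also have "\<dots> = ennreal (\<Sum>(a, b)\<in>E. norm d * (dist a b * (integral {0..1} (\<lambda>t. \<bar>F (linepath a b t)\<bar>) + L * norm d)))"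
    unfolding case_prod_unfold
  proof (rule sum_ennreal)
    fix e :: "(real^2) \<times> (real^2)"
    have "0 \<le> integral {0..1} (\<lambda>t. \<bar>F (linepath (fst e) (snd e) t)\<bar>)"
      by (intro integral_nonneg integrable_continuous_real continuous_intros continuous_on_compose2[OF F continuous_on_linepath]) auto
    then show "0 \<le> norm d * (dist (fst e) (snd e) * (integral {0..1} (\<lambda>t. \<bar>F (linepath (fst e) (snd e) t)\<bar>) + L * norm d))"
      using lipschitz_on_nonneg[OF L] by auto
  qed
  finally have "ennreal \<bar>LINT x|lebesgue_on \<Omega>. F (x + d) - F x\<bar> \<le>
     ennreal (norm d * (\<Sum>(a, b)\<in>E. dist a b * (integral {0..1} (\<lambda>t. \<bar>F (linepath a b t)\<bar>) + L * norm d)))"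
    by (simp add: sum_distrib_left case_prod_unfold)
  then show ?thesis
  proof (rule ennreal_le_iff[THEN iffD1, rotated])
    have "0 \<le> integral {0..1} (\<lambda>t. \<bar>F (linepath a b t)\<bar>)" for a b
      by (intro integral_nonneg integrable_continuous_real continuous_intros continuous_on_compose2[OF F continuous_on_linepath]) auto
    then show "0 \<le> norm d * (\<Sum>(a, b)\<in>E. dist a b * (integral {0..1} (\<lambda>t. \<bar>F (linepath a b t)\<bar>) + L * norm d))"
      using lipschitz_on_nonneg[OF L] by (auto intro!: mult_nonneg_nonneg sum_nonneg)
  qed
qed

text \<open>Green's formula in the form of an inequality: the normal does not appear, and no orientation of
  the edges is needed.\<close>

lemma green_estimate:
  fixes \<Omega> :: "(real^2) set" and F :: "real^2 \<Rightarrow> real"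
  assumes bd: "bounded_domain \<Omega>" and E: "finite E" "frontier \<Omega> \<subseteq> (\<Union>(a, b)\<in>E. closed_segment a b)"
    and F: "continuous_on UNIV F" and L: "\<And>R. \<exists>L. L-lipschitz_on (cball 0 R) F"
    and G: "\<And>x. x \<in> \<Omega> \<Longrightarrow> (\<lambda>n. dquot F e n x) \<longlonglongrightarrow> G x"
  shows "\<bar>LINT x|lebesgue_on \<Omega>. G x\<bar> \<le> norm e * (LINT x|boundary_measure E. \<bar>F x\<bar>)"
proof -
  interpret bounded_domain \<Omega> by (rule bd)
  obtain R0 where R0: "\<And>x. x \<in> \<Omega> \<Longrightarrow> norm x \<le> R0" using domain_radius by blast
  \<comment> \<open>Large enough for the domain and for all end points, with \<open>norm e\<close>
    to spare for the shift. The sum stands in for a maximum over the edges and covers an empty set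
    of edges.\<close>
  define R where "R = max R0 (\<Sum>(a, b)\<in>E. norm a + norm b) + norm e"
  have RE: "norm a + norm e \<le> R \<and> norm b + norm e \<le> R" if "(a, b) \<in> E" for a b
  proof -
    have "(\<lambda>(a, b). norm a + norm b) (a, b) \<le> (\<Sum>e\<in>E. (\<lambda>(a, b). norm a + norm b) e)"
      using that E(1) by (intro member_le_sum) auto
    then have "norm a + norm b \<le> (\<Sum>(a, b)\<in>E. norm a + norm b)" by simp
    also have "\<dots> \<le> R - norm e" by (simp add: R_def)
    finally show ?thesis using norm_ge_zero[of a] norm_ge_zero[of b] by linarith
  qed
  obtain L where L: "L-lipschitz_on (cball 0 R) F" using assms(5) by blast
  define h where "h n = inverse (real (Suc n))" for n
  have h: "0 < h n" "h n \<le> 1" for n by (auto simp: h_def inverse_eq_divide)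
  have h0: "h \<longlonglongrightarrow> 0" unfolding h_def by (rule LIMSEQ_inverse_real_of_nat)
  define I where "I a b = integral {0..1} (\<lambda>t. \<bar>F (linepath a b t)\<bar>)" for a b
  have lim1: "(\<lambda>n. \<bar>LINT x|lebesgue_on \<Omega>. dquot F e n x\<bar>) \<longlonglongrightarrow> \<bar>LINT x|lebesgue_on \<Omega>. G x\<bar>"
    by (intro tendsto_rabs difference_quotient_integral[OF domain_lmeasurable _ L G])
       (use R0 in \<open>force simp: R_def max_def\<close>)
  \<comment> \<open>The Lipschitz error has one more factor \<open>h n\<close> than the one divided
    out, so it disappears in the limit.\<close>
  have lim2: "(\<lambda>n. norm e * (\<Sum>(a, b)\<in>E. dist a b * (I a b + L * (h n * norm e)))) \<longlonglongrightarrow>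
      norm e * (\<Sum>(a, b)\<in>E. dist a b * (I a b + L * (0 * norm e)))"
    unfolding case_prod_unfold by (intro tendsto_intros h0)
  have "\<bar>LINT x|lebesgue_on \<Omega>. dquot F e n x\<bar> \<le> norm e * (\<Sum>(a, b)\<in>E. dist a b * (I a b + L * (h n * norm e)))" for n
  proof -
    have hn: "norm (h n *\<^sub>R e) = h n * norm e" "h n * norm e \<le> norm e"
      using h[of n] mult_right_mono[of "h n" 1 "norm e"] by auto
    have "\<bar>LINT x|lebesgue_on \<Omega>. F (x + h n *\<^sub>R e) - F x\<bar> \<le>
      norm (h n *\<^sub>R e) * (\<Sum>(a, b)\<in>E. dist a b * (I a b + L * norm (h n *\<^sub>R e)))"
      unfolding I_def
    proof (rule green_shift_estimate[OF bd E F L])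
      fix a b assume "(a, b) \<in> E"
      from RE[OF this] show "norm a + norm (h n *\<^sub>R e) \<le> R \<and> norm b + norm (h n *\<^sub>R e) \<le> R"
        using hn by linarith
    qed
    also have "\<dots> = h n * (norm e * (\<Sum>(a, b)\<in>E. dist a b * (I a b + L * (h n * norm e))))"
      unfolding hn(1) by simp
    finally have "\<bar>LINT x|lebesgue_on \<Omega>. F (x + h n *\<^sub>R e) - F x\<bar> / h n \<le> norm e * (\<Sum>(a, b)\<in>E. dist a b * (I a b + L * (h n * norm e)))"
      using h(1)[of n] by (simp add: pos_divide_le_eq mult.commute)
    moreover have "(LINT x|lebesgue_on \<Omega>. dquot F e n x) = (LINT x|lebesgue_on \<Omega>. F (x + h n *\<^sub>R e) - F x) / h n"
      unfolding dquot_def h_def by (rule integral_divide_zero)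
    ultimately show ?thesis using h(1)[of n] by (simp add: abs_divide)
  qed
  then have "\<bar>LINT x|lebesgue_on \<Omega>. G x\<bar> \<le> norm e * (\<Sum>(a, b)\<in>E. dist a b * (I a b + L * (0 * norm e)))"
    by (intro LIMSEQ_le[OF lim1 lim2]) auto
  also have "\<dots> = norm e * (LINT x|boundary_measure E. \<bar>F x\<bar>)"
    using boundary_integral_continuous(2)[of "\<lambda>x. \<bar>F x\<bar>" E] F by (simp add: I_def continuous_on_rabs)
  finally show ?thesis .
qed

section \<open>Integration by parts for functions with zero trace\<close>

text \<open>The regularity asked of a mollified function: it dominates the difference quotients and
  is easily read off the kernel, whereas full smoothness would require differentiating under the
  integral repeatedly.\<close>

definition locally_lipschitz :: "('a::euclidean_space \<Rightarrow> real) \<Rightarrow> bool" where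
  "locally_lipschitz F \<longleftrightarrow> (\<forall>R. \<exists>L. L-lipschitz_on (cball 0 R) F)"

lemma smooth_locally_lipschitz: "smooth \<phi> \<Longrightarrow> locally_lipschitz \<phi>"
  unfolding locally_lipschitz_def by (blast intro: smooth_lipschitz_on_cball)

lemma locally_lipschitz_continuous:
  assumes "locally_lipschitz F"
  shows "continuous_on UNIV F"
proof (rule continuous_at_imp_continuous_on, rule ballI)
  fix x :: 'a
  obtain L where "L-lipschitz_on (cball 0 (norm x + 1)) F" using assms unfolding locally_lipschitz_def by blast
  then have "continuous_on (cball 0 (norm x + 1)) F" by (rule lipschitz_on_continuous_on)
  then show "isCont F x" by (rule continuous_on_interior) simp
qed

lemma locally_lipschitz_mult:
  assumes "locally_lipschitz F" "locally_lipschitz G"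
  shows "locally_lipschitz (\<lambda>x. F x * G x)"
  unfolding locally_lipschitz_def
proof
  fix R :: real
  obtain L M where L: "L-lipschitz_on (cball 0 R) F" and M: "M-lipschitz_on (cball 0 R) G"
    using assms unfolding locally_lipschitz_def by blast
  have bd: "\<exists>B\<ge>0. \<forall>x\<in>cball 0 R. \<bar>H x\<bar> \<le> B" if "continuous_on UNIV H" for H :: "'a \<Rightarrow> real"
  proof -
    have "bounded (H ` cball 0 R)"
      using continuous_on_subset[OF that, of "cball 0 R"]
      by (intro compact_imp_bounded compact_continuous_image) auto
    then obtain B where "\<forall>x\<in>cball 0 R. \<bar>H x\<bar> \<le> B" by (auto simp: bounded_iff)
    then show ?thesis by (intro exI[of _ "max B 0"]) auto
  qed
  obtain A B where A: "A \<ge> 0" "\<And>x. x \<in> cball 0 R \<Longrightarrow> \<bar>F x\<bar> \<le> A" and B: "B \<ge> 0" "\<And>x. x \<in> cball 0 R \<Longrightarrow> \<bar>G x\<bar> \<le> B"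
    using bd[OF locally_lipschitz_continuous[OF assms(1)]] bd[OF locally_lipschitz_continuous[OF assms(2)]] by blast
  note nn = lipschitz_on_nonneg[OF L] lipschitz_on_nonneg[OF M]
  have "(A * M + B * L)-lipschitz_on (cball 0 R) (\<lambda>x. F x * G x)"
  proof (rule lipschitz_onI)
    fix x y :: 'a assume xy: "x \<in> cball 0 R" "y \<in> cball 0 R"
    have "F x * G x - F y * G y = F x * (G x - G y) + G y * (F x - F y)" by (simp add: algebra_simps)
    then have "\<bar>F x * G x - F y * G y\<bar> \<le> \<bar>F x\<bar> * \<bar>G x - G y\<bar> + \<bar>G y\<bar> * \<bar>F x - F y\<bar>"
      by (metis abs_mult abs_triangle_ineq)
    also have "\<dots> \<le> A * (M * dist x y) + B * (L * dist x y)"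
      using A(2)[OF xy(1)] B(2)[OF xy(2)] lipschitz_onD[OF L xy] lipschitz_onD[OF M xy] A(1) B(1)
      by (intro add_mono mult_mono) (auto simp: dist_real_def)
    finally show "dist (F x * G x) (F y * G y) \<le> (A * M + B * L) * dist x y"
      by (simp add: dist_real_def algebra_simps)
  qed (use nn A B in auto)
  then show "\<exists>L. L-lipschitz_on (cball 0 R) (\<lambda>x. F x * G x)" by blast
qed

text \<open>The product rule along the sequence of steps. One factor is evaluated at the shifted
  point, which is why its continuity is assumed.\<close>

lemma dquot_mult_tendsto:
  assumes "continuous_on UNIV F" "(\<lambda>n. dquot F e n x) \<longlonglongrightarrow> F'" "(\<lambda>n. dquot G e n x) \<longlonglongrightarrow> G'"
  shows "(\<lambda>n. dquot (\<lambda>x. F x * G x) e n x) \<longlonglongrightarrow> F' * G x + F x * G'"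
proof -
  have "(\<lambda>n. x + inverse (real (Suc n)) *\<^sub>R e) \<longlonglongrightarrow> x + 0 *\<^sub>R e"
    by (intro tendsto_intros LIMSEQ_inverse_real_of_nat)
  moreover have "isCont F x" using assms(1) by (simp add: continuous_on_eq_continuous_at)
  ultimately have "(\<lambda>n. F (x + inverse (real (Suc n)) *\<^sub>R e)) \<longlonglongrightarrow> F x"
    by (intro isCont_tendsto_compose[of x F]) auto
  then have "(\<lambda>n. dquot F e n x * G x + F (x + inverse (real (Suc n)) *\<^sub>R e) * dquot G e n x) \<longlonglongrightarrow> F' * G x + F x * G'"
    by (intro tendsto_intros assms)
  moreover have "dquot (\<lambda>x. F x * G x) e n x = dquot F e n x * G x + F (x + inverse (real (Suc n)) *\<^sub>R e) * dquot G e n x" for n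
    by (simp add: dquot_def field_simps)
  ultimately show ?thesis by simp
qed

lemma pderiv_minus: "smooth \<phi> \<Longrightarrow> pderiv_at \<phi> (- e) x = - pderiv_at \<phi> e x"
  using linear_neg[OF has_derivative_linear[OF smooth_has_derivative]] .

text \<open>The offset \<open>c\<close> moves the sampled ball from \<open>x\<close> to
  \<open>x + c\<close>, which is how kernels are pushed into the domain. The integral extends over
  the domain only, so the function is defined on the whole plane although \<open>q\<close> matters
  only inside.\<close>

definition mollified :: "'a::euclidean_space set \<Rightarrow> ('a \<Rightarrow> real) \<Rightarrow> 'a \<Rightarrow> real \<Rightarrow> 'a \<Rightarrow> real" where
  "mollified \<Omega> q c r x = (LINT y|lebesgue_on \<Omega>. q y * bump (x + c) r y)"

context bounded_domain
begin

text \<open>The variable enters through the kernel alone, so the constant is that of the kernel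
  times the L1 norm of \<open>q\<close>.\<close>

lemma mollified_lipschitz:
  assumes q: "q \<in> L2 (lebesgue_on \<Omega>)"
  shows "locally_lipschitz (mollified \<Omega> q c r)"
  unfolding locally_lipschitz_def
proof
  fix R :: real
  obtain R0 where R0: "\<And>x. x \<in> \<Omega> \<Longrightarrow> norm x \<le> R0" using domain_radius by blast
  obtain L where L: "L-lipschitz_on (cball 0 (R0 + R + norm c)) (bump 0 r :: 'a \<Rightarrow> real)"
    using smooth_lipschitz_on_cball[OF smooth_bump] by blast
  have i: "integrable (lebesgue_on \<Omega>) (\<lambda>y. q y * bump (x + c) r y)" for x
    using L2_mult_integrable[OF q continuous_L2[OF smooth_continuous[OF smooth_bump]]] .
  have qi: "integrable (lebesgue_on \<Omega>) (\<lambda>y. \<bar>q y\<bar>)" using domain.L2_integrable[OF q] by simp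
  have b: "bump (x + c) r y = bump 0 r (y - x - c)" for x y by (simp add: bump_def algebra_simps)
  have "((LINT y|lebesgue_on \<Omega>. \<bar>q y\<bar>) * L)-lipschitz_on (cball 0 R) (mollified \<Omega> q c r)"
  proof (rule lipschitz_onI)
    fix x x' :: 'a assume x: "x \<in> cball 0 R" "x' \<in> cball 0 R"
    have "\<bar>mollified \<Omega> q c r x - mollified \<Omega> q c r x'\<bar> =
       \<bar>LINT y|lebesgue_on \<Omega>. q y * bump (x + c) r y - q y * bump (x' + c) r y\<bar>"
      using i by (simp add: mollified_def)
    also have "\<dots> \<le> (LINT y|lebesgue_on \<Omega>. \<bar>q y * bump (x + c) r y - q y * bump (x' + c) r y\<bar>)"
      by (rule integral_abs_bound)
    also have "\<dots> \<le> (LINT y|lebesgue_on \<Omega>. \<bar>q y\<bar> * (L * dist x x'))"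
    proof (rule integral_mono)
      fix y assume "y \<in> space (lebesgue_on \<Omega>)"
      then have y: "norm y \<le> R0" using R0 by simp
      have "y - z - c \<in> cball 0 (R0 + R + norm c)" if "z \<in> cball 0 R" for z
        using norm_triangle_ineq4[of "y - z" c] norm_triangle_ineq4[of y z] y that unfolding mem_cball_0 by linarith
      from lipschitz_onD[OF L this[OF x(1)] this[OF x(2)]]
      have "\<bar>bump (x + c) r y - bump (x' + c) r y\<bar> \<le> L * dist x x'"
        unfolding b by (simp add: dist_real_def dist_norm norm_minus_commute)
      then show "\<bar>q y * bump (x + c) r y - q y * bump (x' + c) r y\<bar> \<le> \<bar>q y\<bar> * (L * dist x x')"
        by (simp add: right_diff_distrib[symmetric] abs_mult mult_left_mono)
    qed (use i qi in auto)
    also have "\<dots> = (LINT y|lebesgue_on \<Omega>. \<bar>q y\<bar>) * L * dist x x'" by simp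
    finally show "dist (mollified \<Omega> q c r x) (mollified \<Omega> q c r x') \<le> (LINT y|lebesgue_on \<Omega>. \<bar>q y\<bar>) * L * dist x x'"
      by (simp add: dist_real_def)
  qed (auto intro!: mult_nonneg_nonneg integral_nonneg_AE lipschitz_on_nonneg[OF L])
  then show "\<exists>L. L-lipschitz_on (cball 0 R) (mollified \<Omega> q c r)" by blast
qed

text \<open>Moving \<open>x\<close> by a step along \<open>e\<close> affects the kernel like moving
  \<open>y\<close> by the opposite step, whence the sign. Holds at every point; that the limit is
  the mollified weak derivative needs the position of the kernel, as in
  \<open>mollified_derivative\<close>.\<close>

lemma mollified_dquot_tendsto:
  assumes q: "q \<in> L2 (lebesgue_on \<Omega>)" and e: "e \<in> Basis"
  shows "(\<lambda>n. dquot (mollified \<Omega> q c r) e n x) \<longlonglongrightarrow> - (LINT y|lebesgue_on \<Omega>. q y * pderiv_at (bump (x + c) r) e y)"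
proof -
  obtain R0 where R0: "\<And>x. x \<in> \<Omega> \<Longrightarrow> norm x \<le> R0" using domain_radius by blast
  obtain L where L: "L-lipschitz_on (cball 0 (R0 + norm e)) (bump (x + c) r)"
    using smooth_lipschitz_on_cball[OF smooth_bump] by blast
  have i: "integrable (lebesgue_on \<Omega>) (\<lambda>y. q y * bump z r y)" for z
    using L2_mult_integrable[OF q continuous_L2[OF smooth_continuous[OF smooth_bump]]] .
  have b: "bump (x + h *\<^sub>R e + c) r y = bump (x + c) r (y + h *\<^sub>R (- e))" for h y by (simp add: bump_def algebra_simps)
  have qm: "q \<in> borel_measurable (lebesgue_on \<Omega>)" using q by (rule L2D)
  have cd: "continuous_on UNIV (dquot (bump (x + c) r) (- e) n)" for n
    unfolding dquot_def
    by (intro continuous_intros continuous_on_compose2[OF smooth_continuous[OF smooth_bump, of UNIV]] smooth_continuous[OF smooth_bump]) auto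
  have "dquot (mollified \<Omega> q c r) e n x = (LINT y|lebesgue_on \<Omega>. q y * dquot (bump (x + c) r) (- e) n y)" for n
  proof -
    have "dquot (mollified \<Omega> q c r) e n x =
      (LINT y|lebesgue_on \<Omega>. (q y * bump (x + inverse (real (Suc n)) *\<^sub>R e + c) r y - q y * bump (x + c) r y) / inverse (real (Suc n)))"
      using i by (simp add: dquot_def mollified_def del: of_nat_Suc inverse_inverse_eq)
    then show ?thesis unfolding b dquot_def by (simp add: right_diff_distrib del: of_nat_Suc scaleR_minus_right)
  qed
  moreover have "(\<lambda>n. LINT y|lebesgue_on \<Omega>. q y * dquot (bump (x + c) r) (- e) n y) \<longlonglongrightarrow>
      (LINT y|lebesgue_on \<Omega>. q y * pderiv_at (bump (x + c) r) (- e) y)"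
  proof (rule integral_dominated_convergence[where w = "\<lambda>y. \<bar>q y\<bar> * (L * norm e)"])
    show "AE y in lebesgue_on \<Omega>. (\<lambda>n. q y * dquot (bump (x + c) r) (- e) n y) \<longlonglongrightarrow> q y * pderiv_at (bump (x + c) r) (- e) y"
      by (intro AE_I2 tendsto_intros smooth_dquot_tendsto smooth_bump)
    show "AE y in lebesgue_on \<Omega>. norm (q y * dquot (bump (x + c) r) (- e) n y) \<le> \<bar>q y\<bar> * (L * norm e)" for n
    proof (rule AE_I2)
      fix y assume "y \<in> space (lebesgue_on \<Omega>)"
      then have "norm y + norm (- e) \<le> R0 + norm e" using R0 by simp
      from dquot_bound[OF L this, of n]
      show "norm (q y * dquot (bump (x + c) r) (- e) n y) \<le> \<bar>q y\<bar> * (L * norm e)"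
        by (simp add: abs_mult mult_left_mono)
    qed
    show "integrable (lebesgue_on \<Omega>) (\<lambda>y. \<bar>q y\<bar> * (L * norm e))" using domain.L2_integrable[OF q] by simp
    show "(\<lambda>y. q y * dquot (bump (x + c) r) (- e) n y) \<in> borel_measurable (lebesgue_on \<Omega>)" for n
      using qm continuous_measurable_lebesgue_on[OF cd] by measurable
    have "(\<lambda>y. - pderiv_at (bump (x + c) r) e y) \<in> borel_measurable (lebesgue_on \<Omega>)"
      by (intro continuous_measurable_lebesgue_on continuous_intros smooth_continuous smooth_pderiv smooth_bump e)
    then show "(\<lambda>y. q y * pderiv_at (bump (x + c) r) (- e) y) \<in> borel_measurable (lebesgue_on \<Omega>)"
      unfolding pderiv_minus[OF smooth_bump] using qm by (intro borel_measurable_times)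
  qed
  ultimately show ?thesis by (simp add: pderiv_minus[OF smooth_bump])
qed

text \<open>If the ball lies in the domain, the kernel is a test function and the definition of the
  weak derivative applies. If it misses \<open>K\<close>, both integrands vanish, although the ball
  may stick out of the domain.\<close>

lemma mollified_derivative:
  assumes q: "has_weak_partial \<Omega> i q q'" and i: "i \<in> Basis" and r: "r > 0"
    and zero: "\<And>y. y \<in> \<Omega> \<Longrightarrow> y \<notin> K \<Longrightarrow> q y = 0 \<and> q' y = 0"
    and cases: "cball (x + c) r \<subseteq> \<Omega> \<or> cball (x + c) r \<inter> K = {}"
  shows "(\<lambda>n. dquot (mollified \<Omega> q c r) i n x) \<longlonglongrightarrow> mollified \<Omega> q' c r x"
proof -
  have L: "q \<in> L2 (lebesgue_on \<Omega>)" "q' \<in> L2 (lebesgue_on \<Omega>)" using q by (auto simp: has_weak_partial_def)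
  have supp: "{y. bump (x + c) r y \<noteq> 0} = ball (x + c) r" by (auto simp: bump_eq_0_iff[OF r])
  have "- (LINT y|lebesgue_on \<Omega>. q y * pderiv_at (bump (x + c) r) i y) = mollified \<Omega> q' c r x"
    using cases
  proof
    assume "cball (x + c) r \<subseteq> \<Omega>"
    from test_function_bump[OF r this] q show ?thesis
      by (simp add: has_weak_partial_def mollified_def)
  next
    assume disj: "cball (x + c) r \<inter> K = {}"
    have "q y * pderiv_at (bump (x + c) r) i y = 0 \<and> q' y * bump (x + c) r y = 0" if "y \<in> \<Omega>" for y
    proof (cases "y \<in> cball (x + c) r")
      case True
      then have "y \<notin> K" using disj by blast
      then show ?thesis using zero[OF that] by simp
    next
      case False
      then have "pderiv_at (bump (x + c) r) i y = 0"
        using r by (intro pderiv_eq_0_outside_support smooth_bump) (simp add: supp)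
      moreover have "bump (x + c) r y = 0" using False by (simp add: bump_eq_0_iff[OF r])
      ultimately show ?thesis by simp
    qed
    then have "(LINT y|lebesgue_on \<Omega>. q y * pderiv_at (bump (x + c) r) i y) = (LINT y|lebesgue_on \<Omega>. 0)"
      "mollified \<Omega> q' c r x = (LINT y|lebesgue_on \<Omega>. 0)"
      unfolding mollified_def by (intro Bochner_Integration.integral_cong; simp)+
    then show ?thesis by simp
  qed
  with mollified_dquot_tendsto[OF L(1) i, of c r x] show ?thesis by simp
qed

end

section \<open>Integration by parts on a polygonal domain\<close>

locale polygon =
  fixes \<Omega> :: "(real^2) set" and E :: "((real^2) \<times> (real^2)) set"
  assumes polygonal: "polygonal_domain \<Omega> E"
begin

sublocale bounded_domain \<Omega>
  using polygonal by unfold_locales (auto simp: polygonal_domain_def)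

lemma bounded_domain: "bounded_domain \<Omega>"
  by unfold_locales

lemma finite_edges: "finite E"
  and frontier_edges: "frontier \<Omega> \<subseteq> (\<Union>(a, b)\<in>E. closed_segment a b)"
  using polygonal by (auto simp: polygonal_domain_def)

text \<open>The domain integrals converge because the approximants of \<open>d\<close> and their
  derivatives converge in L2. By Green's estimate and Cauchy-Schwarz they are bounded by a product
  of two boundary norms, one tending to zero. The derivative of \<open>P\<close> is required at
  points of the domain only, where \<open>mollified_derivative\<close> provides it.\<close>

lemma zero_trace_parts_lipschitz:
  assumes d: "has_trace \<Omega> E d (\<lambda>x. 0)" and P: "locally_lipschitz P" and P': "continuous_on UNIV P'"
    and lim: "\<And>x. x \<in> \<Omega> \<Longrightarrow> (\<lambda>n. dquot P i n x) \<longlonglongrightarrow> P' x" and i: "i \<in> Basis"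
  shows "(LINT x|lebesgue_on \<Omega>. weak_partial \<Omega> i d x * P x) + (LINT x|lebesgue_on \<Omega>. d x * P' x) = 0"
proof -
  obtain \<phi> where \<phi>: "\<And>k. smooth (\<phi> k)" "(\<lambda>k. H1_norm \<Omega> (\<lambda>x. \<phi> k x - d x)) \<longlonglongrightarrow> 0"
    "(\<lambda>k. L2_norm (boundary_measure E) (\<phi> k)) \<longlonglongrightarrow> 0" and dH: "d \<in> H1 \<Omega>"
    using d unfolding has_trace_def by auto
  note c\<phi> = smooth_continuous[OF \<phi>(1), of UNIV] smooth_continuous[OF smooth_pderiv[OF \<phi>(1) i], of UNIV]
  note cP = locally_lipschitz_continuous[OF P]
  note PL = continuous_L2[OF cP] continuous_L2[OF P'] and \<phi>L = continuous_L2[OF c\<phi>(1)] continuous_L2[OF c\<phi>(2)]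
  have dk: "(\<lambda>x. \<phi> k x - d x) \<in> H1 \<Omega>" for k
    using H1_lincomb[OF H1_smooth[OF \<phi>(1)] dH, of 1 k "- 1"] by simp
  have lim1: "(\<lambda>k. L2_norm (lebesgue_on \<Omega>) (\<lambda>x. \<phi> k x - d x)) \<longlonglongrightarrow> 0"
    by (rule Lim_null_comparison[OF _ \<phi>(2)], intro always_eventually allI)
       (use L2_norm_le_H1_norm(1)[OF dk] in \<open>simp add: L2_norm_nonneg\<close>)
  have lim2: "(\<lambda>k. L2_norm (lebesgue_on \<Omega>) (\<lambda>x. pderiv_at (\<phi> k) i x - weak_partial \<Omega> i d x)) \<longlonglongrightarrow> 0"
  proof (rule Lim_null_comparison[OF _ \<phi>(2)], intro always_eventually allI)
    fix k
    have "has_weak_partial \<Omega> i (\<lambda>x. \<phi> k x - d x) (\<lambda>x. pderiv_at (\<phi> k) i x - weak_partial \<Omega> i d x)"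
      using has_weak_partial_lincomb[OF has_weak_partial_smooth[OF \<phi>(1) i] H1_weak_partial[OF dH i] i, of 1 k "- 1"] by simp
    \<comment> \<open>The explicit derivative agrees only almost everywhere with the representative
      inside \<open>H1_norm\<close>; the norms are equal all the same.\<close>
    from weak_partial_AE[OF this]
    have "L2_norm (lebesgue_on \<Omega>) (\<lambda>x. pderiv_at (\<phi> k) i x - weak_partial \<Omega> i d x) = L2_norm (lebesgue_on \<Omega>) (weak_partial \<Omega> i (\<lambda>x. \<phi> k x - d x))"
      unfolding L2_norm_def
      by (intro arg_cong[where f = sqrt] integral_cong_AE)
         (use L2D(1)[OF L2_diff[OF \<phi>L(2) H1_L2(2)[OF dH i]]] L2D(1)[OF H1_L2(2)[OF dk i]] in auto)
    then show "norm (L2_norm (lebesgue_on \<Omega>) (\<lambda>x. pderiv_at (\<phi> k) i x - weak_partial \<Omega> i d x)) \<le> H1_norm \<Omega> (\<lambda>x. \<phi> k x - d x)"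
      using L2_norm_le_H1_norm(2)[OF dk i] by (simp add: L2_norm_nonneg)
  qed
  have "(\<lambda>k. (LINT x|lebesgue_on \<Omega>. pderiv_at (\<phi> k) i x * P x) + (LINT x|lebesgue_on \<Omega>. \<phi> k x * P' x)) \<longlonglongrightarrow>
    (LINT x|lebesgue_on \<Omega>. weak_partial \<Omega> i d x * P x) + (LINT x|lebesgue_on \<Omega>. d x * P' x)"
    by (intro tendsto_add L2_integral_mult_tendsto lim1 lim2 \<phi>L PL H1_L2 dH i)
  moreover have "(\<lambda>k. (LINT x|lebesgue_on \<Omega>. pderiv_at (\<phi> k) i x * P x) + (LINT x|lebesgue_on \<Omega>. \<phi> k x * P' x)) \<longlonglongrightarrow> 0"
  proof (rule Lim_null_comparison)
    show "\<forall>\<^sub>F k in sequentially. norm ((LINT x|lebesgue_on \<Omega>. pderiv_at (\<phi> k) i x * P x) + (LINT x|lebesgue_on \<Omega>. \<phi> k x * P' x))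
      \<le> L2_norm (boundary_measure E) (\<phi> k) * L2_norm (boundary_measure E) P"
    proof (intro always_eventually allI)
      fix k
      have "locally_lipschitz (\<lambda>x. \<phi> k x * P x)"
        by (intro locally_lipschitz_mult smooth_locally_lipschitz \<phi> P)
      then have "\<bar>LINT x|lebesgue_on \<Omega>. pderiv_at (\<phi> k) i x * P x + \<phi> k x * P' x\<bar> \<le> norm i * (LINT x|boundary_measure E. \<bar>\<phi> k x * P x\<bar>)"
        by (intro green_estimate[OF bounded_domain finite_edges frontier_edges] locally_lipschitz_continuous
            dquot_mult_tendsto c\<phi> smooth_dquot_tendsto \<phi> lim) (auto simp: locally_lipschitz_def)
      also have "\<dots> = (LINT x|boundary_measure E. \<bar>\<phi> k x * P x\<bar>)" using i by simp
      also have "\<dots> \<le> L2_norm (boundary_measure E) (\<phi> k) * L2_norm (boundary_measure E) P"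
        by (intro L2_cauchy_schwarz continuous_L2_boundary c\<phi> cP)
      finally show "norm ((LINT x|lebesgue_on \<Omega>. pderiv_at (\<phi> k) i x * P x) + (LINT x|lebesgue_on \<Omega>. \<phi> k x * P' x))
        \<le> L2_norm (boundary_measure E) (\<phi> k) * L2_norm (boundary_measure E) P"
        using L2_mult_integrable[OF \<phi>L(2) PL(1)] L2_mult_integrable[OF \<phi>L(1) PL(2)] by simp
    qed
    show "(\<lambda>k. L2_norm (boundary_measure E) (\<phi> k) * L2_norm (boundary_measure E) P) \<longlonglongrightarrow> 0"
      using tendsto_mult_left_zero[OF \<phi>(3)] .
  qed
  ultimately show ?thesis by (rule LIMSEQ_unique)
qed

text \<open>Kernels that, for the part of the domain near \<open>x0\<close>, sit inside the domain: near the boundary they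
  are shifted into the domain along the axis of the Lipschitz epigraph.\<close>

definition inward :: "real^2 \<Rightarrow> real \<Rightarrow> bool" where
  "inward x0 \<epsilon> \<longleftrightarrow> \<epsilon> > 0 \<and> (\<forall>\<eta>>0. \<exists>c r. r > 0 \<and> norm c + r \<le> \<eta> \<and>
    (\<forall>x\<in>\<Omega>. cball (x + c) r \<subseteq> \<Omega> \<or> cball (x + c) r \<inter> cball x0 \<epsilon> = {}))"

lemma inward_interior:
  assumes "x0 \<in> \<Omega>"
  obtains \<epsilon> where "inward x0 \<epsilon>"
proof -
  obtain e where e: "e > 0" "ball x0 e \<subseteq> \<Omega>" using domain_open assms openE by blast
  have "\<exists>c r. r > 0 \<and> norm c + r \<le> \<eta> \<and> (\<forall>x\<in>\<Omega>. cball (x + c) r \<subseteq> \<Omega> \<or> cball (x + c) r \<inter> cball x0 (e / 4) = {})"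
    if "\<eta> > 0" for \<eta>
  proof (rule exI[of _ 0], rule exI[of _ "min \<eta> (e / 4)"], intro conjI ballI)
    fix x
    show "cball (x + 0) (min \<eta> (e / 4)) \<subseteq> \<Omega> \<or> cball (x + 0) (min \<eta> (e / 4)) \<inter> cball x0 (e / 4) = {}"
    proof (rule disjCI)
      assume "cball (x + 0) (min \<eta> (e / 4)) \<inter> cball x0 (e / 4) \<noteq> {}"
      then obtain y where y: "dist x y \<le> e / 4" "dist x0 y \<le> e / 4" by auto
      have "cball x (e / 4) \<subseteq> ball x0 e"
      proof
        fix z assume "z \<in> cball x (e / 4)"
        then have "dist x z \<le> e / 4" by simp
        then have "dist x0 z \<le> e / 4 + e / 4 + e / 4"
          using y dist_triangle[of x0 z y] dist_triangle[of y z x] by (simp add: dist_commute)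
        then show "z \<in> ball x0 e" using e(1) by simp
      qed
      then show "cball (x + 0) (min \<eta> (e / 4)) \<subseteq> \<Omega>" using e(2) by auto
    qed
  qed (use that e in auto)
  then have "inward x0 (e / 4)" using e by (simp add: inward_def)
  then show thesis by (rule that)
qed

text \<open>Shifting by \<open>s\<close> along \<open>n\<close> raises a point by \<open>s\<close>
  above the graph. A further displacement by at most \<open>r\<close> lowers it by at most
  \<open>r\<close> and raises the graph by at most L * r; with r + L * r = s the strict inequality
  valid at \<open>x\<close> persists.\<close>

lemma inward_frontier:
  assumes "x0 \<in> frontier \<Omega>"
  obtains \<epsilon> where "inward x0 \<epsilon>"
proof -
  have "lipschitz_boundary \<Omega>" using polygonal by (simp add: polygonal_domain_def)
  then obtain t n \<gamma> L e where tn: "norm t = 1" "norm n = 1" "t \<bullet> n = 0"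
    and L: "L-lipschitz_on UNIV (\<gamma> :: real \<Rightarrow> real)" and e: "e > 0"
    and epi: "\<And>y. y \<in> ball x0 e \<Longrightarrow> y \<in> \<Omega> \<longleftrightarrow> \<gamma> ((y - x0) \<bullet> t) < (y - x0) \<bullet> n"
    using assms unfolding lipschitz_boundary_def by metis
  have L0: "0 \<le> L" using L by (rule lipschitz_on_nonneg)
  have "\<exists>c r. r > 0 \<and> norm c + r \<le> \<eta> \<and> (\<forall>x\<in>\<Omega>. cball (x + c) r \<subseteq> \<Omega> \<or> cball (x + c) r \<inter> cball x0 (e / 4) = {})"
    if "\<eta> > 0" for \<eta>
  proof -
    \<comment> \<open>As r is at most s, the first bound gives norm c + r at most \<eta>. The second
      keeps \<open>x\<close> and the shifted ball within e/2 of \<open>x0\<close> when the ball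
      meets the small ball, so the graph description applies to both.\<close>
    define s where "s = min (\<eta> / 2) (e / 8)"
    define r where "r = s / (1 + L)"
    have s: "s > 0" "s \<le> \<eta> / 2" "s \<le> e / 8" using that e by (auto simp: s_def)
    have r: "r > 0" "r * (1 + L) = s" using s L0 by (auto simp: r_def)
    then have rL: "r + L * r = s" by (simp add: algebra_simps)
    then have rs: "r \<le> s" using mult_nonneg_nonneg[OF L0, of r] r(1) by simp
    show ?thesis
    proof (intro exI[of _ "s *\<^sub>R n"] exI[of _ r] conjI ballI)
      show "norm (s *\<^sub>R n) + r \<le> \<eta>" using s rs tn by simp
      fix x assume x: "x \<in> \<Omega>"
      show "cball (x + s *\<^sub>R n) r \<subseteq> \<Omega> \<or> cball (x + s *\<^sub>R n) r \<inter> cball x0 (e / 4) = {}"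
      proof (rule disjCI)
        assume "cball (x + s *\<^sub>R n) r \<inter> cball x0 (e / 4) \<noteq> {}"
        then obtain y where y: "dist (x + s *\<^sub>R n) y \<le> r" "dist x0 y \<le> e / 4" by auto
        have sn: "dist x (x + s *\<^sub>R n) = s" using s tn by (simp add: dist_norm)
        have x0: "dist x0 (x + s *\<^sub>R n) \<le> e / 4 + r"
          using y dist_triangle[of x0 "x + s *\<^sub>R n" y] by (simp add: dist_commute)
        then have "dist x0 x \<le> e / 4 + r + s"
          using sn dist_triangle[of x0 x "x + s *\<^sub>R n"] by (simp add: dist_commute)
        then have "x \<in> ball x0 e" using rs s e by simp
        then have gx: "\<gamma> ((x - x0) \<bullet> t) < (x - x0) \<bullet> n" using epi x by blast
        show "cball (x + s *\<^sub>R n) r \<subseteq> \<Omega>"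
        proof
          fix z assume "z \<in> cball (x + s *\<^sub>R n) r"
          then have z: "dist (x + s *\<^sub>R n) z \<le> r" by simp
          then have "dist x0 z \<le> e / 4 + r + r" using x0 dist_triangle[of x0 z "x + s *\<^sub>R n"] by simp
          then have zb: "z \<in> ball x0 e" using rs s e by simp
          define w where "w = z - (x + s *\<^sub>R n)"
          have w: "norm w \<le> r" using z by (simp add: w_def dist_norm norm_minus_commute)
          have zw: "z - x0 = (x - x0) + s *\<^sub>R n + w" by (simp add: w_def)
          have nn: "n \<bullet> n = 1" using tn by (simp add: norm_eq_1)
          have zt: "(z - x0) \<bullet> t = (x - x0) \<bullet> t + w \<bullet> t"
            unfolding zw using inner_commute[of n t] tn(3) by (simp add: inner_add_left)
          have zn: "(z - x0) \<bullet> n = (x - x0) \<bullet> n + s + w \<bullet> n"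
            unfolding zw by (simp add: inner_add_left nn)
          have wt: "\<bar>w \<bullet> t\<bar> \<le> r" "\<bar>w \<bullet> n\<bar> \<le> r"
            using Cauchy_Schwarz_ineq2[of w t] Cauchy_Schwarz_ineq2[of w n] tn w by auto
          have "\<bar>\<gamma> ((z - x0) \<bullet> t) - \<gamma> ((x - x0) \<bullet> t)\<bar> \<le> L * \<bar>w \<bullet> t\<bar>"
            using lipschitz_onD[OF L, of "(z - x0) \<bullet> t" "(x - x0) \<bullet> t"] by (simp add: dist_real_def zt)
          also have "\<dots> \<le> L * r" using wt L0 by (intro mult_left_mono)
          finally have "\<gamma> ((z - x0) \<bullet> t) < (z - x0) \<bullet> n"
            using gx zn wt rL by linarith
          then show "z \<in> \<Omega>" using epi zb by blast
        qed
      qed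
    qed (use r in auto)
  qed
  then have "inward x0 (e / 4)" using e by (simp add: inward_def)
  then show thesis by (rule that)
qed

text \<open>Mollifying \<open>q\<close> and \<open>q'\<close> with one admissible kernel gives a
  function and its derivative on the whole domain, since wherever the kernel leaves the domain it
  misses the ball that carries \<open>q\<close>. The identity holds for each such kernel and passes
  to the limit.\<close>

lemma zero_trace_parts_local:
  assumes d: "has_trace \<Omega> E d (\<lambda>x. 0)" and x0: "inward x0 \<epsilon>" and q: "has_weak_partial \<Omega> i q q'" and i: "i \<in> Basis"
    and zero: "\<And>y. y \<in> \<Omega> \<Longrightarrow> y \<notin> cball x0 \<epsilon> \<Longrightarrow> q y = 0 \<and> q' y = 0"
  shows "(LINT x|lebesgue_on \<Omega>. weak_partial \<Omega> i d x * q x) + (LINT x|lebesgue_on \<Omega>. d x * q' x) = 0"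
proof -
  have dH: "d \<in> H1 \<Omega>" using d by (simp add: has_trace_def)
  have L: "q \<in> L2 (lebesgue_on \<Omega>)" "q' \<in> L2 (lebesgue_on \<Omega>)" using q by (auto simp: has_weak_partial_def)
  show ?thesis
  proof (rule mollify_sum_eq_0[OF H1_L2(2)[OF dH i] L(1) H1_L2(1)[OF dH] L(2)])
    fix \<eta> :: real assume "\<eta> > 0"
    then obtain c r where cr: "r > 0" "norm c + r \<le> \<eta>"
      "\<And>x. x \<in> \<Omega> \<Longrightarrow> cball (x + c) r \<subseteq> \<Omega> \<or> cball (x + c) r \<inter> cball x0 \<epsilon> = {}"
      using x0 unfolding inward_def by blast
    have "(LINT x|lebesgue_on \<Omega>. weak_partial \<Omega> i d x * mollified \<Omega> q c r x) +
        (LINT x|lebesgue_on \<Omega>. d x * mollified \<Omega> q' c r x) = 0"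
      using mollified_derivative[OF q i cr(1) zero cr(3)]
      by (intro zero_trace_parts_lipschitz[OF d] mollified_lipschitz L locally_lipschitz_continuous i) auto
    then show "\<exists>c r. r > 0 \<and> norm c + r \<le> \<eta> \<and>
      (LINT x|lebesgue_on \<Omega>. weak_partial \<Omega> i d x * (LINT y|lebesgue_on \<Omega>. q y * bump c r (y - x))) +
      (LINT x|lebesgue_on \<Omega>. d x * (LINT y|lebesgue_on \<Omega>. q' y * bump c r (y - x))) = 0"
      using cr(1,2) unfolding mollified_def bump_shift by blast
  qed
qed

text \<open>Multiplying successively by \<open>1 - \<theta>\<close> for cutoffs \<open>\<theta>\<close> does not change the left-hand side, and
  after finitely many steps nothing of the function is left in the domain.\<close>

lemma zero_trace_parts:
  assumes d: "has_trace \<Omega> E d (\<lambda>x. 0)" and p: "p \<in> H1 \<Omega>" and i: "i \<in> Basis"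
  shows "(LINT x|lebesgue_on \<Omega>. weak_partial \<Omega> i d x * p x) + (LINT x|lebesgue_on \<Omega>. d x * weak_partial \<Omega> i p x) = 0"
proof -
  have dH: "d \<in> H1 \<Omega>" using d by (simp add: has_trace_def)
  define B where "B q q' = (LINT x|lebesgue_on \<Omega>. weak_partial \<Omega> i d x * q x) + (LINT x|lebesgue_on \<Omega>. d x * q' x)" for q q'
  have "\<exists>\<epsilon>. inward x \<epsilon>" if "x \<in> closure \<Omega>" for x
  proof (cases "x \<in> \<Omega>")
    case False
    then have "x \<in> frontier \<Omega>" using that domain_open by (simp add: frontier_def interior_open)
    then show ?thesis using inward_frontier by blast
  qed (use inward_interior in blast)
  then obtain \<epsilon> where \<epsilon>: "\<And>x. x \<in> closure \<Omega> \<Longrightarrow> inward x (\<epsilon> x)" by metis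
  have "compact (closure \<Omega>)" using domain_bounded by (simp add: compact_closure)
  \<comment> \<open>Half radii, so that a cutoff can be 1 on a ball of the cover and still vanish
    outside the ball to which \<open>inward\<close> refers.\<close>
  moreover have "closure \<Omega> \<subseteq> (\<Union>x\<in>closure \<Omega>. ball x (\<epsilon> x / 2))"
  proof
    fix x assume "x \<in> closure \<Omega>"
    then show "x \<in> (\<Union>x\<in>closure \<Omega>. ball x (\<epsilon> x / 2))" using \<epsilon>[of x] by (intro UN_I[of x]) (auto simp: inward_def)
  qed
  ultimately obtain X where X: "X \<subseteq> closure \<Omega>" "finite X" "closure \<Omega> \<subseteq> (\<Union>x\<in>X. ball x (\<epsilon> x / 2))"
    by (rule compactE_image[OF _ open_ball])
  \<comment> \<open>A pair of a function and an explicit weak derivative is carried along, because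
    both must vanish pointwise on the balls already treated; the representative picked by
    \<open>weak_partial\<close> would do so only almost everywhere.\<close>
  have "\<exists>q q'. has_weak_partial \<Omega> i q q' \<and> B q q' = B p (weak_partial \<Omega> i p) \<and> (\<forall>x\<in>X. \<forall>y\<in>ball x (\<epsilon> x / 2). q y = 0 \<and> q' y = 0)"
    using X(2,1)
  proof (induction X rule: finite_induct)
    case empty
    then show ?case using H1_weak_partial[OF p i] by auto
  next
    case (insert a X)
    then obtain q q' where q: "has_weak_partial \<Omega> i q q'" "B q q' = B p (weak_partial \<Omega> i p)"
      "\<And>x y. x \<in> X \<Longrightarrow> y \<in> ball x (\<epsilon> x / 2) \<Longrightarrow> q y = 0 \<and> q' y = 0"
      by auto
    have L: "q \<in> L2 (lebesgue_on \<Omega>)" "q' \<in> L2 (lebesgue_on \<Omega>)" using q(1) by (auto simp: has_weak_partial_def)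
    have a: "inward a (\<epsilon> a)" "\<epsilon> a > 0" using \<epsilon> insert.prems by (auto simp: inward_def)
    obtain \<theta> where \<theta>: "smooth \<theta>" "\<And>x. x \<in> ball a (\<epsilon> a / 2) \<Longrightarrow> \<theta> x = 1" "\<And>x. x \<notin> ball a (\<epsilon> a) \<Longrightarrow> \<theta> x = 0"
      using cutoff_exists[of "\<epsilon> a / 2" "\<epsilon> a" a] a(2) by auto
    define \<zeta> where "\<zeta> x = 1 - \<theta> x" for x
    have \<zeta>: "smooth \<zeta>" unfolding \<zeta>_def by (intro smooth_diff smooth_const \<theta>)
    note w = has_weak_partial_mult[OF q(1) \<theta>(1) i] and w' = has_weak_partial_mult[OF q(1) \<zeta> i]
    have supp\<theta>: "closure {x. \<theta> x \<noteq> 0} \<subseteq> cball a (\<epsilon> a)"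
      using \<theta>(3) by (intro closure_minimal) (auto, force)
    have "closure {x. \<zeta> x \<noteq> 0} \<subseteq> - ball a (\<epsilon> a / 2)"
      using \<theta>(2) by (intro closure_minimal) (auto simp: \<zeta>_def)
    \<comment> \<open>A function that is zero on an open set has zero derivative there: such points
      lie outside the closure of its support. The same argument gives \<open>z2\<close>.\<close>
    then have z1: "pderiv_at \<zeta> i y = 0" "\<zeta> y = 0" if "y \<in> ball a (\<epsilon> a / 2)" for y
      using that \<theta>(2) by (blast intro: pderiv_eq_0_outside_support[OF \<zeta>], simp add: \<zeta>_def)
    have z2: "pderiv_at \<theta> i y = 0" "\<theta> y = 0" if "y \<notin> cball a (\<epsilon> a)" for y
      using that supp\<theta> \<theta>(3)[of y] by (blast intro: pderiv_eq_0_outside_support[OF \<theta>(1)], simp)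
    have split: "pderiv_at \<zeta> i x = - pderiv_at \<theta> i x" for x
    proof -
      have "(\<zeta> has_derivative (\<lambda>h. 0 - frechet_derivative \<theta> (at x) h)) (at x)"
        unfolding \<zeta>_def by (intro has_derivative_diff has_derivative_const smooth_has_derivative \<theta>)
      from fun_cong[OF frechet_derivative_at[OF this], of i] show ?thesis by simp
    qed
    have "B (\<lambda>x. \<theta> x * q x) (\<lambda>x. \<theta> x * q' x + pderiv_at \<theta> i x * q x) = 0"
      unfolding B_def by (rule zero_trace_parts_local[OF d a(1) w i]) (simp add: z2)
    moreover have "B q q' = B (\<lambda>x. \<theta> x * q x) (\<lambda>x. \<theta> x * q' x + pderiv_at \<theta> i x * q x) +
        B (\<lambda>x. \<zeta> x * q x) (\<lambda>x. \<zeta> x * q' x + pderiv_at \<zeta> i x * q x)"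
    proof -
      have dL: "weak_partial \<Omega> i d \<in> L2 (lebesgue_on \<Omega>)" "d \<in> L2 (lebesgue_on \<Omega>)" using H1_L2[OF dH] i by auto
      have wL: "(\<lambda>x. \<theta> x * q x) \<in> L2 (lebesgue_on \<Omega>)" "(\<lambda>x. \<theta> x * q' x + pderiv_at \<theta> i x * q x) \<in> L2 (lebesgue_on \<Omega>)"
        "(\<lambda>x. \<zeta> x * q x) \<in> L2 (lebesgue_on \<Omega>)" "(\<lambda>x. \<zeta> x * q' x + pderiv_at \<zeta> i x * q x) \<in> L2 (lebesgue_on \<Omega>)"
        using w w' by (auto simp: has_weak_partial_def)
      have "(LINT x|lebesgue_on \<Omega>. weak_partial \<Omega> i d x * q x) =
        (LINT x|lebesgue_on \<Omega>. weak_partial \<Omega> i d x * (\<theta> x * q x) + weak_partial \<Omega> i d x * (\<zeta> x * q x))"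
        by (simp add: \<zeta>_def algebra_simps)
      also have "\<dots> = (LINT x|lebesgue_on \<Omega>. weak_partial \<Omega> i d x * (\<theta> x * q x)) + (LINT x|lebesgue_on \<Omega>. weak_partial \<Omega> i d x * (\<zeta> x * q x))"
        by (rule Bochner_Integration.integral_add[OF L2_mult_integrable[OF dL(1) wL(1)] L2_mult_integrable[OF dL(1) wL(3)]])
      finally have 1: "(LINT x|lebesgue_on \<Omega>. weak_partial \<Omega> i d x * q x) = \<dots>" .
      have "(LINT x|lebesgue_on \<Omega>. d x * q' x) =
        (LINT x|lebesgue_on \<Omega>. d x * (\<theta> x * q' x + pderiv_at \<theta> i x * q x) + d x * (\<zeta> x * q' x + pderiv_at \<zeta> i x * q x))"
        unfolding split by (simp add: \<zeta>_def algebra_simps)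
      also have "\<dots> = (LINT x|lebesgue_on \<Omega>. d x * (\<theta> x * q' x + pderiv_at \<theta> i x * q x)) + (LINT x|lebesgue_on \<Omega>. d x * (\<zeta> x * q' x + pderiv_at \<zeta> i x * q x))"
        by (rule Bochner_Integration.integral_add[OF L2_mult_integrable[OF dL(2) wL(2)] L2_mult_integrable[OF dL(2) wL(4)]])
      finally show ?thesis unfolding B_def using 1 by simp
    qed
    ultimately show ?case
      using w' q(2,3) z1 by (intro exI[of _ "\<lambda>x. \<zeta> x * q x"] exI[of _ "\<lambda>x. \<zeta> x * q' x + pderiv_at \<zeta> i x * q x"]) auto
  qed
  then obtain q q' where q: "B q q' = B p (weak_partial \<Omega> i p)"
    "\<And>x y. x \<in> X \<Longrightarrow> y \<in> ball x (\<epsilon> x / 2) \<Longrightarrow> q y = 0 \<and> q' y = 0"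
    by blast
  have "q y = 0 \<and> q' y = 0" if "y \<in> \<Omega>" for y
    using q(2) X(3) closure_subset that by blast
  then have "B q q' = (LINT x|lebesgue_on \<Omega>. 0) + (LINT x|lebesgue_on \<Omega>. 0)"
    unfolding B_def by (intro arg_cong2[where f = "(+)"] Bochner_Integration.integral_cong) auto
  then show ?thesis using q(1) by (simp add: B_def)
qed

end

section \<open>The energy and the obstacle problem\<close>

text \<open>The bilinear form of the energy, split by coordinates because integration by parts works
  with one direction at a time.\<close>

definition dirichlet :: "'a::euclidean_space set \<Rightarrow> ('a \<Rightarrow> real) \<Rightarrow> ('a \<Rightarrow> real) \<Rightarrow> real" where
  "dirichlet \<Omega> u v = (\<Sum>i\<in>Basis. LINT x|lebesgue_on \<Omega>. weak_partial \<Omega> i u x * weak_partial \<Omega> i v x)"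

lemma dirichlet_commute: "dirichlet \<Omega> u v = dirichlet \<Omega> v u"
  by (simp add: dirichlet_def mult.commute)

context bounded_domain
begin

lemma dirichlet_lincomb:
  assumes u: "u \<in> H1 \<Omega>" and v: "v \<in> H1 \<Omega>" and w: "w \<in> H1 \<Omega>"
  shows "dirichlet \<Omega> (\<lambda>x. a * u x + b * v x) w = a * dirichlet \<Omega> u w + b * dirichlet \<Omega> v w"
proof -
  have "(LINT x|lebesgue_on \<Omega>. weak_partial \<Omega> i (\<lambda>x. a * u x + b * v x) x * weak_partial \<Omega> i w x) =
     a * (LINT x|lebesgue_on \<Omega>. weak_partial \<Omega> i u x * weak_partial \<Omega> i w x) +
     b * (LINT x|lebesgue_on \<Omega>. weak_partial \<Omega> i v x * weak_partial \<Omega> i w x)" if i: "i \<in> Basis" for i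
  proof -
    note L = H1_L2(2)[OF u i] H1_L2(2)[OF v i] H1_L2(2)[OF w i] H1_L2(2)[OF H1_lincomb[OF u v] i]
    have "(LINT x|lebesgue_on \<Omega>. weak_partial \<Omega> i (\<lambda>x. a * u x + b * v x) x * weak_partial \<Omega> i w x) =
       (LINT x|lebesgue_on \<Omega>. a * (weak_partial \<Omega> i u x * weak_partial \<Omega> i w x) + b * (weak_partial \<Omega> i v x * weak_partial \<Omega> i w x))"
    proof (rule integral_cong_AE)
      show "AE x in lebesgue_on \<Omega>. weak_partial \<Omega> i (\<lambda>x. a * u x + b * v x) x * weak_partial \<Omega> i w x =
         a * (weak_partial \<Omega> i u x * weak_partial \<Omega> i w x) + b * (weak_partial \<Omega> i v x * weak_partial \<Omega> i w x)"
        using weak_partial_lincomb[OF u v i, of a b] by eventually_elim (simp add: algebra_simps)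
    qed (use L[THEN L2D(1)] in measurable)
    then show ?thesis
      using L2_mult_integrable[OF L(1,3)] L2_mult_integrable[OF L(2,3)] by simp
  qed
  then show ?thesis by (simp add: dirichlet_def sum.distrib sum_distrib_left)
qed

lemma dirichlet_self_lincomb:
  assumes "u \<in> H1 \<Omega>" "v \<in> H1 \<Omega>"
  shows "dirichlet \<Omega> (\<lambda>x. a * u x + b * v x) (\<lambda>x. a * u x + b * v x) =
    a\<^sup>2 * dirichlet \<Omega> u u + 2 * a * b * dirichlet \<Omega> u v + b\<^sup>2 * dirichlet \<Omega> v v"
  using dirichlet_lincomb[OF assms H1_lincomb[OF assms], of a b a b]
    dirichlet_lincomb[OF assms assms(1), of a b] dirichlet_lincomb[OF assms assms(2), of a b]
  by (simp add: dirichlet_commute[of \<Omega> u "\<lambda>x. a * u x + b * v x"]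
      dirichlet_commute[of \<Omega> v "\<lambda>x. a * u x + b * v x"] dirichlet_commute[of \<Omega> v u]
      power2_eq_square algebra_simps)

text \<open>A sum of nonnegative integrals. The hypothesis is an inequality since that is what
  comparing energies yields.\<close>

lemma dirichlet_eq_0_imp:
  assumes u: "u \<in> H1 \<Omega>" and "dirichlet \<Omega> u u \<le> 0" and i: "i \<in> Basis"
  shows "AE x in lebesgue_on \<Omega>. weak_partial \<Omega> i u x = 0"
proof -
  have nn: "(LINT x|lebesgue_on \<Omega>. weak_partial \<Omega> j u x * weak_partial \<Omega> j u x) \<ge> 0" for j
    by (simp add: integral_nonneg_AE)
  have "(LINT x|lebesgue_on \<Omega>. weak_partial \<Omega> i u x * weak_partial \<Omega> i u x) \<le> dirichlet \<Omega> u u"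
    unfolding dirichlet_def using nn i by (intro member_le_sum) auto
  then have "(LINT x|lebesgue_on \<Omega>. weak_partial \<Omega> i u x * weak_partial \<Omega> i u x) = 0"
    using assms(2) nn[of i] by linarith
  then show ?thesis
    using integral_nonneg_eq_0_iff_AE[OF L2_mult_integrable[OF H1_L2(2)[OF u i] H1_L2(2)[OF u i]]] by simp
qed

end

section \<open>Comparison of the two energies, uniqueness, and the shift of solutions\<close>

context polygon
begin

lemma energy_eq:
  assumes "v \<in> H1 \<Omega>"
  shows "energy \<Omega> f v = 1/2 * dirichlet \<Omega> v v - (LINT x|lebesgue_on \<Omega>. f x * v x)"
proof -
  have "(LINT x|lebesgue_on \<Omega>. (norm (weak_grad \<Omega> v x))\<^sup>2) = dirichlet \<Omega> v v"
    unfolding weak_grad_norm_sq dirichlet_def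
    unfolding power2_eq_square
    using H1_L2(2)[OF assms] L2_mult_integrable by (intro Bochner_Integration.integral_sum) blast
  then show ?thesis by (simp add: energy_def)
qed

lemma energy_lincomb:
  assumes u: "u \<in> H1 \<Omega>" and v: "v \<in> H1 \<Omega>" and f: "f \<in> L2 (lebesgue_on \<Omega>)"
  shows "energy \<Omega> f (\<lambda>x. a * u x + b * v x) =
    1/2 * (a\<^sup>2 * dirichlet \<Omega> u u + 2 * a * b * dirichlet \<Omega> u v + b\<^sup>2 * dirichlet \<Omega> v v)
    - a * (LINT x|lebesgue_on \<Omega>. f x * u x) - b * (LINT x|lebesgue_on \<Omega>. f x * v x)"
proof -
  have "(LINT x|lebesgue_on \<Omega>. f x * (a * u x + b * v x)) =
      (LINT x|lebesgue_on \<Omega>. a * (f x * u x) + b * (f x * v x))"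
    by (simp add: algebra_simps)
  also have "\<dots> = a * (LINT x|lebesgue_on \<Omega>. f x * u x) + b * (LINT x|lebesgue_on \<Omega>. f x * v x)"
    using L2_mult_integrable[OF f H1_L2(1)[OF u]] L2_mult_integrable[OF f H1_L2(1)[OF v]] by simp
  finally show ?thesis
    unfolding energy_eq[OF H1_lincomb[OF u v]] dirichlet_self_lincomb[OF u v] by simp
qed

lemma weak_laplacian_L2:
  assumes "\<psi> \<in> H2 \<Omega>"
  shows "weak_laplacian \<Omega> \<psi> \<in> L2 (lebesgue_on \<Omega>)"
  using assms H1_L2(2) unfolding weak_laplacian_def[abs_def] by (intro L2_sum) (auto simp: H2_def)

text \<open>Integration by parts against each first derivative of \<open>\<psi>\<close>, which lies
  in \<open>H1\<close> because \<open>\<psi>\<close> is in \<open>H2\<close>, summed over the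
  coordinates.\<close>

lemma zero_trace_laplacian:
  assumes d: "has_trace \<Omega> E d (\<lambda>x. 0)" and \<psi>: "\<psi> \<in> H2 \<Omega>"
  shows "dirichlet \<Omega> d \<psi> + (LINT x|lebesgue_on \<Omega>. weak_laplacian \<Omega> \<psi> x * d x) = 0"
proof -
  have dH: "d \<in> H1 \<Omega>" using d by (simp add: has_trace_def)
  have H: "weak_partial \<Omega> i \<psi> \<in> H1 \<Omega>" if "i \<in> Basis" for i using \<psi> that by (simp add: H2_def)
  have "(LINT x|lebesgue_on \<Omega>. weak_laplacian \<Omega> \<psi> x * d x) =
      (LINT x|lebesgue_on \<Omega>. (\<Sum>i\<in>Basis. d x * weak_partial \<Omega> i (weak_partial \<Omega> i \<psi>) x))"
    by (simp add: weak_laplacian_def sum_distrib_left mult.commute)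
  also have "\<dots> = (\<Sum>i\<in>Basis. LINT x|lebesgue_on \<Omega>. d x * weak_partial \<Omega> i (weak_partial \<Omega> i \<psi>) x)"
    using L2_mult_integrable[OF H1_L2(1)[OF dH]] H H1_L2(2) by (intro Bochner_Integration.integral_sum) blast
  finally show ?thesis
    using zero_trace_parts[OF d H] by (simp add: dirichlet_def sum.distrib[symmetric])
qed

text \<open>The two functionals differ by a constant on functions with a fixed trace: their difference is
  the boundary integral of the trace against the normal derivative of \<open>\<psi>\<close>.\<close>

lemma energy_shift:
  assumes \<psi>: "\<psi> \<in> H2 \<Omega>" and f: "f \<in> L2 (lebesgue_on \<Omega>)"
    and u: "has_trace \<Omega> E u h" and v: "has_trace \<Omega> E v h"
  shows "energy \<Omega> f (\<lambda>x. u x + \<psi> x) - energy \<Omega> (\<lambda>x. f x + weak_laplacian \<Omega> \<psi> x) u =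
    energy \<Omega> f (\<lambda>x. v x + \<psi> x) - energy \<Omega> (\<lambda>x. f x + weak_laplacian \<Omega> \<psi> x) v"
proof -
  have \<psi>H: "\<psi> \<in> H1 \<Omega>" using \<psi> by (simp add: H2_def)
  have uv: "u \<in> H1 \<Omega>" "v \<in> H1 \<Omega>" using u v by (auto simp: has_trace_def)
  note lap = weak_laplacian_L2[OF \<psi>]
  \<comment> \<open>Expanding the square leaves a part linear in \<open>w\<close> and a part without
    \<open>w\<close>. The linear part has the same value at \<open>u\<close> and \<open>v\<close>,
    because it vanishes on their difference, which has trace zero.\<close>
  have diff: "energy \<Omega> f (\<lambda>x. w x + \<psi> x) - energy \<Omega> (\<lambda>x. f x + weak_laplacian \<Omega> \<psi> x) w =
     dirichlet \<Omega> w \<psi> + (LINT x|lebesgue_on \<Omega>. weak_laplacian \<Omega> \<psi> x * w x)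
     + (1/2 * dirichlet \<Omega> \<psi> \<psi> - (LINT x|lebesgue_on \<Omega>. f x * \<psi> x))" if w: "w \<in> H1 \<Omega>" for w
  proof -
    have "(LINT x|lebesgue_on \<Omega>. (f x + weak_laplacian \<Omega> \<psi> x) * w x) =
      (LINT x|lebesgue_on \<Omega>. f x * w x) + (LINT x|lebesgue_on \<Omega>. weak_laplacian \<Omega> \<psi> x * w x)"
      using L2_mult_integrable[OF f H1_L2(1)[OF w]] L2_mult_integrable[OF lap H1_L2(1)[OF w]]
      by (simp add: distrib_right)
    then show ?thesis
      using energy_lincomb[OF w \<psi>H f, of 1 1] energy_eq[OF w, of "\<lambda>x. f x + weak_laplacian \<Omega> \<psi> x"]
      by (simp add: add_divide_distrib)
  qed
  have "has_trace \<Omega> E (\<lambda>x. u x - v x) (\<lambda>x. 0)"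
    using has_trace_lincomb[OF bounded_domain u v, of 1 "- 1"] by simp
  from zero_trace_laplacian[OF this \<psi>]
  have "dirichlet \<Omega> (\<lambda>x. u x - v x) \<psi> + (LINT x|lebesgue_on \<Omega>. weak_laplacian \<Omega> \<psi> x * (u x - v x)) = 0" .
  moreover have "dirichlet \<Omega> (\<lambda>x. u x - v x) \<psi> = dirichlet \<Omega> u \<psi> - dirichlet \<Omega> v \<psi>"
    using dirichlet_lincomb[OF uv \<psi>H, of 1 "- 1"] by simp
  moreover have "(LINT x|lebesgue_on \<Omega>. weak_laplacian \<Omega> \<psi> x * (u x - v x)) =
     (LINT x|lebesgue_on \<Omega>. weak_laplacian \<Omega> \<psi> x * u x) - (LINT x|lebesgue_on \<Omega>. weak_laplacian \<Omega> \<psi> x * v x)"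
    using L2_mult_integrable[OF lap H1_L2(1)[OF uv(1)]] L2_mult_integrable[OF lap H1_L2(1)[OF uv(2)]]
    by (simp add: right_diff_distrib)
  ultimately show ?thesis using diff[OF uv(1)] diff[OF uv(2)] by linarith
qed

text \<open>Integration by parts against the product of a coordinate and \<open>d\<close>, whose weak derivative is \<open>d\<close>.\<close>

lemma zero_trace_zero_gradient:
  assumes d: "has_trace \<Omega> E d (\<lambda>x. 0)" and le: "dirichlet \<Omega> d d \<le> 0"
  shows "AE x in lebesgue_on \<Omega>. d x = 0"
proof -
  have dH: "d \<in> H1 \<Omega>" using d by (simp add: has_trace_def)
  obtain i :: "real^2" where i: "i \<in> Basis" using nonempty_Basis by blast
  note zero = dirichlet_eq_0_imp[OF dH le i]
  let ?p = "\<lambda>x. (x \<bullet> i) * d x"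
  have pH: "?p \<in> H1 \<Omega>" by (intro H1_mult dH smooth_inner)
  have pd: "pderiv_at (\<lambda>x. x \<bullet> i) i x = 1" for x
  proof -
    have "((\<lambda>x. x \<bullet> i) has_derivative (\<lambda>h. h \<bullet> i)) (at x)" by (auto intro!: derivative_eq_intros)
    from fun_cong[OF frechet_derivative_at[OF this], of i] show ?thesis using i by simp
  qed
  have "AE x in lebesgue_on \<Omega>. weak_partial \<Omega> i ?p x = d x"
    using weak_partial_AE[OF has_weak_partial_mult[OF H1_weak_partial[OF dH i] smooth_inner[of i] i]] zero
    by eventually_elim (simp add: pd)
  then have "(LINT x|lebesgue_on \<Omega>. d x * weak_partial \<Omega> i ?p x) = (LINT x|lebesgue_on \<Omega>. d x * d x)"
    using L2D(1)[OF H1_L2(1)[OF dH]] L2D(1)[OF H1_L2(2)[OF pH i]]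
    by (intro integral_cong_AE borel_measurable_times) auto
  moreover have "(LINT x|lebesgue_on \<Omega>. weak_partial \<Omega> i d x * ?p x) = (LINT x|lebesgue_on \<Omega>. 0)"
    using borel_measurable_times[OF L2D(1)[OF H1_L2(2)[OF dH i]] L2D(1)[OF H1_L2(1)[OF pH]]] zero
    by (intro integral_cong_AE) auto
  ultimately have "(LINT x|lebesgue_on \<Omega>. d x * d x) = 0"
    using zero_trace_parts[OF d pH i] by simp
  then show ?thesis
    using integral_nonneg_eq_0_iff_AE[OF L2_mult_integrable[OF H1_L2(1)[OF dH] H1_L2(1)[OF dH]]] by simp
qed

lemma solves_obstacle_unique:
  assumes f: "f \<in> L2 (lebesgue_on \<Omega>)" and u: "solves_obstacle \<Omega> E \<psi> g f u" and v: "solves_obstacle \<Omega> E \<psi> g f v"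
  shows "AE x in lebesgue_on \<Omega>. u x = v x"
proof -
  have uH: "u \<in> H1 \<Omega>" "v \<in> H1 \<Omega>" and tr: "has_trace \<Omega> E u g" "has_trace \<Omega> E v g"
    and ge: "AE x in lebesgue_on \<Omega>. \<psi> x \<le> u x" "AE x in lebesgue_on \<Omega>. \<psi> x \<le> v x"
    using u v by (auto simp: solves_obstacle_def obstacle_set_def)
  let ?m = "\<lambda>x. 1/2 * u x + 1/2 * v x"
  \<comment> \<open>The arithmetic of strict convexity: A, B, C stand for the Dirichlet forms of
    (u,u), (u,v), (v,v) and F, G for the load terms. Adding the two comparisons with the midpoint
    cancels F and G.\<close>
  have midpoint: "A - 2 * B + C \<le> 0"
    if "1/2 * A - F \<le> 1/2 * ((1/2)\<^sup>2 * A + 2 * (1/2) * (1/2) * B + (1/2)\<^sup>2 * C) - 1/2 * F - 1/2 * G"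
      "1/2 * C - G \<le> 1/2 * ((1/2)\<^sup>2 * A + 2 * (1/2) * (1/2) * B + (1/2)\<^sup>2 * C) - 1/2 * F - 1/2 * G"
    for A B C F G :: real
    using that by (simp add: power2_eq_square field_simps)
  have "has_trace \<Omega> E ?m g"
    using has_trace_lincomb[OF bounded_domain tr, of "1/2" "1/2"] by simp
  moreover have "AE x in lebesgue_on \<Omega>. \<psi> x \<le> ?m x" using ge by eventually_elim simp
  ultimately have "?m \<in> obstacle_set \<Omega> E \<psi> g"
    using H1_lincomb[OF uH, of "1/2" "1/2"] by (simp add: obstacle_set_def)
  then have "energy \<Omega> f u \<le> energy \<Omega> f ?m" "energy \<Omega> f v \<le> energy \<Omega> f ?m"
    using u v unfolding solves_obstacle_def by blast+
  then have "dirichlet \<Omega> u u - 2 * dirichlet \<Omega> u v + dirichlet \<Omega> v v \<le> 0"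
    unfolding energy_lincomb[OF uH f] energy_eq[OF uH(1)] energy_eq[OF uH(2)] by (rule midpoint)
  then have "dirichlet \<Omega> (\<lambda>x. u x - v x) (\<lambda>x. u x - v x) \<le> 0"
    using dirichlet_self_lincomb[OF uH, of 1 "- 1"] by simp
  moreover have "has_trace \<Omega> E (\<lambda>x. u x - v x) (\<lambda>x. 0)"
    using has_trace_lincomb[OF bounded_domain tr, of 1 "- 1"] by simp
  ultimately have "AE x in lebesgue_on \<Omega>. u x - v x = 0" using zero_trace_zero_gradient by blast
  then show ?thesis by simp
qed

lemma obstacle_set_shift:
  assumes \<psi>: "has_trace \<Omega> E \<psi> \<psi>\<Gamma>"
  shows "u \<in> obstacle_set \<Omega> E (\<lambda>x. 0) (\<lambda>x. g x - \<psi>\<Gamma> x) \<Longrightarrow> (\<lambda>x. u x + \<psi> x) \<in> obstacle_set \<Omega> E \<psi> g"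
    and "v \<in> obstacle_set \<Omega> E \<psi> g \<Longrightarrow> (\<lambda>x. v x - \<psi> x) \<in> obstacle_set \<Omega> E (\<lambda>x. 0) (\<lambda>x. g x - \<psi>\<Gamma> x)"
proof -
  assume "u \<in> obstacle_set \<Omega> E (\<lambda>x. 0) (\<lambda>x. g x - \<psi>\<Gamma> x)"
  then have u: "has_trace \<Omega> E u (\<lambda>x. g x - \<psi>\<Gamma> x)" "AE x in lebesgue_on \<Omega>. 0 \<le> u x"
    by (auto simp: obstacle_set_def)
  have "has_trace \<Omega> E (\<lambda>x. u x + \<psi> x) g"
    using has_trace_lincomb[OF bounded_domain u(1) \<psi>, of 1 1] by simp
  then show "(\<lambda>x. u x + \<psi> x) \<in> obstacle_set \<Omega> E \<psi> g"
    using u(2) by (simp add: obstacle_set_def has_trace_def)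
next
  assume "v \<in> obstacle_set \<Omega> E \<psi> g"
  then have v: "has_trace \<Omega> E v g" "AE x in lebesgue_on \<Omega>. \<psi> x \<le> v x"
    by (auto simp: obstacle_set_def)
  have "has_trace \<Omega> E (\<lambda>x. v x - \<psi> x) (\<lambda>x. g x - \<psi>\<Gamma> x)"
    using has_trace_lincomb[OF bounded_domain v(1) \<psi>, of 1 "- 1"] by simp
  then show "(\<lambda>x. v x - \<psi> x) \<in> obstacle_set \<Omega> E (\<lambda>x. 0) (\<lambda>x. g x - \<psi>\<Gamma> x)"
    using v(2) by (simp add: obstacle_set_def has_trace_def)
qed

lemma solves_obstacle_shift:
  assumes \<psi>: "\<psi> \<in> H2 \<Omega>" and tr: "has_trace \<Omega> E \<psi> \<psi>\<Gamma>" and f: "f \<in> L2 (lebesgue_on \<Omega>)"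
  shows "solves_obstacle \<Omega> E (\<lambda>x. 0) (\<lambda>x. g x - \<psi>\<Gamma> x) (\<lambda>x. f x + weak_laplacian \<Omega> \<psi> x) u \<longleftrightarrow>
    solves_obstacle \<Omega> E \<psi> g f (\<lambda>x. u x + \<psi> x)"
    (is "solves_obstacle \<Omega> E _ ?g ?f u \<longleftrightarrow> _")
proof -
  \<comment> \<open>Competitors share the trace, so their energies in the two problems differ by one
    constant and are ordered alike.\<close>
  have le: "energy \<Omega> ?f a \<le> energy \<Omega> ?f b \<longleftrightarrow> energy \<Omega> f (\<lambda>x. a x + \<psi> x) \<le> energy \<Omega> f (\<lambda>x. b x + \<psi> x)"
    if "a \<in> obstacle_set \<Omega> E (\<lambda>x. 0) ?g" "b \<in> obstacle_set \<Omega> E (\<lambda>x. 0) ?g" for a b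
    using that energy_shift[OF \<psi> f, of a ?g b] by (auto simp: obstacle_set_def)
  show ?thesis
  proof
    assume u: "solves_obstacle \<Omega> E (\<lambda>x. 0) ?g ?f u"
    then have uo: "u \<in> obstacle_set \<Omega> E (\<lambda>x. 0) ?g" by (simp add: solves_obstacle_def)
    show "solves_obstacle \<Omega> E \<psi> g f (\<lambda>x. u x + \<psi> x)"
      unfolding solves_obstacle_def
    proof (intro conjI ballI)
      show "(\<lambda>x. u x + \<psi> x) \<in> obstacle_set \<Omega> E \<psi> g" by (rule obstacle_set_shift(1)[OF tr uo])
      fix v assume "v \<in> obstacle_set \<Omega> E \<psi> g"
      note vo = obstacle_set_shift(2)[OF tr this]
      have "energy \<Omega> ?f u \<le> energy \<Omega> ?f (\<lambda>x. v x - \<psi> x)" using u vo by (simp add: solves_obstacle_def)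
      then show "energy \<Omega> f (\<lambda>x. u x + \<psi> x) \<le> energy \<Omega> f v" using le[OF uo vo] by simp
    qed
  next
    assume u: "solves_obstacle \<Omega> E \<psi> g f (\<lambda>x. u x + \<psi> x)"
    then have uo: "u \<in> obstacle_set \<Omega> E (\<lambda>x. 0) ?g"
      using obstacle_set_shift(2)[OF tr, of "\<lambda>x. u x + \<psi> x" g] by (simp add: solves_obstacle_def)
    show "solves_obstacle \<Omega> E (\<lambda>x. 0) ?g ?f u"
      unfolding solves_obstacle_def
    proof (intro conjI ballI uo)
      fix w assume wo: "w \<in> obstacle_set \<Omega> E (\<lambda>x. 0) ?g"
      have "energy \<Omega> f (\<lambda>x. u x + \<psi> x) \<le> energy \<Omega> f (\<lambda>x. w x + \<psi> x)"
        using u obstacle_set_shift(1)[OF tr wo] by (simp add: solves_obstacle_def)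
      then show "energy \<Omega> ?f u \<le> energy \<Omega> ?f w" using le[OF uo wo] by simp
    qed
  qed
qed

end

theorem proposition4:
  fixes \<Omega> :: "(real^2) set" and E :: "((real^2) \<times> (real^2)) set"
    and \<psi> \<psi>\<Gamma> g f :: "real^2 \<Rightarrow> real"
  assumes "polygonal_domain \<Omega> E"
    and "\<psi> \<in> H2 \<Omega>"
    and "has_trace \<Omega> E \<psi> \<psi>\<Gamma>"
    and "g \<in> H_half \<Omega> E"
    and "AE x in boundary_measure E. \<psi>\<Gamma> x \<le> g x"
    and "f \<in> L2 (lebesgue_on \<Omega>)"
  shows "((\<lambda>x. g x - \<psi>\<Gamma> x) \<in> H_half \<Omega> E \<and>
      (AE x in boundary_measure E. 0 \<le> g x - \<psi>\<Gamma> x) \<and>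
      (\<lambda>x. f x + weak_laplacian \<Omega> \<psi> x) \<in> L2 (lebesgue_on \<Omega>)) \<and>
    (\<forall>u. solves_obstacle \<Omega> E (\<lambda>x. 0) (\<lambda>x. g x - \<psi>\<Gamma> x) (\<lambda>x. f x + weak_laplacian \<Omega> \<psi> x) u \<longrightarrow>
       solves_obstacle \<Omega> E \<psi> g f (\<lambda>x. u x + \<psi> x) \<and>
       (\<forall>w. solves_obstacle \<Omega> E \<psi> g f w \<longrightarrow> (AE x in lebesgue_on \<Omega>. w x = u x + \<psi> x))) \<and>
    (\<forall>u. solves_obstacle \<Omega> E \<psi> g f u \<longrightarrow>
       solves_obstacle \<Omega> E (\<lambda>x. 0) (\<lambda>x. g x - \<psi>\<Gamma> x) (\<lambda>x. f x + weak_laplacian \<Omega> \<psi> x)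
         (\<lambda>x. u x - \<psi> x))"
proof -
  interpret polygon \<Omega> E by (rule polygon.intro) (rule assms(1))
  note shift = solves_obstacle_shift[OF assms(2,3,6)]
  obtain v where "v \<in> H1 \<Omega>" and v: "has_trace \<Omega> E v g" using assms(4) by (auto simp: H_half_def)
  have "has_trace \<Omega> E (\<lambda>x. v x - \<psi> x) (\<lambda>x. g x - \<psi>\<Gamma> x)"
    using has_trace_lincomb[OF bounded_domain v assms(3), of 1 "- 1"] by simp
  then have "(\<lambda>x. g x - \<psi>\<Gamma> x) \<in> H_half \<Omega> E"
    unfolding H_half_def has_trace_def by blast
  moreover have "AE x in boundary_measure E. 0 \<le> g x - \<psi>\<Gamma> x" using assms(5) by simp
  moreover have "(\<lambda>x. f x + weak_laplacian \<Omega> \<psi> x) \<in> L2 (lebesgue_on \<Omega>)"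
    by (intro L2_add assms(6) weak_laplacian_L2 assms(2))
  moreover have "AE x in lebesgue_on \<Omega>. w x = u x + \<psi> x"
    if "solves_obstacle \<Omega> E \<psi> g f (\<lambda>x. u x + \<psi> x)" "solves_obstacle \<Omega> E \<psi> g f w" for u w
    using solves_obstacle_unique[OF assms(6) that(2,1)] .
  moreover have "solves_obstacle \<Omega> E (\<lambda>x. 0) (\<lambda>x. g x - \<psi>\<Gamma> x) (\<lambda>x. f x + weak_laplacian \<Omega> \<psi> x) (\<lambda>x. u x - \<psi> x)"
    if "solves_obstacle \<Omega> E \<psi> g f u" for u
    \<comment> \<open>The shift is an equivalence; its converse direction is used at the difference,
      to which adding \<open>\<psi>\<close> gives back \<open>u\<close>.\<close>
    using that shift[of g "\<lambda>x. u x - \<psi> x"] by simp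
  ultimately show ?thesis using shift[of g] by blast
qed

end
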